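(* Let $k$ and $n$ be integers with $k\geq 1$ and $n\geq N+\frac{3}{2}\sqrt{2N-6}$, where $N=\max\{2.67\times 9^{17},\,10.2\times 2^{2k-4}+2\}$. Then $\mathrm{SPEX}_{\mathcal{P}}(n,(k+1)K_2)=\{M_{n,k}\}$, where $$M_{n,k}=\begin{cases}K_{1,n-1}, & \text{if } k=1,\\ K_2+(n-2)K_1, & \text{if } k=2,\\ K_2+(P_{2k-3}\cup(n-2k+1)K_1), & \text{if } k\geq 3.\end{cases}$$ In particular, $M_{n,k}$ is the unique graph (up to isomorphism) attaining the maximum spectral radius among all planar graphs of order $n$ with matching number $k$.
   Context: All graphs are finite, simple and undirected. The spectral radius $\rho(G)$ is the largest eigenvalue of the adjacency matrix of $G$. A graph is $F$-free if it has no (not necessarily induced) subgraph isomorphic to $F$. $\mathrm{SPEX}_{\mathcal{P}}(n,F)$ denotes the set of graphs (up to isomorphism) attaining the maximum spectral radius among all $F$-free planar graphs on $n$ vertices. $P_m$ and $K_m$ are the path and complete graph on $m$ vertices; $G\cup H$ is the disjoint union and $mG$ is the disjoint union of $m$ copies of $G$ (so $(k+1)K_2$ consists of $k+1$ independent edges). The join $G+H$ is obtained from the disjoint union $G\cup H$ by adding all possible edges between $G$ and $H$. The matching number of a graph is the maximum size of a set of pairwise independent edges. *)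

theory Defs
  imports
    "HOL-Analysis.Analysis"
    "HOL-Library.Nat_Bijection"
    "Jordan_Normal_Form.Char_Poly"
begin

section \<open>Finite simple graphs\<close>

type_synonym 'a ugraph = "'a set \<times> 'a set set"

abbreviation vertices :: "'a ugraph \<Rightarrow> 'a set" where "vertices G \<equiv> fst G"
abbreviation edges :: "'a ugraph \<Rightarrow> 'a set set" where "edges G \<equiv> snd G"

definition simple_graph :: "'a ugraph \<Rightarrow> bool" where
  "simple_graph G \<longleftrightarrow>
     finite (vertices G) \<and>
     edges G \<subseteq> {{u, v} | u v. u \<in> vertices G \<and> v \<in> vertices G \<and> u \<noteq> v}"

definition isomorphic :: "'a ugraph \<Rightarrow> 'b ugraph \<Rightarrow> bool" where
  "isomorphic G H \<longleftrightarrow>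
     (\<exists>f. bij_betw f (vertices G) (vertices H) \<and> (\<lambda>e. f ` e) ` edges G = edges H)"

definition is_subgraph :: "'a ugraph \<Rightarrow> 'a ugraph \<Rightarrow> bool" where
  "is_subgraph H G \<longleftrightarrow>
     simple_graph H \<and> vertices H \<subseteq> vertices G \<and> edges H \<subseteq> edges G"

definition free_of :: "'b ugraph \<Rightarrow> 'a ugraph \<Rightarrow> bool" where
  "free_of F G \<longleftrightarrow> \<not> (\<exists>H. is_subgraph H G \<and> isomorphic H F)"

definition matching :: "'a ugraph \<Rightarrow> 'a set set \<Rightarrow> bool" where
  "matching G M \<longleftrightarrow> M \<subseteq> edges G \<and> pairwise disjnt M"

definition matching_number :: "'a ugraph \<Rightarrow> nat" where
  "matching_number G = Max (card ` {M. matching G M})"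

text \<open>A graph is planar if it can be drawn in the plane: \<open>p\<close> places the vertices at distinct
  points, \<open>c e\<close> is a simple arc joining the two ends of the edge \<open>e\<close> and meeting no other
  vertex, and arcs of different edges meet only in the points of common end vertices.\<close>

definition planar :: "'a ugraph \<Rightarrow> bool" where
  "planar G \<longleftrightarrow>
     (\<exists>(p :: 'a \<Rightarrow> complex) (c :: 'a set \<Rightarrow> real \<Rightarrow> complex).
        inj_on p (vertices G) \<and>
        (\<forall>e\<in>edges G. arc (c e) \<and> {pathstart (c e), pathfinish (c e)} = p ` e \<and>
                      path_image (c e) \<inter> p ` vertices G = p ` e) \<and>
        (\<forall>e\<in>edges G. \<forall>e'\<in>edges G. e \<noteq> e' \<longrightarrow>
                      path_image (c e) \<inter> path_image (c e') = p ` (e \<inter> e')))"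


section \<open>Spectral radius\<close>

text \<open>The vertices are listed in increasing order to index rows and columns. The adjacency matrix
  of a finite graph is real symmetric, so all its eigenvalues are real; the maximum is over a
  nonempty finite set whenever the graph has a vertex.\<close>

definition adjacency_matrix :: "'a :: linorder ugraph \<Rightarrow> real Matrix.mat" where
  "adjacency_matrix G =
     (let vs = sorted_list_of_set (vertices G); n = card (vertices G)
      in Matrix.mat n n (\<lambda>(i, j). if {vs ! i, vs ! j} \<in> edges G then 1 else 0))"

definition graph_spectral_radius :: "'a :: linorder ugraph \<Rightarrow> real" where
  "graph_spectral_radius G = Max {x. eigenvalue (adjacency_matrix G) x}"


section \<open>Constructions\<close>

text \<open>All graphs built here have natural numbers as vertices; the bijections \<open>sum_encode\<close> and
  \<open>prod_encode\<close> keep the vertices of different components apart.\<close>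

definition relabel :: "('a \<Rightarrow> 'b) \<Rightarrow> 'a ugraph \<Rightarrow> 'b ugraph" where
  "relabel f G = (f ` vertices G, (\<lambda>e. f ` e) ` edges G)"

definition complete_graph :: "nat \<Rightarrow> nat ugraph" where
  "complete_graph m = ({..<m}, {{i, j} | i j. i < m \<and> j < m \<and> i \<noteq> j})"

definition path_graph :: "nat \<Rightarrow> nat ugraph" where
  "path_graph m = ({..<m}, {{i, Suc i} | i. Suc i < m})"

definition complete_bipartite :: "nat \<Rightarrow> nat \<Rightarrow> nat ugraph" where
  "complete_bipartite s t =
     (sum_encode ` ({..<s} <+> {..<t}),
      {{sum_encode (Inl i), sum_encode (Inr j)} | i j. i < s \<and> j < t})"

definition disjoint_union :: "nat ugraph \<Rightarrow> nat ugraph \<Rightarrow> nat ugraph" where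
  "disjoint_union G H =
     (let G' = relabel (\<lambda>u. sum_encode (Inl u)) G; H' = relabel (\<lambda>v. sum_encode (Inr v)) H
      in (vertices G' \<union> vertices H', edges G' \<union> edges H'))"

definition graph_join :: "nat ugraph \<Rightarrow> nat ugraph \<Rightarrow> nat ugraph" where
  "graph_join G H =
     (vertices (disjoint_union G H),
      edges (disjoint_union G H) \<union>
      {{sum_encode (Inl u), sum_encode (Inr v)} | u v. u \<in> vertices G \<and> v \<in> vertices H})"

definition copies :: "nat \<Rightarrow> nat ugraph \<Rightarrow> nat ugraph" where
  "copies m G =
     (\<Union>i<m. vertices (relabel (\<lambda>v. prod_encode (i, v)) G),
      \<Union>i<m. edges (relabel (\<lambda>v. prod_encode (i, v)) G))"


section \<open>Spectral extremal graphs\<close>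

text \<open>Every finite graph is isomorphic to one whose vertices are natural numbers, so classes of
  such graphs represent all finite graphs up to isomorphism.\<close>

definition iso_class :: "nat ugraph \<Rightarrow> nat ugraph set" where
  "iso_class G = {H. simple_graph H \<and> isomorphic H G}"

definition planar_graphs :: "nat \<Rightarrow> nat ugraph set" where
  "planar_graphs n = {G. simple_graph G \<and> card (vertices G) = n \<and> planar G}"

definition spectral_maximizers :: "nat ugraph set \<Rightarrow> nat ugraph set" where
  "spectral_maximizers \<G> = {G \<in> \<G>. \<forall>H\<in>\<G>. graph_spectral_radius H \<le> graph_spectral_radius G}"

definition SPEX_planar :: "nat \<Rightarrow> nat ugraph \<Rightarrow> nat ugraph set set" where
  "SPEX_planar n F = iso_class ` spectral_maximizers {G \<in> planar_graphs n. free_of F G}"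

definition M_graph :: "nat \<Rightarrow> nat \<Rightarrow> nat ugraph" where
  "M_graph n k =
     (if k = 1 then complete_bipartite 1 (n - 1)
      else if k = 2 then graph_join (complete_graph 2) (copies (n - 2) (complete_graph 1))
      else graph_join (complete_graph 2)
             (disjoint_union (path_graph (2 * k - 3)) (copies (n + 1 - 2 * k) (complete_graph 1))))"

end

theory Submission
  imports Defs "Jordan_Normal_Form.Spectral_Radius"
begin

text \<open>Let \<open>G\<close> be planar of order \<open>n\<close> with matching number at most \<open>k\<close>, where \<open>k \<ge> 2\<close>, and suppose
that its spectral radius \<open>\<mu>\<close> is at least that of the graph \<open>M = M_graph n k\<close>. The vertices of a maximum matching form a
vertex cover \<open>S\<close> with at most \<open>2 * k\<close> elements, which is tiny compared with \<open>n\<close>. Planarity is used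
through two forbidden configurations: \<open>K33\<close>, and a cycle all of whose vertices are adjacent to both
ends of one edge (a subdivided \<open>K5\<close>). Both are excluded by one topological fact: two disjoint chords of a
closed curve whose ends alternate lie on different sides of the curve (\<open>crossing_chords\<close>).

\<^bold>\<open>Two dominating vertices.\<close> Since \<open>M\<close> contains the join of \<open>K2\<close> with \<open>n - 2\<close> isolated vertices,
\<open>\<mu>\<^sup>2 - \<mu> \<ge> 2 * (n - 2)\<close>. As \<open>G\<close> has no \<open>K33\<close>, all but \<open>O(k\<^sup>3)\<close> vertices outside \<open>S\<close> have at most two
neighbours. Counting walks of length two from the vertex with the largest eigenvector entry, the
lower bound on \<open>\<mu>\<close> forces two vertices \<open>u\<close>, \<open>v\<close> of \<open>S\<close> to have almost all vertices as common neighbours;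
the entries at all other vertices are then small. A second count shows that every vertex that is not
adjacent to both \<open>u\<close> and \<open>v\<close> costs more than all edges that avoid \<open>u\<close> and \<open>v\<close> can contribute. Hence
\<open>u\<close> and \<open>v\<close> are adjacent and every other vertex is adjacent to both (\<open>hub_pair_exists\<close>).

\<^bold>\<open>The rest is one path.\<close> So \<open>G\<close> is the join of \<open>K2\<close> with a graph \<open>H\<close>. Excluding \<open>K33\<close> and the subdivided
\<open>K5\<close>, \<open>H\<close> is a disjoint union of paths, and since \<open>u\<close> and \<open>v\<close> can always be matched outside, \<open>H\<close> has
matching number at most \<open>k - 2\<close>, hence at most \<open>2 * (k - 2)\<close> edges. The spectral radius of the join is
the largest root \<open>x\<close> of \<open>x - 1 = 2 * (W0 / x + W1 / x\<^sup>2 + W2 / x\<^sup>3 + ...)\<close>, where \<open>Wi\<close> is the number of walks with \<open>i\<close>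
edges in \<open>H\<close>. Here \<open>W0 = n - 2\<close>, \<open>W1\<close> is twice the number of edges, and \<open>W2\<close>, the sum of the squared
degrees, is four times the number of edges minus the number of leaves. Because \<open>x\<close> is huge compared with
\<open>k\<close>, the graphs are ordered by \<open>W1\<close> first and by \<open>W2\<close> next, and a single path with
\<open>2 * (k - 2)\<close> edges is the only maximum (\<open>model_graph_extremal\<close>). For \<open>k = 1\<close> all edges meet pairwise,
so the graph is contained in a star or in a triangle, up to isolated vertices (\<open>star_graph_extremal\<close>).

\<^bold>\<open>Spectral method.\<close> Everything spectral is expressed by subsolutions: nonnegative functions \<open>y\<close> on the
vertices with \<open>\<mu> * y v\<close> at most the sum of \<open>y\<close> over the neighbours of \<open>v\<close>. The absolute value of an
eigenvector is one for the spectral radius (\<open>spectral_radius_subsolution\<close>), and any nonzero one proves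
that \<open>\<mu>\<close> is at most the spectral radius (\<open>spectral_radius_ge_of_subsolution\<close>).\<close>

section \<open>Arcs and crossing chords of closed curves\<close>

definition joins :: "complex set \<Rightarrow> complex \<Rightarrow> complex \<Rightarrow> bool" where
  "joins X a b \<longleftrightarrow> (\<exists>g. arc g \<and> path_image g = X \<and> pathstart g = a \<and> pathfinish g = b)"

lemma joins_sym: "joins X a b \<Longrightarrow> joins X b a"
  unfolding joins_def by (metis arc_reversepath path_image_reversepath pathstart_reversepath pathfinish_reversepath)

lemma joins_trans:
  assumes "joins X a b" "joins Y b c" "X \<inter> Y = {b}"
  shows "joins (X \<union> Y) a c"
proof -
  obtain g h where "arc g" "path_image g = X" "pathstart g = a" "pathfinish g = b"
    and "arc h" "path_image h = Y" "pathstart h = b" "pathfinish h = c"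
    using assms unfolding joins_def by blast
  then have "arc (g +++ h)" "path_image (g +++ h) = X \<union> Y" "pathstart (g +++ h) = a" "pathfinish (g +++ h) = c"
    using assms(3) by (auto intro!: arc_join simp: path_image_join)
  then show ?thesis unfolding joins_def by blast
qed

lemma joins_endpoints: "joins X a b \<Longrightarrow> a \<in> X \<and> b \<in> X \<and> a \<noteq> b"
  unfolding joins_def by (metis arc_distinct_ends pathfinish_in_path_image pathstart_in_path_image)

lemma joins_compact: "joins X a b \<Longrightarrow> compact X"
  unfolding joins_def by (metis arc_imp_path compact_path_image)

lemma joins_connected: "joins X a b \<Longrightarrow> connected X"
  unfolding joins_def by (metis arc_imp_path connected_path_image)

lemma joins_connected_open: "joins X a b \<Longrightarrow> connected (X - {a, b}) \<and> X - {a, b} \<noteq> {}"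
  unfolding joins_def
  by (metis arc_imp_simple_path connected_simple_path_endless nonempty_simple_path_endless)

lemma joins_connected_half_open:
  assumes "joins X a b"
  shows "connected (X - {b})"
proof -
  obtain g where g: "arc g" "path_image g = X" "pathstart g = a" "pathfinish g = b"
    using assms unfolding joins_def by blast
  have inj: "inj_on g {0..1}" and cont: "continuous_on {0..1} g"
    using g(1) by (auto simp: arc_def path_def)
  have "X - {b} = g ` ({0..1} - {1})"
    using inj g unfolding path_image_def pathfinish_def
    by (subst inj_on_image_set_diff [of g "{0..1}"]) auto
  also have "{0..1} - {1} = {0..<1::real}" by auto
  finally have "X - {b} = g ` {0..<1}" .
  moreover have "continuous_on {0..<1} g"
    using cont by (rule continuous_on_subset) auto
  ultimately show ?thesis
    by (simp add: connected_continuous_image)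
qed

text \<open>The Jordan curve theorem for the closed curve formed by two arcs with common ends. The two sides
play symmetric roles below, so it is not recorded which of them is bounded.\<close>

lemma Jordan_sides:
  assumes A: "joins A a c" and B: "joins B a c" and AB: "A \<inter> B = {a, c}"
  obtains F G where "open F" "connected F" "open G" "connected G" "F \<inter> G = {}"
    "F \<union> G = - (A \<union> B)" "frontier F = A \<union> B" "frontier G = A \<union> B"
proof -
  obtain g where g: "arc g" "path_image g = A" "pathstart g = a" "pathfinish g = c"
    using A unfolding joins_def by blast
  obtain h where h: "arc h" "path_image h = B" "pathstart h = c" "pathfinish h = a"
    using joins_sym [OF B] unfolding joins_def by blast
  have "simple_path (g +++ h)"
    by (rule simple_path_join_loop) (use g h AB in auto)
  moreover have "pathfinish (g +++ h) = pathstart (g +++ h)"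
    using g h by simp
  moreover have "path_image (g +++ h) = A \<union> B"
    using g h by (simp add: path_image_join)
  ultimately show ?thesis
    using Jordan_curve [of "g +++ h"] that by metis
qed

lemma connected_subset_side:
  assumes "open F" "open G" "F \<inter> G = {}" "connected S" "S \<subseteq> F \<union> G"
  shows "S \<subseteq> F \<or> S \<subseteq> G"
  using connectedD [OF assms(4) assms(1,2)] assms by blast

text \<open>The proof is by Janiszewski's theorem. If both chords lie on the side \<open>F\<close>, the chord \<open>R\<close> together with
the other side \<open>G\<close> and the end \<open>b\<close> is connected and avoids \<open>B\<close> and \<open>P\<close>, and with the end \<open>d\<close> in place of
\<open>b\<close> it avoids \<open>A\<close> and \<open>P\<close>. So neither of the sets \<open>A \<union> P\<close>, \<open>B \<union> P\<close>, whose intersection \<open>P\<close> is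
connected, separates \<open>G\<close> from \<open>R\<close>. Then their union does not either, although it contains the whole curve.\<close>

lemma crossing_chords_not_same_side:
  assumes A: "joins A a c" and B: "joins B a c" and AB: "A \<inter> B = {a, c}"
    and P: "joins P a c" "P \<inter> (A \<union> B) = {a, c}"
    and R: "joins R b d" "R \<inter> (A \<union> B) = {b, d}" "P \<inter> R = {}"
    and b: "b \<in> A" and d: "d \<in> B"
    and FG: "F \<inter> G = {}" "connected G" "G \<noteq> {}"  "F \<union> G = - (A \<union> B)"
      "open F" "open G" "frontier G = A \<union> B"
    and PF: "P - {a, c} \<subseteq> F" and RF: "R - {b, d} \<subseteq> F"
  shows False
proof -
  have bd: "b \<noteq> a" "b \<noteq> c" "d \<noteq> a" "d \<noteq> c"
    using joins_endpoints [OF R(1)] joins_endpoints [OF P(1)] R(3) by auto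
  have bd': "b \<notin> B" "d \<notin> A"
    using b d bd AB by auto
  obtain z where z: "z \<in> G" using FG by auto
  obtain w where w: "w \<in> R - {b, d}" using joins_connected_open [OF R(1)] by auto
  have clG: "A \<union> B \<subseteq> closure G"
    using FG(7) by (auto simp: frontier_def)
  \<comment> \<open>Passing from \<open>G\<close> to \<open>R\<close> through the common boundary point \<open>e\<close>.\<close>
  have side: "connected_component (- (C \<union> P)) z w"
    if "connected (R - {e'})" "e \<in> R" "e \<noteq> e'" "{e, e'} = {b, d}" "e \<in> A \<union> B" "e \<notin> C" "C \<subseteq> A \<union> B" "e' \<in> C" for e e' C
  proof -
    have "connected (insert e G)"
      by (rule connected_intermediate_closure [OF FG(2)]) (use clG that closure_subset [of G] in auto)
    then have con: "connected (insert e G \<union> (R - {e'}))"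
      by (rule connected_Un) (use that in auto)
    have "insert e G \<union> (R - {e'}) \<subseteq> - (C \<union> P)"
    proof -
      have "e \<notin> P" using that R(3) by auto
      moreover have "G \<inter> (C \<union> P) = {}"
        using FG(1,4) PF P(2) that(7) by auto
      moreover have "(R - {e'}) \<inter> (C \<union> P) = {}"
        using R(2,3) that by auto
      ultimately show ?thesis using that by auto
    qed
    moreover have "z \<in> insert e G \<union> (R - {e'})" "w \<in> insert e G \<union> (R - {e'})"
      using z w that by auto
    ultimately show ?thesis
      using con unfolding connected_component_def by blast
  qed
  have "connected_component (- (B \<union> P)) z w"
    by (rule side [of d b]) (use joins_connected_half_open [OF R(1)] joins_endpoints [OF R(1)] b d bd' in auto)
  moreover have "connected_component (- (A \<union> P)) z w"
    by (rule side [of b d]) (use joins_connected_half_open [OF joins_sym [OF R(1)]] joins_endpoints [OF R(1)] b d bd' in auto)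
  moreover have "compact (A \<union> P)" "closed (B \<union> P)" 
    using A B P(1) joins_compact compact_Un compact_imp_closed by metis+
  moreover have "(A \<union> P) \<inter> (B \<union> P) = P"
    using AB joins_endpoints [OF P(1)] by auto
  ultimately have "connected_component (- ((A \<union> P) \<union> (B \<union> P))) z w"
    using Janiszewski [of "A \<union> P" "B \<union> P" z w] joins_connected [OF P(1)] by auto
  then obtain T where T: "connected T" "T \<subseteq> - ((A \<union> P) \<union> (B \<union> P))" "z \<in> T" "w \<in> T"
    unfolding connected_component_def by blast
  then have "T \<subseteq> F \<or> T \<subseteq> G"
    by (intro connected_subset_side) (use FG in auto)
  moreover have "w \<in> F" using w RF by auto
  ultimately show False
    using T z FG(1) by auto
qed

lemma crossing_chords:
  assumes A: "joins A a c" and B: "joins B a c" and AB: "A \<inter> B = {a, c}"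
    and P: "joins P a c" "P \<inter> (A \<union> B) = {a, c}"
    and R: "joins R b d" "R \<inter> (A \<union> B) = {b, d}" "P \<inter> R = {}"
    and b: "b \<in> A" and d: "d \<in> B"
    and FG: "open F" "connected F" "open G" "connected G" "F \<inter> G = {}"
    "F \<union> G = - (A \<union> B)" "frontier F = A \<union> B" "frontier G = A \<union> B"
  shows "(P - {a, c} \<subseteq> F \<and> R - {b, d} \<subseteq> G) \<or> (P - {a, c} \<subseteq> G \<and> R - {b, d} \<subseteq> F)"
proof -
  have ne: "F \<noteq> {}" "G \<noteq> {}"
    using FG(7,8) joins_endpoints [OF A] by auto
  have "P - {a, c} \<subseteq> F \<or> P - {a, c} \<subseteq> G"
    by (rule connected_subset_side) (use FG joins_connected_open [OF P(1)] P(2) in auto)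
  moreover have "R - {b, d} \<subseteq> F \<or> R - {b, d} \<subseteq> G"
    by (rule connected_subset_side) (use FG joins_connected_open [OF R(1)] R(2) in auto)
  moreover have "\<not> (P - {a, c} \<subseteq> F \<and> R - {b, d} \<subseteq> F)"
    using crossing_chords_not_same_side [OF A B AB P R b d, of F G] FG ne by blast
  moreover have "\<not> (P - {a, c} \<subseteq> G \<and> R - {b, d} \<subseteq> G)"
    using crossing_chords_not_same_side [OF A B AB P R b d, of G F] FG ne by blast
  ultimately show ?thesis by blast
qed

section \<open>Drawings of K33 and K5\<close>

text \<open>The part of a planar drawing that the arguments need, with the arcs given by their images. In
contrast to \<open>planar\<close>, an edge may be drawn along a path of a larger graph, which is how
subdivisions are handled.\<close>

definition drawing :: "'v set \<Rightarrow> 'v set set \<Rightarrow> ('v \<Rightarrow> complex) \<Rightarrow> ('v set \<Rightarrow> complex set) \<Rightarrow> bool" where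
  "drawing V E p D \<longleftrightarrow> inj_on p V \<and> \<Union>E \<subseteq> V \<and>
     (\<forall>v w. {v, w} \<in> E \<longrightarrow> joins (D {v, w}) (p v) (p w)) \<and>
     (\<forall>e\<in>E. \<forall>e'\<in>E. e \<noteq> e' \<longrightarrow> D e \<inter> D e' = p ` (e \<inter> e'))"

text \<open>The six vertices form a hexagon, drawn as a closed curve, and any two of the three remaining edges are
crossing chords of it. Two of three chords lie on the same side.\<close>

lemma drawing_no_K33:
  assumes D: "drawing V E p D"
    and E: "\<And>i j. i \<in> {x1, x2, x3} \<Longrightarrow> j \<in> {y1, y2, y3} \<Longrightarrow> {i, j} \<in> E"
    and dist: "distinct [x1, x2, x3, y1, y2, y3]"
  shows False
proof -
  have j: "joins (D {v, w}) (p v) (p w)" if "{v, w} \<in> E" for v w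
    using D that unfolding drawing_def by blast
  have i: "D e \<inter> D e' = p ` (e \<inter> e')" if "e \<in> E" "e' \<in> E" "e \<noteq> e'" for e e'
    using D that unfolding drawing_def by blast
  have e: "{x1,y1} \<in> E" "{x1,y2} \<in> E" "{x1,y3} \<in> E" "{x2,y1} \<in> E" "{x2,y2} \<in> E" "{x2,y3} \<in> E"
    "{x3,y1} \<in> E" "{x3,y2} \<in> E" "{x3,y3} \<in> E" using E by auto
  have e': "{y1,x1} \<in> E" "{y2,x1} \<in> E" "{y3,x1} \<in> E" "{y1,x2} \<in> E" "{y2,x2} \<in> E" "{y3,x2} \<in> E"
    "{y1,x3} \<in> E" "{y2,x3} \<in> E" "{y3,x3} \<in> E" using e by (simp_all add: insert_commute)
  have ds: "x1 \<noteq> x2" "x1 \<noteq> x3" "x2 \<noteq> x3" "y1 \<noteq> y2" "y1 \<noteq> y3" "y2 \<noteq> y3"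
    "x1 \<noteq> y1" "x1 \<noteq> y2" "x1 \<noteq> y3" "x2 \<noteq> y1" "x2 \<noteq> y2" "x2 \<noteq> y3" "x3 \<noteq> y1" "x3 \<noteq> y2" "x3 \<noteq> y3"
    using dist by auto
  note ds' = ds ds [THEN not_sym]
  note ints = i e e' doubleton_eq_iff ds' Int_Un_distrib Int_Un_distrib2
  define A where "A = D {x1,y1} \<union> D {y1,x2} \<union> D {x2,y2}"
  define B where "B = D {x1,y3} \<union> D {y3,x3} \<union> D {x3,y2}"
  define A' where "A' = D {x2,y2} \<union> D {y2,x3} \<union> D {x3,y3}"
  define B' where "B' = D {x2,y1} \<union> D {y1,x1} \<union> D {x1,y3}"
  note AB = A_def B_def A'_def B'_def
  have three: "joins (D {a,b} \<union> D {b,c} \<union> D {c,d}) (p a) (p d)"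
    if "{a,b} \<in> E" "{b,c} \<in> E" "{c,d} \<in> E" "distinct [a,b,c,d]" for a b c d
    by (intro joins_trans [of _ _ "p c"] joins_trans [of _ _ "p b"] j)
      (use that in \<open>auto simp: i doubleton_eq_iff Int_Un_distrib2\<close>)
  have joi: "joins A (p x1) (p y2)" "joins B (p x1) (p y2)" "joins A' (p x2) (p y3)" "joins B' (p x2) (p y3)"
    unfolding AB by (rule three; use e e' ds' in simp)+
  have AB': "A' \<union> B' = A \<union> B"
    unfolding AB by (auto simp: insert_commute)
  have meet: "A \<inter> B = {p x1, p y2}" "A' \<inter> B' = {p x2, p y3}"
    unfolding AB by (auto simp: ints)
  have chords: "D {x1,y2} \<inter> (A \<union> B) = {p x1, p y2}" "D {x2,y3} \<inter> (A \<union> B) = {p x2, p y3}" "D {y1,x3} \<inter> (A \<union> B) = {p y1, p x3}"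
    unfolding AB by (auto simp: ints)
  have disj: "D {x1,y2} \<inter> D {x2,y3} = {}" "D {x1,y2} \<inter> D {y1,x3} = {}" "D {x2,y3} \<inter> D {y1,x3} = {}"
    by (auto simp: ints)
  have mem: "p x2 \<in> A" "p y3 \<in> B" "p y1 \<in> A" "p x3 \<in> B" "p x3 \<in> A'" "p y1 \<in> B'"
    unfolding AB using joins_endpoints [OF j] e e' by auto
  obtain F G where FG: "open F" "connected F" "open G" "connected G" "F \<inter> G = {}"
    "F \<union> G = - (A \<union> B)" "frontier F = A \<union> B" "frontier G = A \<union> B"
    using Jordan_sides [OF joi(1,2) meet(1)] by metis
  let ?P = "D {x1,y2} - {p x1, p y2}" and ?Q = "D {x2,y3} - {p x2, p y3}" and ?R = "D {y1,x3} - {p y1, p x3}"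
  have "?P \<subseteq> F \<and> ?Q \<subseteq> G \<or> ?P \<subseteq> G \<and> ?Q \<subseteq> F"
    by (rule crossing_chords [OF joi(1,2) meet(1) j chords(1) j chords(2) disj(1) mem(1,2) FG]) (use e in auto)
  moreover have "?P \<subseteq> F \<and> ?R \<subseteq> G \<or> ?P \<subseteq> G \<and> ?R \<subseteq> F"
    by (rule crossing_chords [OF joi(1,2) meet(1) j chords(1) j chords(3) disj(2) mem(3,4) FG]) (use e e' in auto)
  moreover have "?Q \<subseteq> F \<and> D {x3,y1} - {p x3, p y1} \<subseteq> G \<or> ?Q \<subseteq> G \<and> D {x3,y1} - {p x3, p y1} \<subseteq> F"
    by (rule crossing_chords [OF joi(3,4) meet(2) j _ j _ _ mem(5,6)])
       (use e chords(2,3) disj(3) FG AB' in \<open>simp_all add: insert_commute\<close>)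
  then have "?Q \<subseteq> F \<and> ?R \<subseteq> G \<or> ?Q \<subseteq> G \<and> ?R \<subseteq> F"
    by (simp add: insert_commute)
  moreover have "?P \<noteq> {}" "?Q \<noteq> {}" "?R \<noteq> {}"
    using joins_connected_open [OF j] e e' by auto
  ultimately show False
    using FG(5) by blast
qed

text \<open>Consider the closed curve through \<open>u\<close>, \<open>a\<close>, \<open>c\<close>, \<open>b\<close>. The edges \<open>{u, c}\<close> and \<open>{a, b}\<close> are crossing
chords, and so are the paths \<open>u\<close>, \<open>v\<close>, \<open>c\<close> and \<open>a\<close>, \<open>v\<close>, \<open>b\<close> with \<open>{a, b}\<close> and \<open>{u, c}\<close> respectively.
The two paths meet in \<open>v\<close>, hence lie on one side, and then both edges lie on the other.\<close>

lemma drawing_no_K5: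
  assumes D: "drawing V E p D"
    and E: "\<And>i j. i \<in> {u, v, a, b, c} \<Longrightarrow> j \<in> {u, v, a, b, c} \<Longrightarrow> i \<noteq> j \<Longrightarrow> {i, j} \<in> E"
    and dist: "distinct [u, v, a, b, c]"
  shows False
proof -
  have j: "joins (D {v, w}) (p v) (p w)" if "{v, w} \<in> E" for v w
    using D that unfolding drawing_def by blast
  have i: "D e \<inter> D e' = p ` (e \<inter> e')" if "e \<in> E" "e' \<in> E" "e \<noteq> e'" for e e'
    using D that unfolding drawing_def by blast
  have ds: "u \<noteq> v" "u \<noteq> a" "u \<noteq> b" "u \<noteq> c" "v \<noteq> a" "v \<noteq> b" "v \<noteq> c" "a \<noteq> b" "a \<noteq> c" "b \<noteq> c"
    using dist by auto
  have e: "{u,v} \<in> E" "{u,a} \<in> E" "{u,b} \<in> E" "{u,c} \<in> E" "{v,a} \<in> E" "{v,b} \<in> E" "{v,c} \<in> E"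
     "{a,b} \<in> E" "{a,c} \<in> E" "{b,c} \<in> E" using E ds by auto
  have e': "{v,u} \<in> E" "{a,u} \<in> E" "{b,u} \<in> E" "{c,u} \<in> E" "{a,v} \<in> E" "{b,v} \<in> E" "{c,v} \<in> E"
     "{b,a} \<in> E" "{c,a} \<in> E" "{c,b} \<in> E" using e by (simp_all add: insert_commute)
  note ds' = ds ds [THEN not_sym]
  note ints = i e e' doubleton_eq_iff ds' Int_Un_distrib Int_Un_distrib2
  define A where "A = D {u,a} \<union> D {a,c}"
  define B where "B = D {u,b} \<union> D {b,c}"
  note AB = A_def B_def
  define P where "P = D {u,v} \<union> D {v,c}"
  define R where "R = D {a,v} \<union> D {v,b}"
  have two: "joins (D {x,y} \<union> D {y,z}) (p x) (p z)"
    if "{x,y} \<in> E" "{y,z} \<in> E" "distinct [x,y,z]" for x y z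
    by (intro joins_trans [of _ _ "p y"] j)
      (use that in \<open>auto simp: i doubleton_eq_iff\<close>)
  have joi: "joins A (p u) (p c)" "joins B (p u) (p c)" "joins P (p u) (p c)" "joins R (p a) (p b)"
    unfolding AB P_def R_def by (rule two; use e e' ds' in simp)+
  have meet: "A \<inter> B = {p u, p c}"
    unfolding AB by (auto simp: ints)
  have chords: "P \<inter> (A \<union> B) = {p u, p c}" "R \<inter> (A \<union> B) = {p a, p b}" 
    "D {u,c} \<inter> (A \<union> B) = {p u, p c}" "D {a,b} \<inter> (A \<union> B) = {p a, p b}" 
    unfolding AB P_def R_def by (auto simp: ints)
  have disj: "P \<inter> D {a,b} = {}" "D {u,c} \<inter> R = {}" "D {u,c} \<inter> D {a,b} = {}"
    unfolding P_def R_def by (auto simp: ints)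
  have mem: "p a \<in> A" "p b \<in> B"
    unfolding AB using joins_endpoints [OF j] e e' by auto
  obtain F G where FG: "open F" "connected F" "open G" "connected G" "F \<inter> G = {}"
    "F \<union> G = - (A \<union> B)" "frontier F = A \<union> B" "frontier G = A \<union> B"
    using Jordan_sides [OF joi(1,2) meet(1)] by metis
  let ?P = "P - {p u, p c}" and ?R = "R - {p a, p b}" and ?M = "D {u,c} - {p u, p c}" and ?N = "D {a,b} - {p a, p b}"
  have "?P \<subseteq> F \<and> ?N \<subseteq> G \<or> ?P \<subseteq> G \<and> ?N \<subseteq> F"
    by (rule crossing_chords [OF joi(1,2) meet(1) joi(3) chords(1) j chords(4) disj(1) mem FG]) (use e in auto)
  moreover have "?M \<subseteq> F \<and> ?R \<subseteq> G \<or> ?M \<subseteq> G \<and> ?R \<subseteq> F"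
    by (rule crossing_chords [OF joi(1,2) meet(1) j chords(3) joi(4) chords(2) disj(2) mem FG]) (use e in auto)
  moreover have "?M \<subseteq> F \<and> ?N \<subseteq> G \<or> ?M \<subseteq> G \<and> ?N \<subseteq> F"
    by (rule crossing_chords [OF joi(1,2) meet(1) j chords(3) j chords(4) disj(3) mem FG]) (use e in auto)
  moreover have "?P \<noteq> {}" "?R \<noteq> {}" "?M \<noteq> {}" "?N \<noteq> {}"
    using joins_connected_open [OF j] joins_connected_open [OF joi(3)] joins_connected_open [OF joi(4)] e e' by auto
  moreover have "p v \<in> ?P" "p v \<in> ?R"
    using joins_endpoints [OF j] e e' ds' D 
    unfolding P_def R_def drawing_def by (auto simp: inj_on_def)
  ultimately show False
    using FG(5) by blast
qed

section \<open>Forbidden configurations in planar graphs\<close>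

lemma simple_graph_edgeE:
  assumes "simple_graph G" "e \<in> edges G"
  obtains v w where "e = {v, w}" "v \<in> vertices G" "w \<in> vertices G" "v \<noteq> w"
  using assms unfolding simple_graph_def by blast

lemma planar_drawing:
  fixes G :: "'a ugraph"
  assumes "simple_graph G" "planar G"
  obtains p D where "drawing (vertices G) (edges G) p D"
proof -
  obtain p :: "'a \<Rightarrow> complex" and c :: "'a set \<Rightarrow> real \<Rightarrow> complex" where
      inj: "inj_on p (vertices G)"
    and c': "\<forall>e\<in>edges G. arc (c e) \<and> {pathstart (c e), pathfinish (c e)} = p ` e \<and>
         path_image (c e) \<inter> p ` vertices G = p ` e"
    and meet: "\<forall>e\<in>edges G. \<forall>e'\<in>edges G. e \<noteq> e' \<longrightarrow>
       path_image (c e) \<inter> path_image (c e') = p ` (e \<inter> e')"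
    using assms(2) unfolding planar_def by (elim exE conjE) (rule that)
  note c = bspec [OF c']
  have "joins (path_image (c {v, w})) (p v) (p w)" if "{v, w} \<in> edges G" for v w
  proof -
    have "{pathstart (c {v, w}), pathfinish (c {v, w})} = {p v, p w}"
      using c [OF that] by simp
    then have "pathstart (c {v, w}) = p v \<and> pathfinish (c {v, w}) = p w \<or>
      pathstart (c {v, w}) = p w \<and> pathfinish (c {v, w}) = p v"
      by (simp add: doubleton_eq_iff)
    moreover have "arc (c {v, w})"
      using c [OF that] by simp
    ultimately have "joins (path_image (c {v, w})) (p v) (p w) \<or> joins (path_image (c {v, w})) (p w) (p v)"
      unfolding joins_def by metis
    then show ?thesis using joins_sym by blast
  qed
  moreover have "\<Union> (edges G) \<subseteq> vertices G"
    using assms(1) by (auto elim!: simple_graph_edgeE)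
  ultimately have "drawing (vertices G) (edges G) p (\<lambda>e. path_image (c e))"
    using inj meet unfolding drawing_def by simp
  then show ?thesis by (rule that)
qed

lemma planar_no_K33:
  assumes "simple_graph G" "planar G" "distinct [x1, x2, x3, y1, y2, y3]"
    and "\<And>i j. i \<in> {x1, x2, x3} \<Longrightarrow> j \<in> {y1, y2, y3} \<Longrightarrow> {i, j} \<in> edges G"
  shows False
  using planar_drawing [OF assms(1,2)] drawing_no_K33 [OF _ assms(4,3)] by metis

fun walk_edges :: "'a list \<Rightarrow> 'a set set" where
  "walk_edges (x # y # zs) = insert {x, y} (walk_edges (y # zs))"
| "walk_edges zs = {}"

lemma walk_edges_subset: "e \<in> walk_edges xs \<Longrightarrow> e \<subseteq> set xs"
  by (induction xs rule: walk_edges.induct) auto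

lemma Union_walk_edges: "length xs \<ge> 2 \<Longrightarrow> \<Union> (walk_edges xs) = set xs"
proof (induction xs rule: walk_edges.induct)
  case (1 x y zs)
  then show ?case by (cases zs) auto
qed auto

lemma drawing_meet:
  "drawing V E p D \<Longrightarrow> e \<in> E \<Longrightarrow> e' \<in> E \<Longrightarrow> e \<noteq> e' \<Longrightarrow> D e \<inter> D e' = p ` (e \<inter> e')"
  unfolding drawing_def by simp

text \<open>The arcs of the edges of a path concatenate to a single arc.\<close>

lemma drawing_walk:
  assumes "drawing V E p D" "distinct xs" "length xs \<ge> 2" "walk_edges xs \<subseteq> E"
  shows "joins (\<Union> (D ` walk_edges xs)) (p (hd xs)) (p (last xs))"
  using assms(2-)
proof (induction xs rule: walk_edges.induct)
  case (1 x y zs)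
  have xy: "joins (D {x, y}) (p x) (p y)"
    using 1 assms(1) unfolding drawing_def by auto
  show ?case
  proof (cases zs)
    case Nil
    then show ?thesis using xy by simp
  next
    case (Cons z zs')
    have IH: "joins (\<Union> (D ` walk_edges (y # zs))) (p y) (p (last (y # zs)))"
      using 1 Cons by auto
    have "D {x, y} \<inter> D e = p ` ({x, y} \<inter> e)" if "e \<in> walk_edges (y # zs)" for e
    proof -
      have "{x, y} \<noteq> e" using walk_edges_subset [OF that] 1 by auto
      then show ?thesis
        using that 1 by (intro drawing_meet [OF assms(1)]) auto
    qed
    then have "D {x, y} \<inter> \<Union> (D ` walk_edges (y # zs)) = p ` ({x, y} \<inter> \<Union> (walk_edges (y # zs)))"
      by blast
    also have "\<dots> = {p y}"
      using 1 Cons by (subst Union_walk_edges) auto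
    finally have "joins (D {x, y} \<union> \<Union> (D ` walk_edges (y # zs))) (p x) (p (last (y # zs)))"
      by (rule joins_trans [OF xy IH])
    then show ?thesis by simp
  qed
qed auto

text \<open>Together with the first three vertices of the cycle, \<open>u\<close> and \<open>v\<close> are the branch vertices of a
subdivision of \<open>K5\<close>: the only edge that may be missing joins the first to the third of these vertices, and
the remainder of the cycle replaces it.\<close>

lemma planar_no_double_wheel:
  assumes G: "simple_graph G" "planar G"
    and cyc: "distinct cs" "length cs \<ge> 3" "walk_edges (cs @ [hd cs]) \<subseteq> edges G"
    and uv: "{u, v} \<in> edges G" "u \<notin> set cs" "v \<notin> set cs"
    and hub: "\<And>x. x \<in> set cs \<Longrightarrow> {u, x} \<in> edges G \<and> {v, x} \<in> edges G"
  shows False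
proof -
  obtain p D where D: "drawing (vertices G) (edges G) p D"
    using planar_drawing [OF G] .
  obtain a b c ds where cs: "cs = a # b # c # ds"
    using cyc(2) by (auto simp: numeral_3_eq_3 Suc_le_length_iff)
  \<comment> \<open>The remainder of the cycle, closed up; for a triangle this is the edge from \<open>c\<close> to \<open>a\<close>.\<close>
  define xs where "xs = c # ds @ [a]"
  define P where "P = \<Union> (D ` walk_edges xs)"
  have xsE: "walk_edges xs \<subseteq> edges G" "{a, b} \<in> edges G" "{b, c} \<in> edges G"
    using cyc(3) unfolding xs_def cs by auto
  have "joins P (p (hd xs)) (p (last xs))"
    unfolding P_def by (rule drawing_walk [OF D]) (use cyc(1) xsE in \<open>auto simp: xs_def cs\<close>)
  then have P: "joins P (p a) (p c)"
    using joins_sym by (auto simp: xs_def)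
  define E' where "E' = {{i, j} | i j. i \<in> {u, v, a, b, c} \<and> j \<in> {u, v, a, b, c} \<and> i \<noteq> j}"
  define D' where "D' = D({a, c} := P)"
  have "u \<noteq> v" using uv(1) G(1) by (auto elim!: simple_graph_edgeE simp: doubleton_eq_iff)
  then have dist: "distinct [u, v, a, b, c]"
    using cyc(1) uv by (auto simp: cs)
  have hubs: "{u, v} \<in> edges G" "{u, a} \<in> edges G" "{u, b} \<in> edges G" "{u, c} \<in> edges G"
     "{v, a} \<in> edges G" "{v, b} \<in> edges G" "{v, c} \<in> edges G"
    using uv hub by (auto simp: cs)
  have E': "e \<in> edges G" if "e \<in> E'" "e \<noteq> {a, c}" for e
    using that hubs xsE unfolding E'_def
    by (auto simp: insert_commute)
  have E'_sub: "e \<subseteq> {u, v, a, b, c}" "\<exists>x y. e = {x, y} \<and> x \<noteq> y" if "e \<in> E'" for e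
    using that unfolding E'_def by auto
  have meetP: "P \<inter> D e = p ` ({a, c} \<inter> e)" if "e \<in> E'" "e \<noteq> {a, c}" for e
  proof -
    have ac: "set xs \<inter> e = {a, c} \<inter> e"
      using E'_sub(1) [OF that(1)] uv cyc(1) by (auto simp: xs_def cs)
    have "D e' \<inter> D e = p ` (e' \<inter> e)" if e': "e' \<in> walk_edges xs" for e'
    proof -
      have "e \<noteq> e'"
      proof
        assume "e = e'"
        then have "e \<subseteq> {a, c}"
          using ac walk_edges_subset [OF e'] by auto
        then show False
          using E'_sub(2) [OF \<open>e \<in> E'\<close>] \<open>e \<noteq> {a, c}\<close> by auto
      qed
      then show ?thesis
        using E' [OF \<open>e \<in> E'\<close> \<open>e \<noteq> {a, c}\<close>] xsE(1) e' by (intro drawing_meet [OF D]) auto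
    qed
    then have "P \<inter> D e = p ` (\<Union> (walk_edges xs) \<inter> e)"
      unfolding P_def by blast
    then show ?thesis
      using ac by (subst (asm) Union_walk_edges) (auto simp: xs_def)
  qed
  have 1: "inj_on p (vertices G)" using D unfolding drawing_def by simp
  have 2: "\<Union> E' \<subseteq> vertices G"
  proof -
    have "\<Union> (edges G) \<subseteq> vertices G" using D unfolding drawing_def by simp
    then have "{u, v, a, b, c} \<subseteq> vertices G" using hubs by blast
    then show ?thesis using E'_sub(1) by blast
  qed
  have 3: "joins (D' {x, y}) (p x) (p y)" if "{x, y} \<in> E'" for x y
  proof (cases "{x, y} = {a, c}")
    case True
    then show ?thesis using P joins_sym [OF P] unfolding D'_def doubleton_eq_iff by auto
  next
    case False
    then show ?thesis using E' [OF that] D by (auto simp: D'_def drawing_def)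
  qed
  have 4: "D' e \<inter> D' e' = p ` (e \<inter> e')" if "e \<in> E'" "e' \<in> E'" "e \<noteq> e'" for e e'
  proof -
    consider "e = {a, c}" | "e' = {a, c}" | "e \<noteq> {a, c}" "e' \<noteq> {a, c}" by blast
    then show ?thesis
    proof cases
      case 1
      then show ?thesis using that meetP [of e'] by (auto simp: D'_def)
    next
      case 2
      then show ?thesis using that meetP [of e] by (auto simp: D'_def Int_commute)
    next
      case 3
      then show ?thesis using that E' D by (simp add: D'_def drawing_def)
    qed
  qed
  have "drawing (vertices G) E' p D'"
    using 1 2 3 4 unfolding drawing_def by blast
  then show False
    by (rule drawing_no_K5 [OF _ _ dist]) (auto simp: E'_def)
qed

section \<open>A straight-line drawing\<close>

text \<open>The join of \<open>K2\<close>, on the vertices 0 and 1, with a path on the \<open>2 * q + 1\<close> vertices from 2 to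
\<open>2 * q + 2\<close> and isolated vertices. For \<open>k \<ge> 2\<close> and \<open>n \<ge> 2 * k - 1\<close> it is isomorphic to \<open>M_graph n k\<close>, with \<open>q = k - 2\<close>.\<close>

definition model_graph :: "nat \<Rightarrow> nat \<Rightarrow> nat ugraph" where
  "model_graph n q = ({..<n}, {{0, 1}} \<union> {{0, j} | j. 2 \<le> j \<and> j < n} \<union> {{1, j} | j. 2 \<le> j \<and> j < n} \<union>
     {{j, Suc j} | j. 2 \<le> j \<and> j < 2 * q + 2})"

text \<open>The two vertices of \<open>K2\<close> are placed at \<open>\<i>\<close> and \<open>- \<i>\<close>, and the others at the points 1, 2, 3, ... of the
real line, so that the segment between the first two, which crosses the line at 0, meets no other vertex.\<close>

definition place :: "nat \<Rightarrow> complex" where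
  "place j = (if j = 0 then \<i> else if j = 1 then - \<i> else complex_of_real (real j - 1))"

lemma in_segment_upper:
  "z \<in> closed_segment \<i> (complex_of_real r) \<longleftrightarrow> 0 \<le> Im z \<and> Im z \<le> 1 \<and> Re z = r * (1 - Im z)"
proof
  assume "z \<in> closed_segment \<i> (complex_of_real r)"
  then show "0 \<le> Im z \<and> Im z \<le> 1 \<and> Re z = r * (1 - Im z)"
    by (auto simp: closed_segment_def)
next
  assume "0 \<le> Im z \<and> Im z \<le> 1 \<and> Re z = r * (1 - Im z)"
  then show "z \<in> closed_segment \<i> (complex_of_real r)"
    by (auto simp: closed_segment_def complex_eq_iff intro!: exI [of _ "1 - Im z"])
qed

lemma in_segment_lower:
  "z \<in> closed_segment (- \<i>) (complex_of_real r) \<longleftrightarrow> -1 \<le> Im z \<and> Im z \<le> 0 \<and> Re z = r * (1 + Im z)"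
proof
  assume "z \<in> closed_segment (- \<i>) (complex_of_real r)"
  then show "-1 \<le> Im z \<and> Im z \<le> 0 \<and> Re z = r * (1 + Im z)"
    by (auto simp: closed_segment_def)
next
  assume "-1 \<le> Im z \<and> Im z \<le> 0 \<and> Re z = r * (1 + Im z)"
  then show "z \<in> closed_segment (- \<i>) (complex_of_real r)"
    by (auto simp: closed_segment_def complex_eq_iff intro!: exI [of _ "1 + Im z"])
qed

lemma in_segment_vertical:
  "z \<in> closed_segment \<i> (- \<i>) \<longleftrightarrow> -1 \<le> Im z \<and> Im z \<le> 1 \<and> Re z = 0"
proof
  assume "z \<in> closed_segment \<i> (- \<i>)"
  then show "-1 \<le> Im z \<and> Im z \<le> 1 \<and> Re z = 0"
    by (auto simp: closed_segment_def)
next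
  assume "-1 \<le> Im z \<and> Im z \<le> 1 \<and> Re z = 0"
  then show "z \<in> closed_segment \<i> (- \<i>)"
    by (auto simp: closed_segment_def complex_eq_iff field_simps intro!: exI [of _ "(1 - Im z) / 2"])
qed

lemma in_segment_horizontal:
  assumes "r < s"
  shows "z \<in> closed_segment (complex_of_real r) (complex_of_real s) \<longleftrightarrow> Im z = 0 \<and> r \<le> Re z \<and> Re z \<le> s"
  using assms by (auto simp: closed_segment_of_real closed_segment_eq_real_ivl complex_eq_iff
      intro!: image_eqI [of _ _ "Re z"])

text \<open>The straight-line drawing given by \<open>place\<close>: segments in the upper half-plane leave from \<open>\<i>\<close>, those in
the lower half-plane from \<open>- \<i>\<close>, and the path runs along the real line.\<close>

lemma planar_model_subgraph:
  assumes "\<And>e. e \<in> snd G \<Longrightarrow> e \<subseteq> fst G" "snd G \<subseteq> snd (model_graph n q)"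
  shows "planar G"
proof -
  define S where "S e = closed_segment (place (Min e)) (place (Max e))" for e
  have ed: "(\<exists>j\<ge>2. e = {0, j}) \<or> (\<exists>j\<ge>2. e = {1, j}) \<or> e = {0, 1} \<or> (\<exists>j\<ge>2. e = {j, Suc j})"
    if "e \<in> snd G" for e
    using that assms(2) unfolding model_graph_def by auto
  have place2: "place j = complex_of_real (real j - 1)" "place (Suc j) = complex_of_real (real j)" if "j \<ge> 2" for j
    using that by (auto simp: place_def)
  have place01: "place 0 = \<i>" "place (Suc 0) = - \<i>"
    by (auto simp: place_def)
  have S0: "S {0, j} = {z. 0 \<le> Im z \<and> Im z \<le> 1 \<and> Re z = (real j - 1) * (1 - Im z)}" if "j \<ge> 2" for j
    using that by (simp add: S_def place2 place01 in_segment_upper set_eq_iff del: of_real_diff)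
  have S1: "S {1, j} = {z. -1 \<le> Im z \<and> Im z \<le> 0 \<and> Re z = (real j - 1) * (1 + Im z)}" if "j \<ge> 2" for j
    using that by (simp add: S_def place2 place01 in_segment_lower set_eq_iff del: of_real_diff)
  have S2: "S {0, 1} = {z. -1 \<le> Im z \<and> Im z \<le> 1 \<and> Re z = 0}"
    by (simp add: S_def place01 in_segment_vertical set_eq_iff)
  have S3: "S {j, Suc j} = {z. Im z = 0 \<and> real j - 1 \<le> Re z \<and> Re z \<le> real j}" if "j \<ge> 2" for j
    using that in_segment_horizontal [of "real j - 1" "real j"]
    by (simp add: S_def place2 set_eq_iff del: of_real_diff of_real_of_nat_eq)
  have inj: "inj place"
    by (rule injI) (auto simp: place_def complex_eq_iff split: if_splits)
  have ends: "place ` e = {place (Min e), place (Max e)}" if "e \<in> snd G" for e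
    using ed [OF that] by auto
  have arc: "place (Min e) \<noteq> place (Max e)" if "e \<in> snd G" for e
  proof -
    have "Min e \<noteq> Max e" using ed [OF that] by auto
    then show ?thesis using inj by (auto simp: inj_def)
  qed
  have vert: "w \<in> e" if "e \<in> snd G" "place w \<in> S e" for e w
    using ed [OF that(1)]
  proof (elim disjE exE conjE)
    fix j assume "2 \<le> j" "e = {0, j}"
    then show ?thesis using that(2) by (auto simp: S0 place_def split: if_splits)
  next
    fix j assume "2 \<le> j" "e = {1, j}"
    then show ?thesis using that(2) S1 [of j] by (auto simp: place_def split: if_splits)
  next
    assume "e = {0, 1}"
    then show ?thesis using that(2) S2 by (auto simp: place_def split: if_splits)
  next
    fix j assume "2 \<le> j" "e = {j, Suc j}"
    then show ?thesis using that(2) S3 [of j] by (auto simp: place_def split: if_splits)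
  qed
  have pl: "Re (place w) = (if w < 2 then 0 else real w - 1)" "Im (place w) = (if w = 0 then 1 else if w = 1 then -1 else 0)" for w
    by (auto simp: place_def)
  \<comment> \<open>Every kind of pair of segments is compared in coordinates; only the pair of path edges needs an ordering.\<close>
  have meet: "\<exists>w \<in> e \<inter> e'. z = place w" if e: "e \<in> snd G" "e' \<in> snd G" "e \<noteq> e'" and z: "z \<in> S e" "z \<in> S e'" for e e' z
  proof -
    have A: "Im z = 1 \<Longrightarrow> Re z = 0 \<Longrightarrow> z = place 0" "Im z = -1 \<Longrightarrow> Re z = 0 \<Longrightarrow> z = place 1" 
       and B: "\<And>j. j \<ge> 2 \<Longrightarrow> Im z = 0 \<Longrightarrow> Re z = real j - 1 \<Longrightarrow> z = place j"
      by (auto simp: complex_eq_iff pl)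
    have 00: "z = place 0" if "2 \<le> j" "2 \<le> k" "j \<noteq> k" "z \<in> S {0, j}" "z \<in> S {0, k}" for j k
      using that A by (auto simp: S0)
    have 11: "z = place 1" if "2 \<le> j" "2 \<le> k" "j \<noteq> k" "z \<in> S {1, j}" "z \<in> S {1, k}" for j k
      using that A S1 by auto
    have 01: "j = k \<and> z = place j" if "2 \<le> j" "2 \<le> k" "z \<in> S {0, j}" "z \<in> S {1, k}" for j k
      using that B S0 S1 by auto
    have 02: "z = place 0" if "2 \<le> j" "z \<in> S {0, j}" "z \<in> S {0, 1}" for j
      using that A S0 S2 by auto
    have 12: "z = place 1" if "2 \<le> j" "z \<in> S {1, j}" "z \<in> S {0, 1}" for j
      using that A S1 S2 by auto
    have 03: "(j = k \<or> j = Suc k) \<and> z = place j" if "2 \<le> j" "2 \<le> k" "z \<in> S {0, j}" "z \<in> S {k, Suc k}" for j k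
      using that B [of j] S0 S3 by auto
    have 13: "(j = k \<or> j = Suc k) \<and> z = place j" if "2 \<le> j" "2 \<le> k" "z \<in> S {1, j}" "z \<in> S {k, Suc k}" for j k
      using that B [of j] S1 S3 by auto
    have 23: False if "2 \<le> k" "z \<in> S {0, 1}" "z \<in> S {k, Suc k}" for k
      using that S2 S3 by auto
    have 33: "j = Suc k \<and> z = place j" if "2 \<le> j" "2 \<le> k" "k < j" "z \<in> S {j, Suc j}" "z \<in> S {k, Suc k}" for j k
    proof -
      have "real j - 1 \<le> real k" using that S3 by auto
      then have "j = Suc k" using that by simp
      moreover have "Re z = real j - 1" "Im z = 0" using \<open>j = Suc k\<close> that S3 [of j] S3 [of k] by auto
      ultimately show ?thesis using B that by auto
    qed
    consider (a) j where "2 \<le> j" "e = {0, j}" | (b) j where "2 \<le> j" "e = {1, j}" | (c) "e = {0, 1}" | (d) j where "2 \<le> j" "e = {j, Suc j}"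
      using ed [OF e(1)] by blast
    then show ?thesis
    proof cases
      case (a j)
      show ?thesis
        using ed [OF e(2)]
      proof (elim disjE exE conjE)
        fix k assume "2 \<le> k" "e' = {0, k}" then show ?thesis using 00 [of j k] a e z by auto
      next
        fix k assume "2 \<le> k" "e' = {1, k}" then show ?thesis using 01 [of j k] a e z by auto
      next
        assume "e' = {0, 1}" then show ?thesis using 02 [of j] a e z by auto
      next
        fix k assume "2 \<le> k" "e' = {k, Suc k}" then show ?thesis using 03 [of j k] a e z by auto
      qed
    next
      case (b j)
      show ?thesis
        using ed [OF e(2)]
      proof (elim disjE exE conjE)
        fix k assume "2 \<le> k" "e' = {0, k}" then show ?thesis using 01 [of k j] b e z by auto
      next
        fix k assume "2 \<le> k" "e' = {1, k}" then show ?thesis using 11 [of j k] b e z by auto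
      next
        assume "e' = {0, 1}" then show ?thesis using 12 [of j] b e z by auto
      next
        fix k assume "2 \<le> k" "e' = {k, Suc k}" then show ?thesis using 13 [of j k] b e z by auto
      qed
    next
      case c
      show ?thesis
        using ed [OF e(2)]
      proof (elim disjE exE conjE)
        fix k assume "2 \<le> k" "e' = {0, k}" then show ?thesis using 02 [of k] c e z by auto
      next
        fix k assume "2 \<le> k" "e' = {1, k}" then show ?thesis using 12 [of k] c e z by auto
      next
        assume "e' = {0, 1}" then show ?thesis using c e z by auto
      next
        fix k assume "2 \<le> k" "e' = {k, Suc k}" then show ?thesis using 23 [of k] c e z by auto
      qed
    next
      case (d j)
      show ?thesis
        using ed [OF e(2)]
      proof (elim disjE exE conjE)
        fix k assume "2 \<le> k" "e' = {0, k}" then show ?thesis using 03 [of k j] d e z by auto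
      next
        fix k assume "2 \<le> k" "e' = {1, k}" then show ?thesis using 13 [of k j] d e z by auto
      next
        assume "e' = {0, 1}" then show ?thesis using 23 [of j] d e z by auto
      next
        fix k assume k: "2 \<le> k" "e' = {k, Suc k}"
        then have "j < k \<or> k < j" using d e by (metis linorder_less_linear)
        then show ?thesis using 33 [of k j] 33 [of j k] k d e z by auto
      qed
    qed
  qed
  have sub: "place ` e \<subseteq> S e" if "e \<in> snd G" for e
    using ends [OF that] unfolding S_def by auto
  show ?thesis
    unfolding planar_def
  proof (intro exI conjI ballI impI)
    show "inj_on place (fst G)" using inj by (rule inj_on_subset) simp
  next
    fix e assume e: "e \<in> snd G"
    show "arc (linepath (place (Min e)) (place (Max e)))" using arc [OF e] by (rule arc_linepath)
    show "{pathstart (linepath (place (Min e)) (place (Max e))), pathfinish (linepath (place (Min e)) (place (Max e)))} = place ` e"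
      using ends [OF e] by simp
    show "path_image (linepath (place (Min e)) (place (Max e))) \<inter> place ` fst G = place ` e"
      using sub [OF e] vert [OF e] assms(1) [OF e] by (auto simp: S_def)
  next
    fix e e' assume e: "e \<in> snd G" "e' \<in> snd G" "e \<noteq> e'"
    have "S e \<inter> S e' = place ` (e \<inter> e')"
      using meet [OF e] sub [OF e(1)] sub [OF e(2)] by blast
    then show "path_image (linepath (place (Min e)) (place (Max e))) \<inter> path_image (linepath (place (Min e')) (place (Max e'))) = place ` (e \<inter> e')"
      by (simp add: S_def)
  qed
qed

section \<open>Eigenvalues of symmetric matrices\<close>

lemma eigenvalue_iff_sum:
  fixes A :: "'a :: comm_ring_1 mat"
  assumes A: "A \<in> carrier_mat n n"
  shows "eigenvalue A x \<longleftrightarrow>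
     (\<exists>f. (\<exists>i<n. f i \<noteq> 0) \<and> (\<forall>i<n. (\<Sum>j<n. A $$ (i, j) * f j) = x * f i))"
proof
  assume "eigenvalue A x"
  then obtain v where v: "v \<in> carrier_vec n" "v \<noteq> 0\<^sub>v n" "A *\<^sub>v v = x \<cdot>\<^sub>v v"
    using A unfolding eigenvalue_def eigenvector_def by auto
  have nz: "\<exists>i<n. Matrix.vec_index v i \<noteq> 0"
    using v(1,2) by (metis eq_vecI carrier_vecD index_zero_vec(1,2))
  have "(\<Sum>j<n. A $$ (i, j) * Matrix.vec_index v j) = x * Matrix.vec_index v i" if "i < n" for i
  proof -
    have "Matrix.vec_index (A *\<^sub>v v) i = Matrix.vec_index (x \<cdot>\<^sub>v v) i" using v by simp
    then show ?thesis
      using A v(1) that by (simp add: scalar_prod_def lessThan_atLeast0)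
  qed
  then show "\<exists>f. (\<exists>i<n. f i \<noteq> 0) \<and> (\<forall>i<n. (\<Sum>j<n. A $$ (i, j) * f j) = x * f i)"
    using nz by blast
next
  assume "\<exists>f. (\<exists>i<n. f i \<noteq> 0) \<and> (\<forall>i<n. (\<Sum>j<n. A $$ (i, j) * f j) = x * f i)"
  then obtain f i0 where f: "i0 < n" "f i0 \<noteq> 0" "\<And>i. i < n \<Longrightarrow> (\<Sum>j<n. A $$ (i, j) * f j) = x * f i"
    by blast
  have "A *\<^sub>v Matrix.vec n f = x \<cdot>\<^sub>v Matrix.vec n f"
    using A f(3) by (intro eq_vecI) (auto simp: scalar_prod_def lessThan_atLeast0)
  moreover have "Matrix.vec n f \<noteq> 0\<^sub>v n"
    using f(1,2) by (metis index_vec index_zero_vec(1))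
  ultimately show "eigenvalue A x"
    using A unfolding eigenvalue_def eigenvector_def by (intro exI [of _ "Matrix.vec n f"]) auto
qed

text \<open>With an eigenvector \<open>f\<close>, the number \<open>\<Sum>i j. cnj (f i) * A i j * f j\<close> equals its own conjugate, so the eigenvalue
is real; real and imaginary part of \<open>f\<close> are then eigenvectors unless they vanish.\<close>

lemma complex_eigenvalue_of_real_symmetric:
  fixes A :: "real mat"
  assumes A: "A \<in> carrier_mat n n"
    and sym: "\<And>i j. i < n \<Longrightarrow> j < n \<Longrightarrow> A $$ (i, j) = A $$ (j, i)"
    and z: "eigenvalue (map_mat complex_of_real A) z"
  shows "Im z = 0 \<and> eigenvalue A (Re z)"
proof -
  have cA: "map_mat complex_of_real A \<in> carrier_mat n n" using A by simp
  obtain f i0 where f: "i0 < n" "f i0 \<noteq> 0"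
    and ev: "\<And>i. i < n \<Longrightarrow> (\<Sum>j<n. complex_of_real (A $$ (i, j)) * f j) = z * f i"
    using z A unfolding eigenvalue_iff_sum [OF cA] by auto
  define Q where "Q = (\<Sum>i<n. \<Sum>j<n. cnj (f i) * complex_of_real (A $$ (i, j)) * f j)"
  have "cnj Q = (\<Sum>i<n. \<Sum>j<n. cnj (f j) * complex_of_real (A $$ (i, j)) * f i)"
    unfolding Q_def by (simp add: ac_simps)
  also have "\<dots> = (\<Sum>j<n. \<Sum>i<n. cnj (f j) * complex_of_real (A $$ (i, j)) * f i)"
    by (rule sum.swap)
  also have "\<dots> = Q"
    unfolding Q_def by (intro sum.cong) (auto simp: sym)
  finally have ImQ: "Im Q = 0"
    by (metis Reals_cnj_iff complex_is_Real_iff)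
  have "Q = (\<Sum>i<n. cnj (f i) * (\<Sum>j<n. complex_of_real (A $$ (i, j)) * f j))"
    unfolding Q_def by (simp add: sum_distrib_left mult.assoc)
  also have "\<dots> = (\<Sum>i<n. cnj (f i) * (z * f i))"
    by (intro sum.cong) (auto simp: ev)
  also have "\<dots> = z * (\<Sum>i<n. cnj (f i) * f i)"
    by (simp add: sum_distrib_left ac_simps)
  also have "(\<Sum>i<n. cnj (f i) * f i) = complex_of_real (\<Sum>i<n. (cmod (f i))\<^sup>2)"
    unfolding of_real_sum by (intro sum.cong refl) (metis complex_norm_square mult.commute)
  finally have Q: "Q = z * complex_of_real (\<Sum>i<n. (cmod (f i))\<^sup>2)" .
  have "(\<Sum>i<n. (cmod (f i))\<^sup>2) > 0"
    using f by (intro sum_pos2 [of _ i0]) auto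
  then have Imz: "Im z = 0" using ImQ Q by simp
  have re: "(\<Sum>j<n. A $$ (i, j) * Re (f j)) = Re z * Re (f i)" if "i < n" for i
    using arg_cong [OF ev [OF that], of Re] Imz by simp
  have im: "(\<Sum>j<n. A $$ (i, j) * Im (f j)) = Re z * Im (f i)" if "i < n" for i
    using arg_cong [OF ev [OF that], of Im] Imz by simp
  have "Re (f i0) \<noteq> 0 \<or> Im (f i0) \<noteq> 0" using f(2) by (simp add: complex_eq_iff)
  then have "eigenvalue A (Re z)"
    unfolding eigenvalue_iff_sum [OF A] using re im f(1) by metis
  then show ?thesis using Imz by simp
qed

text \<open>This makes the maximum in the definition of the spectral radius of a graph meaningful.\<close>

lemma real_symmetric_eigenvalue_exists:
  fixes A :: "real mat"
  assumes A: "A \<in> carrier_mat n n" and n: "n > 0"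
    and sym: "\<And>i j. i < n \<Longrightarrow> j < n \<Longrightarrow> A $$ (i, j) = A $$ (j, i)"
  shows "\<exists>x. eigenvalue A x"
proof -
  have "spectrum (map_mat complex_of_real A) \<noteq> {}"
    by (rule spectrum_non_empty [OF _ n]) (use A in simp)
  then show ?thesis
    using complex_eigenvalue_of_real_symmetric [OF A sym] unfolding spectrum_def by blast
qed

text \<open>If all eigenvalues of \<open>A\<close> were below \<open>\<mu>\<close>, then a suitable shift and scaling \<open>C = (A + c * 1) / (s + c)\<close>
would have all its eigenvalues strictly between 0 and 1, so its powers would stay bounded. But \<open>y\<close> grows
by the factor \<open>(\<mu> + c) / (s + c) > 1\<close> under every application of the nonnegative matrix \<open>C\<close>.\<close>

lemma eigenvalue_ge_of_subsolution:
  fixes A :: "real mat"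
  assumes A: "A \<in> carrier_mat n n"
    and sym: "\<And>i j. i < n \<Longrightarrow> j < n \<Longrightarrow> A $$ (i, j) = A $$ (j, i)"
    and nonneg: "\<And>i j. i < n \<Longrightarrow> j < n \<Longrightarrow> A $$ (i, j) \<ge> 0"
    and y: "\<And>i. i < n \<Longrightarrow> y i \<ge> 0" "i0 < n" "y i0 > 0"
    and sub: "\<And>i. i < n \<Longrightarrow> \<mu> * y i \<le> (\<Sum>j<n. A $$ (i, j) * y j)"
  shows "\<exists>x. eigenvalue A x \<and> x \<ge> \<mu>"
proof (rule ccontr)
  assume "\<nexists>x. eigenvalue A x \<and> x \<ge> \<mu>"
  then have small: "x < \<mu>" if "eigenvalue A x" for x
    using that by force
  have n: "n > 0" using y(2) by auto
  have fin: "finite (Collect (eigenvalue A))"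
    using card_finite_spectrum(1) [OF A] unfolding spectrum_def .
  have ne: "Collect (eigenvalue A) \<noteq> {}"
    using real_symmetric_eigenvalue_exists [OF A n sym] by auto
  define r where "r = Max (Collect (eigenvalue A))"
  have r: "r < \<mu>" "\<And>x. eigenvalue A x \<Longrightarrow> x \<le> r"
    using small Max_in [OF fin ne] Max_ge [OF fin] unfolding r_def by auto
  \<comment> \<open>Any \<open>s\<close> strictly between the largest eigenvalue and \<open>\<mu>\<close> works; the shift \<open>c\<close> makes all eigenvalues positive.\<close>
  define s where "s = (r + \<mu>) / 2"
  define c where "c = 1 + \<bar>Min (Collect (eigenvalue A))\<bar> + \<bar>s\<bar>"
  have c: "x + c > 0" if "eigenvalue A x" for x
    using Min_le [OF fin, of x] that unfolding c_def by auto
  have s: "r < s" "s < \<mu>" "s + c > 0" "c > 0"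
  proof -
    show "r < s" "s < \<mu>" using r(1) unfolding s_def by auto
    show "s + c > 0" "c > 0" unfolding c_def by linarith+
  qed
  define C where "C = Matrix.mat n n (\<lambda>(i, j). (A $$ (i, j) + (if i = j then c else 0)) / (s + c))"
  have C: "C \<in> carrier_mat n n" unfolding C_def by simp
  have Cij: "C $$ (i, j) = (A $$ (i, j) + (if i = j then c else 0)) / (s + c)" if "i < n" "j < n" for i j
    using that unfolding C_def by simp
  have Cmult: "(\<Sum>j<n. C $$ (i, j) * h j) = ((\<Sum>j<n. A $$ (i, j) * h j) + c * h i) / (s + c)"
    if "i < n" for i h
  proof -
    have "(\<Sum>j<n. C $$ (i, j) * h j) = (\<Sum>j<n. (A $$ (i, j) * h j + (if i = j then c * h j else 0)) / (s + c))"
      by (intro sum.cong) (auto simp: Cij that algebra_simps)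
    also have "\<dots> = (\<Sum>j<n. A $$ (i, j) * h j + (if i = j then c * h j else 0)) / (s + c)"
      by (simp only: sum_divide_distrib [symmetric])
    also have "\<dots> = ((\<Sum>j<n. A $$ (i, j) * h j) + c * h i) / (s + c)"
      using that by (simp add: sum.distrib)
    finally show ?thesis .
  qed
  have Cev: "0 < x \<and> x < 1" if x: "eigenvalue C x" for x
  proof -
    obtain f i where f: "i < n" "f i \<noteq> 0" and ev: "\<And>i. i < n \<Longrightarrow> (\<Sum>j<n. C $$ (i, j) * f j) = x * f i"
      using x unfolding eigenvalue_iff_sum [OF C] by blast
    have "(\<Sum>j<n. A $$ (i, j) * f j) = (x * (s + c) - c) * f i" if "i < n" for i
      using ev [OF that] Cmult [OF that, of f] s(3) by (simp add: field_simps)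
    then have "eigenvalue A (x * (s + c) - c)"
      unfolding eigenvalue_iff_sum [OF A] using f by blast
    then have "x * (s + c) - c + c > 0" and le: "x * (s + c) - c \<le> r"
      using c r(2) by blast+
    then have pos: "0 < x * (s + c)" by simp
    have "x * (s + c) \<le> r + c" using le by (simp only: diff_le_eq)
    also have "\<dots> < 1 * (s + c)" using s(1) by simp
    finally have lt: "x * (s + c) < 1 * (s + c)" .
    have "x < 1" using lt s(3) by (rule mult_right_less_imp_less [OF _ less_imp_le])
    then show ?thesis using pos s(3) by (simp add: zero_less_mult_iff)
  qed
  have csym: "C $$ (i, j) = C $$ (j, i)" if "i < n" "j < n" for i j
    using that by (simp add: Cij sym)
  have "spectral_radius (map_mat complex_of_real C) \<in> cmod ` spectrum (map_mat complex_of_real C)"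
    by (rule spectral_radius_mem_max(1) [OF _ n]) (use C in simp)
  then obtain z where z: "eigenvalue (map_mat complex_of_real C) z" "spectral_radius (map_mat complex_of_real C) = cmod z"
    unfolding spectrum_def by auto
  then have "cmod z < 1"
    using complex_eigenvalue_of_real_symmetric [OF C csym z(1)] Cev [of "Re z"]
    by (simp add: cmod_eq_Re)
  then have "spectral_radius (map_mat complex_of_real C) < 1" using z by simp
  then obtain b where b: "\<And>k. norm_bound (map_mat complex_of_real C ^\<^sub>m k) b"
    using spectral_radius_jnf_norm_bound_less_1_upper_triangular [of "map_mat complex_of_real C" n] C
    by auto
  have bound: "(C ^\<^sub>m k) $$ (i, j) \<le> b" if "i < n" "j < n" for i j k
  proof -
    have "map_mat complex_of_real (C ^\<^sub>m k) = map_mat complex_of_real C ^\<^sub>m k"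
      by (rule of_real_hom.mat_hom_pow [OF C])
    then have "norm_bound (map_mat complex_of_real (C ^\<^sub>m k)) b"
      using b [of k] by simp
    then have "cmod (complex_of_real ((C ^\<^sub>m k) $$ (i, j))) \<le> b"
      using that C unfolding norm_bound_def by auto
    then show ?thesis by simp
  qed
  define t where "t = (\<mu> + c) / (s + c)"
  have t: "t > 1" using s unfolding t_def by simp
  have Cy: "t * y i \<le> (\<Sum>j<n. C $$ (i, j) * y j)" if "i < n" for i
    using sub [OF that] s(3) unfolding Cmult [OF that] t_def
    by (simp add: divide_right_mono algebra_simps)
  have Cnn: "C $$ (i, j) \<ge> 0" if "i < n" "j < n" for i j
    using that nonneg s by (simp add: Cij)
  have pw: "(\<forall>i<n. \<forall>j<n. (C ^\<^sub>m k) $$ (i, j) \<ge> 0) \<and> (\<forall>i<n. t ^ k * y i \<le> (\<Sum>j<n. (C ^\<^sub>m k) $$ (i, j) * y j))" for k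
  proof (induction k)
    case 0
    have "(\<Sum>j<n. 1\<^sub>m n $$ (i, j) * y j) = y i" if "i < n" for i
    proof -
      have "(\<Sum>j<n. 1\<^sub>m n $$ (i, j) * y j) = (\<Sum>j<n. if i = j then y j else 0)"
        by (intro sum.cong) (use that in auto)
      also have "\<dots> = y i" using that by simp
      finally show ?thesis .
    qed
    then show ?case using C by auto
  next
    case (Suc k)
    have Ck: "C ^\<^sub>m k \<in> carrier_mat n n" using C by simp
    have ent: "(C ^\<^sub>m Suc k) $$ (i, j) = (\<Sum>l<n. (C ^\<^sub>m k) $$ (i, l) * C $$ (l, j))" if "i < n" "j < n" for i j
      using that C Ck by (simp add: scalar_prod_def lessThan_atLeast0)
    have "(C ^\<^sub>m Suc k) $$ (i, j) \<ge> 0" if "i < n" "j < n" for i j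
      unfolding ent [OF that] using Suc Cnn that by (intro sum_nonneg) auto
    moreover have "t ^ Suc k * y i \<le> (\<Sum>j<n. (C ^\<^sub>m Suc k) $$ (i, j) * y j)" if i: "i < n" for i
    proof -
      have "t ^ Suc k * y i = t * (t ^ k * y i)" by simp
      also have "\<dots> \<le> t * (\<Sum>l<n. (C ^\<^sub>m k) $$ (i, l) * y l)"
        using Suc i t by (intro mult_left_mono) auto
      also have "\<dots> = (\<Sum>l<n. (C ^\<^sub>m k) $$ (i, l) * (t * y l))"
        by (simp add: sum_distrib_left ac_simps)
      also have "\<dots> \<le> (\<Sum>l<n. (C ^\<^sub>m k) $$ (i, l) * (\<Sum>j<n. C $$ (l, j) * y j))"
        using Suc i Cy by (intro sum_mono mult_left_mono) auto
      also have "\<dots> = (\<Sum>l<n. \<Sum>j<n. (C ^\<^sub>m k) $$ (i, l) * C $$ (l, j) * y j)"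
        by (simp add: sum_distrib_left ac_simps)
      also have "\<dots> = (\<Sum>j<n. \<Sum>l<n. (C ^\<^sub>m k) $$ (i, l) * C $$ (l, j) * y j)"
        by (rule sum.swap)
      also have "\<dots> = (\<Sum>j<n. (C ^\<^sub>m Suc k) $$ (i, j) * y j)"
        using i by (intro sum.cong) (auto simp: ent sum_distrib_right simp del: pow_mat.simps)
      finally show ?thesis .
    qed
    ultimately show ?case by blast
  qed
  have "t ^ k * y i0 \<le> (\<Sum>j<n. b * y j)" for k
  proof -
    have "t ^ k * y i0 \<le> (\<Sum>j<n. (C ^\<^sub>m k) $$ (i0, j) * y j)"
      using pw y(2) by blast
    also have "\<dots> \<le> (\<Sum>j<n. b * y j)"
      using bound y(1,2) by (intro sum_mono mult_right_mono) auto
    finally show ?thesis .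
  qed
  then have "t ^ k \<le> (\<Sum>j<n. b * y j) / y i0" for k
    using y(3) by (simp add: field_simps)
  moreover obtain k where "t ^ k > (\<Sum>j<n. b * y j) / y i0"
    using real_arch_pow [OF t] by blast
  ultimately show False by (meson not_le)
qed

section \<open>Eigenvalues of graphs\<close>

definition neighbors :: "'a ugraph \<Rightarrow> 'a \<Rightarrow> 'a set" where
  "neighbors G v = {w. {v, w} \<in> edges G}"

lemma neighbors_simple:
  assumes "simple_graph G"
  shows "neighbors G v \<subseteq> vertices G" "finite (neighbors G v)" "v \<notin> neighbors G v"
proof -
  show "neighbors G v \<subseteq> vertices G"
    using assms unfolding simple_graph_def neighbors_def by (auto simp: doubleton_eq_iff)
  then show "finite (neighbors G v)"
    using assms unfolding simple_graph_def by (metis finite_subset)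
  show "v \<notin> neighbors G v"
    using assms unfolding simple_graph_def neighbors_def by (auto simp: doubleton_eq_iff)
qed

lemma neighbors_sym: "w \<in> neighbors G v \<longleftrightarrow> v \<in> neighbors G w"
  unfolding neighbors_def by (simp add: insert_commute)

context
  fixes G :: "'a :: linorder ugraph" and vs :: "'a list" and n :: nat
  assumes G: "simple_graph G"
  defines "vs \<equiv> sorted_list_of_set (vertices G)" and "n \<equiv> card (vertices G)"
begin

lemma adjacency_vs: "set vs = vertices G" "distinct vs" "length vs = n"
  using G unfolding vs_def n_def simple_graph_def by auto

lemma adjacency_index:
  assumes "v \<in> vertices G"
  obtains i where "i < n" "vs ! i = v"
  using assms adjacency_vs(1,3) by (metis in_set_conv_nth)

lemma adjacency_carrier: "adjacency_matrix G \<in> carrier_mat n n"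
  unfolding adjacency_matrix_def n_def by (simp add: Let_def)

lemma adjacency_entry:
  "i < n \<Longrightarrow> j < n \<Longrightarrow> adjacency_matrix G $$ (i, j) = (if {vs ! i, vs ! j} \<in> edges G then 1 else 0)"
  unfolding adjacency_matrix_def n_def vs_def by (simp add: Let_def)

lemma adjacency_symmetric:
  "i < n \<Longrightarrow> j < n \<Longrightarrow> adjacency_matrix G $$ (i, j) = adjacency_matrix G $$ (j, i)"
  by (simp add: adjacency_entry insert_commute)

lemma adjacency_row_sum:
  assumes "i < n"
  shows "(\<Sum>j<n. adjacency_matrix G $$ (i, j) * f (vs ! j)) = (\<Sum>w\<in>neighbors G (vs ! i). f w)"
proof -
  have bij: "bij_betw ((!) vs) {..<n} (vertices G)"
    using bij_betw_nth [of vs] adjacency_vs by (metis lessThan_atLeast0 atLeast0LessThan)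
  have "(\<Sum>j<n. adjacency_matrix G $$ (i, j) * f (vs ! j)) =
        (\<Sum>j<n. if vs ! j \<in> neighbors G (vs ! i) then f (vs ! j) else 0)"
    using assms by (intro sum.cong) (auto simp: adjacency_entry neighbors_def)
  also have "\<dots> = (\<Sum>w\<in>vertices G. if w \<in> neighbors G (vs ! i) then f w else 0)"
    by (rule sum.reindex_bij_betw [OF bij])
  also have "\<dots> = (\<Sum>w\<in>vertices G \<inter> neighbors G (vs ! i). f w)"
    using G unfolding simple_graph_def by (simp add: sum.inter_restrict)
  also have "vertices G \<inter> neighbors G (vs ! i) = neighbors G (vs ! i)"
    using neighbors_simple(1) [OF G] by auto
  finally show ?thesis .
qed

lemma eigenvalue_adjacency_iff:
  "eigenvalue (adjacency_matrix G) x \<longleftrightarrow>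
     (\<exists>f. (\<exists>v\<in>vertices G. f v \<noteq> 0) \<and> (\<forall>v\<in>vertices G. (\<Sum>w\<in>neighbors G v. f w) = x * f v))"
proof
  assume "eigenvalue (adjacency_matrix G) x"
  then obtain f i0 where f: "i0 < n" "f i0 \<noteq> 0"
    and ev: "\<And>i. i < n \<Longrightarrow> (\<Sum>j<n. adjacency_matrix G $$ (i, j) * f j) = x * f i"
    unfolding eigenvalue_iff_sum [OF adjacency_carrier] by blast
  define h where "h v = f (THE j. j < n \<and> vs ! j = v)" for v
  have h: "h (vs ! j) = f j" if "j < n" for j
  proof -
    have "(THE k. k < n \<and> vs ! k = vs ! j) = j"
      using that adjacency_vs by (intro the_equality) (auto simp: nth_eq_iff_index_eq)
    then show ?thesis by (simp add: h_def)
  qed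
  have "(\<Sum>w\<in>neighbors G v. h w) = x * h v" if v: "v \<in> vertices G" for v
  proof -
    obtain i where i: "i < n" "vs ! i = v" using adjacency_index [OF v] .
    have "(\<Sum>w\<in>neighbors G v. h w) = (\<Sum>j<n. adjacency_matrix G $$ (i, j) * h (vs ! j))"
      using adjacency_row_sum [OF i(1), of h] i by simp
    also have "\<dots> = x * h v" using ev [OF i(1)] h i by auto
    finally show ?thesis .
  qed
  moreover have "\<exists>v\<in>vertices G. h v \<noteq> 0"
    using f h adjacency_vs by (metis nth_mem)
  ultimately show "\<exists>f. (\<exists>v\<in>vertices G. f v \<noteq> 0) \<and> (\<forall>v\<in>vertices G. (\<Sum>w\<in>neighbors G v. f w) = x * f v)"
    by blast
next
  assume "\<exists>f. (\<exists>v\<in>vertices G. f v \<noteq> 0) \<and> (\<forall>v\<in>vertices G. (\<Sum>w\<in>neighbors G v. f w) = x * f v)"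
  then obtain f v0 where f: "v0 \<in> vertices G" "f v0 \<noteq> 0" "\<And>v. v \<in> vertices G \<Longrightarrow> (\<Sum>w\<in>neighbors G v. f w) = x * f v"
    by blast
  obtain i0 where "i0 < n" "vs ! i0 = v0" using adjacency_index [OF f(1)] .
  moreover have "(\<Sum>j<n. adjacency_matrix G $$ (i, j) * f (vs ! j)) = x * f (vs ! i)" if "i < n" for i
  proof -
    have "vs ! i \<in> vertices G" using that adjacency_vs nth_mem by metis
    then show ?thesis using adjacency_row_sum [OF that, of f] f(3) by simp
  qed
  ultimately show "eigenvalue (adjacency_matrix G) x"
    unfolding eigenvalue_iff_sum [OF adjacency_carrier] using f(2) by (intro exI [of _ "\<lambda>i. f (vs ! i)"]) auto
qed

lemma graph_spectral_radius_eigenvalue: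
  assumes "vertices G \<noteq> {}"
  shows "eigenvalue (adjacency_matrix G) (graph_spectral_radius G)"
    and "eigenvalue (adjacency_matrix G) x \<Longrightarrow> x \<le> graph_spectral_radius G"
proof -
  have n: "n > 0" using assms G unfolding n_def simple_graph_def by (simp add: card_gt_0_iff)
  have fin: "finite {x. eigenvalue (adjacency_matrix G) x}"
    using card_finite_spectrum(1) [OF adjacency_carrier] unfolding spectrum_def .
  have ne: "{x. eigenvalue (adjacency_matrix G) x} \<noteq> {}"
    using real_symmetric_eigenvalue_exists [OF adjacency_carrier n adjacency_symmetric] by auto
  show "eigenvalue (adjacency_matrix G) (graph_spectral_radius G)"
    using Max_in [OF fin ne] unfolding graph_spectral_radius_def by simp
  show "eigenvalue (adjacency_matrix G) x \<Longrightarrow> x \<le> graph_spectral_radius G"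
    using Max_ge [OF fin] unfolding graph_spectral_radius_def by simp
qed

text \<open>The absolute value of an eigenvector.\<close>

lemma spectral_radius_subsolution:
  assumes "vertices G \<noteq> {}"
  obtains y where "\<And>v. y v \<ge> 0" "\<exists>v\<in>vertices G. y v > 0"
    "\<And>v. v \<in> vertices G \<Longrightarrow> graph_spectral_radius G * y v \<le> (\<Sum>w\<in>neighbors G v. y w)"
proof -
  obtain f v0 where f: "v0 \<in> vertices G" "f v0 \<noteq> 0"
    "\<And>v. v \<in> vertices G \<Longrightarrow> (\<Sum>w\<in>neighbors G v. f w) = graph_spectral_radius G * f v"
    using graph_spectral_radius_eigenvalue(1) [OF assms] unfolding eigenvalue_adjacency_iff by blast
  show ?thesis
  proof (rule that [of "\<lambda>v. \<bar>f v\<bar>"])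
    show "\<exists>v\<in>vertices G. \<bar>f v\<bar> > 0" using f by auto
    fix v assume "v \<in> vertices G"
    then have "graph_spectral_radius G * \<bar>f v\<bar> \<le> \<bar>graph_spectral_radius G * f v\<bar>"
      by (simp add: abs_mult mult_right_mono)
    also have "\<dots> = \<bar>\<Sum>w\<in>neighbors G v. f w\<bar>" using f(3) \<open>v \<in> vertices G\<close> by simp
    also have "\<dots> \<le> (\<Sum>w\<in>neighbors G v. \<bar>f w\<bar>)" by (rule sum_abs)
    finally show "graph_spectral_radius G * \<bar>f v\<bar> \<le> (\<Sum>w\<in>neighbors G v. \<bar>f w\<bar>)" .
  qed auto
qed

lemma spectral_radius_ge_of_subsolution:
  assumes y: "\<And>v. v \<in> vertices G \<Longrightarrow> y v \<ge> 0" "v0 \<in> vertices G" "y v0 > 0"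
    and sub: "\<And>v. v \<in> vertices G \<Longrightarrow> \<mu> * y v \<le> (\<Sum>w\<in>neighbors G v. y w)"
  shows "\<mu> \<le> graph_spectral_radius G"
proof -
  obtain i0 where i0: "i0 < n" "vs ! i0 = v0" using adjacency_index [OF y(2)] .
  have mem: "vs ! i \<in> vertices G" if "i < n" for i
    using that adjacency_vs(1,3) nth_mem by metis
  have "\<exists>x. eigenvalue (adjacency_matrix G) x \<and> x \<ge> \<mu>"
  proof (rule eigenvalue_ge_of_subsolution [OF adjacency_carrier adjacency_symmetric])
    show "0 \<le> adjacency_matrix G $$ (i, j)" if "i < n" "j < n" for i j
      using that by (simp add: adjacency_entry)
    show "\<mu> * y (vs ! i) \<le> (\<Sum>j<n. adjacency_matrix G $$ (i, j) * y (vs ! j))" if "i < n" for i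
      using sub [OF mem [OF that]] adjacency_row_sum [OF that, of y] by simp
  qed (use i0 y mem in auto)
  then show ?thesis
    using graph_spectral_radius_eigenvalue(2) y(2) by fastforce
qed

end

text \<open>A subsolution of \<open>G\<close> is carried over along the isomorphism. The graph without vertices has to be treated
apart, because then the maximum is over the empty set on both sides.\<close>

lemma isomorphic_spectral_radius:
  fixes G :: "'a :: linorder ugraph" and H :: "'b :: linorder ugraph"
  assumes G: "simple_graph G" and H: "simple_graph H" and iso: "isomorphic G H"
  shows "graph_spectral_radius G \<le> graph_spectral_radius H"
proof (cases "vertices G = {}")
  case True
  then have "vertices H = {}" using iso unfolding isomorphic_def by (auto simp: bij_betw_def)
  have "\<not> eigenvalue (adjacency_matrix G) x" for x
    using True eigenvalue_adjacency_iff [OF G] by auto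
  moreover have "\<not> eigenvalue (adjacency_matrix H) x" for x
    using \<open>vertices H = {}\<close> eigenvalue_adjacency_iff [OF H] by auto
  ultimately show ?thesis by (simp add: graph_spectral_radius_def)
next
  case False
  obtain f where f: "bij_betw f (vertices G) (vertices H)" "(\<lambda>e. f ` e) ` edges G = edges H"
    using iso unfolding isomorphic_def by blast
  then have inj: "inj_on f (vertices G)" and im: "f ` vertices G = vertices H"
    by (auto simp: bij_betw_def)
  have nbr: "neighbors H (f v) = f ` neighbors G v" if v: "v \<in> vertices G" for v
  proof
    show "f ` neighbors G v \<subseteq> neighbors H (f v)"
    proof
      fix w assume "w \<in> f ` neighbors G v"
      then obtain u where u: "{v, u} \<in> edges G" "w = f u" unfolding neighbors_def by blast
      have "f ` {v, u} \<in> edges H" unfolding f(2) [symmetric] using u(1) by (rule imageI)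
      then show "w \<in> neighbors H (f v)" using u(2) by (simp add: neighbors_def)
    qed
    show "neighbors H (f v) \<subseteq> f ` neighbors G v"
    proof
      fix w assume w: "w \<in> neighbors H (f v)"
      then have "{f v, w} \<in> (`) f ` edges G" using f(2) by (simp add: neighbors_def)
      then obtain e where e: "e \<in> edges G" "{f v, w} = f ` e" by (rule imageE) auto
      obtain a b where ab: "e = {a, b}" "a \<in> vertices G" "b \<in> vertices G" 
        using G e(1) unfolding simple_graph_def by blast
      then have "f v = f a \<and> w = f b \<or> f v = f b \<and> w = f a"
        using e(2) by (auto simp: doubleton_eq_iff)
      then show "w \<in> f ` neighbors G v"
        using inj ab v e(1) unfolding neighbors_def inj_on_def by (auto simp: insert_commute)
    qed
  qed
  obtain y where y: "\<And>v. y v \<ge> 0" "\<exists>v\<in>vertices G. y v > 0"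
    "\<And>v. v \<in> vertices G \<Longrightarrow> graph_spectral_radius G * y v \<le> (\<Sum>w\<in>neighbors G v. y w)"
    using spectral_radius_subsolution [OF G False] by blast
  define g where "g = the_inv_into (vertices G) f"
  have g: "g (f v) = v" if "v \<in> vertices G" for v
    using that inj unfolding g_def by (simp add: the_inv_into_f_f)
  obtain v0 where v0: "v0 \<in> vertices G" "y v0 > 0" using y(2) by blast
  show ?thesis
  proof (rule spectral_radius_ge_of_subsolution [OF H, of "y \<circ> g" "f v0"])
    fix w assume "w \<in> vertices H"
    then obtain v where v: "v \<in> vertices G" "w = f v" using im by auto
    have "inj_on f (neighbors G v)"
      using inj neighbors_simple(1) [OF G] by (rule inj_on_subset)
    then have "(\<Sum>u\<in>neighbors H w. (y \<circ> g) u) = (\<Sum>u\<in>neighbors G v. y (g (f u)))"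
      using nbr [OF v(1)] v(2) by (simp add: sum.reindex)
    also have "\<dots> = (\<Sum>u\<in>neighbors G v. y u)"
      using g neighbors_simple(1) [OF G, of v] by (intro sum.cong) auto
    finally show "graph_spectral_radius G * (y \<circ> g) w \<le> (\<Sum>u\<in>neighbors H w. (y \<circ> g) u)"
      using y(3) [OF v(1)] v g by simp
  qed (use y v0 g im in auto)
qed

section \<open>Isomorphic graphs\<close>

lemma simple_graph_edge_subset: "simple_graph G \<Longrightarrow> e \<in> edges G \<Longrightarrow> e \<subseteq> vertices G"
  unfolding simple_graph_def by auto

lemma simple_graph_finite_edges: "simple_graph G \<Longrightarrow> finite (edges G)"
  using simple_graph_edge_subset [of G] finite_subset [of "edges G" "Pow (vertices G)"]
  by (auto simp: simple_graph_def)

lemma isomorphic_sym: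
  assumes "isomorphic G H" and G: "\<And>e. e \<in> edges G \<Longrightarrow> e \<subseteq> vertices G"
  shows "isomorphic H G"
proof -
  obtain f where f: "bij_betw f (vertices G) (vertices H)" "(\<lambda>e. f ` e) ` edges G = edges H"
    using assms unfolding isomorphic_def by blast
  define g where "g = the_inv_into (vertices G) f"
  have g: "bij_betw g (vertices H) (vertices G)"
    unfolding g_def by (rule bij_betw_the_inv_into [OF f(1)])
  have gf: "g (f v) = v" if "v \<in> vertices G" for v
    using that f(1) unfolding g_def bij_betw_def by (simp add: the_inv_into_f_f)
  have "g ` f ` e = e" if "e \<in> edges G" for e
  proof -
    have "g ` f ` e = (\<lambda>v. v) ` e"
      unfolding image_image using G [OF that] gf by (intro image_cong) auto
    then show ?thesis by simp
  qed
  then have "(\<lambda>e. g ` e) ` edges H = edges G"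
    unfolding f(2) [symmetric] image_image by simp
  then show ?thesis unfolding isomorphic_def using g by blast
qed

lemma isomorphic_trans: "isomorphic G H \<Longrightarrow> isomorphic H K \<Longrightarrow> isomorphic G K"
proof -
  assume "isomorphic G H" "isomorphic H K"
  then obtain f g where "bij_betw f (vertices G) (vertices H)" "(\<lambda>e. f ` e) ` edges G = edges H"
    "bij_betw g (vertices H) (vertices K)" "(\<lambda>e. g ` e) ` edges H = edges K"
    unfolding isomorphic_def by blast
  then have "bij_betw (g \<circ> f) (vertices G) (vertices K) \<and> (\<lambda>e. (g \<circ> f) ` e) ` edges G = edges K"
    by (metis (no_types, lifting) bij_betw_trans image_comp image_image image_cong)
  then show ?thesis unfolding isomorphic_def by blast
qed

lemma iso_class_eqI:
  assumes "simple_graph G" "simple_graph H" "isomorphic G H"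
  shows "iso_class G = iso_class H"
  using assms isomorphic_trans isomorphic_sym [OF assms(3)] simple_graph_edge_subset
  unfolding iso_class_def by blast

lemma isomorphic_simple_graph:
  assumes "isomorphic G H" "simple_graph G"
  shows "simple_graph H"
proof -
  obtain f where f: "bij_betw f (vertices G) (vertices H)" "(\<lambda>e. f ` e) ` edges G = edges H"
    using assms unfolding isomorphic_def by blast
  have "finite (vertices H)"
    using f(1) assms(2) bij_betw_finite unfolding simple_graph_def by blast
  moreover have "edges H \<subseteq> {{u, v} |u v. u \<in> vertices H \<and> v \<in> vertices H \<and> u \<noteq> v}"
  proof
    fix e assume "e \<in> edges H"
    then have "e \<in> (\<lambda>e. f ` e) ` edges G" using f(2) by simp
    then obtain e' where e': "e' \<in> edges G" "e = f ` e'" by (rule imageE) auto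
    obtain u v where uv: "e' = {u, v}" "u \<in> vertices G" "v \<in> vertices G" "u \<noteq> v"
      using simple_graph_edgeE [OF assms(2) e'(1)] .
    have "f u \<noteq> f v" "f u \<in> vertices H" "f v \<in> vertices H"
      using f(1) uv unfolding bij_betw_def inj_on_def by auto
    then show "e \<in> {{u, v} |u v. u \<in> vertices H \<and> v \<in> vertices H \<and> u \<noteq> v}"
      using e'(2) uv(1) by auto
  qed
  ultimately show ?thesis unfolding simple_graph_def by blast
qed

section \<open>Matchings and vertex covers\<close>

lemma finite_matchings: "simple_graph G \<Longrightarrow> finite {M. matching G M}"
  using simple_graph_finite_edges [of G] finite_subset [of "{M. matching G M}" "Pow (edges G)"]
  by (auto simp: matching_def)

lemma matching_number_ge:
  assumes "simple_graph G" "matching G M"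
  shows "card M \<le> matching_number G"
  unfolding matching_number_def
  by (rule Max_ge) (use finite_matchings [OF assms(1)] assms(2) in auto)

lemma maximum_matching:
  assumes "simple_graph G"
  obtains M where "matching G M" "card M = matching_number G"
proof -
  have "matching G {}" by (simp add: matching_def)
  then have "matching_number G \<in> card ` {M. matching G M}"
    unfolding matching_number_def by (intro Max_in) (use finite_matchings [OF assms] in auto)
  then show ?thesis using that by auto
qed

lemma matching_card_le_cover:
  assumes "matching G M" "finite S" "\<And>e. e \<in> edges G \<Longrightarrow> e \<inter> S \<noteq> {}"
  shows "card M \<le> card S"
proof -
  have "\<forall>e\<in>M. \<exists>v. v \<in> e \<inter> S"
    using assms(1,3) unfolding matching_def by blast
  then obtain h where h: "\<And>e. e \<in> M \<Longrightarrow> h e \<in> e \<inter> S" by metis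
  have "inj_on h M"
  proof (rule inj_onI)
    fix e e' assume "e \<in> M" "e' \<in> M" "h e = h e'"
    then show "e = e'"
      using h [of e] h [of e'] assms(1) unfolding matching_def pairwise_def disjnt_def by auto
  qed
  then show ?thesis
    using h assms(2) by (intro card_inj_on_le [of h]) auto
qed

lemma matching_of_family:
  fixes E :: "nat \<Rightarrow> 'a set"
  assumes "\<And>i. i < m \<Longrightarrow> E i \<in> edges G"
    and dis: "\<And>i j. i < j \<Longrightarrow> j < m \<Longrightarrow> E i \<inter> E j = {}" and ne: "\<And>i. i < m \<Longrightarrow> E i \<noteq> {}"
  shows "matching G (E ` {..<m}) \<and> card (E ` {..<m}) = m"
proof
  have dis': "E i \<inter> E j = {}" if "i < m" "j < m" "i \<noteq> j" for i j
    using dis [of i j] dis [of j i] that by (metis Int_commute linorder_neqE_nat)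
  show "matching G (E ` {..<m})"
    unfolding matching_def
  proof
    show "E ` {..<m} \<subseteq> edges G" using assms(1) by auto
    show "pairwise disjnt (E ` {..<m})"
    proof (rule pairwiseI)
      fix a b assume "a \<in> E ` {..<m}" "b \<in> E ` {..<m}" "a \<noteq> b"
      then obtain i j where "a = E i" "b = E j" "i < m" "j < m" "i \<noteq> j" by auto
      then show "disjnt a b" using dis' [of i j] by (simp add: disjnt_def)
    qed
  qed
  have "inj_on E {..<m}"
  proof (rule inj_onI)
    fix i j assume "i \<in> {..<m}" "j \<in> {..<m}" "E i = E j"
    then show "i = j" using dis' [of i j] ne [of i] by auto
  qed
  then show "card (E ` {..<m}) = m" by (simp add: card_image)
qed

lemma matching_number_le_isomorphic:
  assumes "simple_graph G" "simple_graph H" "isomorphic G H"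
  shows "matching_number G \<le> matching_number H"
proof -
  obtain f where f: "bij_betw f (vertices G) (vertices H)" "(\<lambda>e. f ` e) ` edges G = edges H"
    using assms unfolding isomorphic_def by blast
  have inj: "inj_on f (vertices G)" using f(1) by (simp add: bij_betw_def)
  obtain M where M: "matching G M" "card M = matching_number G"
    using maximum_matching [OF assms(1)] .
  have sub: "e \<subseteq> vertices G" if "e \<in> M" for e
    using that M(1) simple_graph_edge_subset [OF assms(1)] unfolding matching_def by blast
  have "inj_on (\<lambda>e. f ` e) M"
    using sub inj by (intro inj_onI) (metis inj_on_image_eq_iff)
  then have "card ((\<lambda>e. f ` e) ` M) = matching_number G"
    using M(2) by (simp add: card_image)
  moreover have "matching H ((\<lambda>e. f ` e) ` M)"
    unfolding matching_def
  proof
    show "(`) f ` M \<subseteq> edges H" using M(1) f(2) unfolding matching_def by blast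
    show "pairwise disjnt ((`) f ` M)"
    proof (rule pairwiseI)
      fix a b assume "a \<in> (`) f ` M" "b \<in> (`) f ` M" "a \<noteq> b"
      then obtain e e' where e: "e \<in> M" "e' \<in> M" "a = f ` e" "b = f ` e'" "e \<noteq> e'" by blast
      then have "e \<inter> e' = {}"
        using M(1) unfolding matching_def pairwise_def disjnt_def by blast
      then have "f ` e \<inter> f ` e' = {}"
        using inj_on_image_Int [OF inj sub [OF e(1)] sub [OF e(2)]] by simp
      then show "disjnt a b" using e unfolding disjnt_def by simp
    qed
  qed
  ultimately show ?thesis using matching_number_ge [OF assms(2)] by metis
qed

text \<open>An edge that misses all edges of a maximum matching would enlarge it.\<close>

lemma matching_vertex_cover:
  assumes "simple_graph G"
  obtains S where "S \<subseteq> vertices G" "card S \<le> 2 * matching_number G"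
    "\<And>e. e \<in> edges G \<Longrightarrow> e \<inter> S \<noteq> {}"
proof -
  obtain M where M: "matching G M" "card M = matching_number G"
    using maximum_matching [OF assms] .
  have fin: "finite M"
    using M(1) simple_graph_finite_edges [OF assms] finite_subset unfolding matching_def by blast
  have two: "card e \<le> 2" if "e \<in> M" for e
    using that M(1) unfolding matching_def by (auto elim!: simple_graph_edgeE [OF assms] intro: card_2_iff [THEN iffD2, THEN eq_imp_le])
  show ?thesis
  proof (rule that [of "\<Union>M"])
    show "\<Union>M \<subseteq> vertices G"
      using M(1) simple_graph_edge_subset [OF assms] unfolding matching_def by blast
    have "card (\<Union>M) \<le> (\<Sum>e\<in>M. card e)" by (rule card_Union_le_sum_card)
    also have "\<dots> \<le> (\<Sum>e\<in>M. 2)" using two by (rule sum_mono)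
    finally show "card (\<Union>M) \<le> 2 * matching_number G" using M(2) by simp
    fix e assume e: "e \<in> edges G"
    show "e \<inter> \<Union>M \<noteq> {}"
    proof
      assume empty: "e \<inter> \<Union>M = {}"
      have "e \<noteq> {}" using e by (auto elim!: simple_graph_edgeE [OF assms])
      then have "e \<notin> M" using empty by auto
      moreover have "matching G (insert e M)"
        using M(1) e empty unfolding matching_def pairwise_insert disjnt_def by auto
      ultimately show False
        using matching_number_ge [OF assms, of "insert e M"] M(2) fin by simp
    qed
  qed
qed

section \<open>Independent edges as a forbidden subgraph\<close>

lemma complete_graph_2: "complete_graph 2 = ({0, 1}, {{0, 1}})"
proof -
  have "{0, 1} \<in> {{i, j} | i j. i < (2::nat) \<and> j < 2 \<and> i \<noteq> j}"
    by (rule CollectI, rule exI [of _ 0], rule exI [of _ 1]) simp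
  moreover have "{{i, j} | i j. i < (2::nat) \<and> j < 2 \<and> i \<noteq> j} \<subseteq> {{0, 1}}"
  proof clarify
    fix i j :: nat assume "i < 2" "j < 2" "i \<noteq> j"
    then have "i = 0 \<and> j = 1 \<or> i = 1 \<and> j = 0" by linarith
    then show "{i, j} = {0, 1}" by auto
  qed
  ultimately have eq: "{{i, j} | i j. i < (2::nat) \<and> j < 2 \<and> i \<noteq> j} = {{0, 1}}" by blast
  have "{..<2::nat} = {0, 1}" by auto
  then show ?thesis unfolding complete_graph_def eq by simp
qed

lemma edges_copies_K2: "edges (copies m (complete_graph 2)) = (\<lambda>i. {prod_encode (i, 0), prod_encode (i, 1)}) ` {..<m}"
proof -
  show ?thesis
    unfolding copies_def relabel_def complete_graph_2 by auto
qed

lemma vertices_copies_K2: "vertices (copies m (complete_graph 2)) = prod_encode ` ({..<m} \<times> {0, 1})"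
  unfolding copies_def relabel_def complete_graph_2 by auto

text \<open>A copy of the graph is the same as a matching with \<open>Suc k\<close> edges, up to naming the ends of the edges.\<close>

lemma free_of_copies_K2_iff:
  fixes G :: "'a ugraph"
  assumes G: "simple_graph G"
  shows "free_of (copies (Suc k) (complete_graph 2)) G \<longleftrightarrow> matching_number G \<le> k"
proof
  let ?F = "copies (Suc k) (complete_graph 2)"
  assume free: "free_of ?F G"
  show "matching_number G \<le> k"
  proof (rule ccontr)
    assume "\<not> matching_number G \<le> k"
    obtain M0 where M0: "matching G M0" "card M0 = matching_number G"
      using maximum_matching [OF G] .
    then have "Suc k \<le> card M0" using \<open>\<not> matching_number G \<le> k\<close> by simp
    then obtain M where M: "M \<subseteq> M0" "card M = Suc k"
      by (rule obtain_subset_with_card_n) blast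
    then have mM: "matching G M"
      using M0(1) unfolding matching_def by (meson pairwise_mono order_refl subset_trans)
    have "finite M" using M(2) by (metis card.infinite nat.distinct(1))
    then obtain E where E: "bij_betw E {..<Suc k} M"
      using ex_bij_betw_nat_finite [of M] M(2) unfolding atLeast0LessThan by auto
    have EM: "E i \<in> edges G" if "i < Suc k" for i
    proof -
      have "E i \<in> M" using E that unfolding bij_betw_def by auto
      then show ?thesis using mM unfolding matching_def by blast
    qed
    have "\<forall>i<Suc k. \<exists>a b. E i = {a, b} \<and> a \<noteq> b"
    proof (intro allI impI)
      fix i assume "i < Suc k"
      then obtain u v where "E i = {u, v}" "u \<noteq> v"
        using simple_graph_edgeE [OF G EM] by metis
      then show "\<exists>a b. E i = {a, b} \<and> a \<noteq> b" by blast
    qed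
    then obtain a b where ab: "\<And>i. i < Suc k \<Longrightarrow> E i = {a i, b i} \<and> a i \<noteq> b i"
      by metis
    have dis: "E i \<inter> E j = {}" if ij: "i < Suc k" "j < Suc k" "i \<noteq> j" for i j
    proof -
      have "E i \<in> M" "E j \<in> M" "E i \<noteq> E j"
        using E ij unfolding bij_betw_def inj_on_def by auto
      then show ?thesis
        using mM unfolding matching_def by (metis disjnt_def pairwiseD)
    qed
    define g where "g x = (let (i, c) = prod_decode x in if c = 0 then a i else b i)" for x
    have g: "g (prod_encode (i, 0)) = a i" "g (prod_encode (i, Suc 0)) = b i" for i
      by (simp_all add: g_def)
    define H where "H = (\<Union>M, M)"
    have "inj_on g (vertices ?F)"
    proof (rule inj_onI)
      fix x y assume "x \<in> vertices ?F" "y \<in> vertices ?F" "g x = g y"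
      then obtain i c j d where x: "x = prod_encode (i, c)" "i < Suc k" "c = 0 \<or> c = 1"
        and y: "y = prod_encode (j, d)" "j < Suc k" "d = 0 \<or> d = 1"
        unfolding vertices_copies_K2 by auto
      have "g x \<in> E i" "g y \<in> E j"
        using x y ab [of i] ab [of j] g [of i] g [of j] by auto
      then have "i = j"
        using dis [of i j] x(2) y(2) \<open>g x = g y\<close> by (metis IntI empty_iff)
      then show "x = y"
        using x y \<open>g x = g y\<close> g [of i] ab [of i] by auto
    qed
    moreover have "g ` vertices ?F = vertices H"
    proof -
      have "g ` vertices ?F = (\<Union>i<Suc k. E i)"
      proof -
        have "vertices ?F = (\<Union>i<Suc k. {prod_encode (i, 0), prod_encode (i, Suc 0)})"
          unfolding vertices_copies_K2 by auto
        then have "g ` vertices ?F = (\<Union>i<Suc k. {a i, b i})"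
          by (simp only: image_UN image_insert image_empty g)
        then show ?thesis using ab by auto
      qed
      also have "\<dots> = \<Union>M" using E unfolding bij_betw_def by auto
      finally show ?thesis by (simp add: H_def)
    qed
    moreover have "(\<lambda>e. g ` e) ` edges ?F = edges H"
    proof -
      have "(\<lambda>e. g ` e) ` edges ?F = E ` {..<Suc k}"
        unfolding edges_copies_K2 image_image by (intro image_cong) (auto simp: g ab)
      then show ?thesis using E unfolding bij_betw_def H_def by simp
    qed
    ultimately have "isomorphic ?F H" unfolding isomorphic_def bij_betw_def by blast
    then have "isomorphic H ?F"
      by (rule isomorphic_sym) (auto simp: edges_copies_K2 vertices_copies_K2)
    moreover have "is_subgraph H G"
      unfolding is_subgraph_def simple_graph_def
    proof (intro conjI)
      have sub: "M \<subseteq> edges G" using mM unfolding matching_def by blast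
      show VG: "vertices H \<subseteq> vertices G"
        using sub simple_graph_edge_subset [OF G] by (auto simp: H_def)
      show "edges H \<subseteq> edges G" using sub by (simp add: H_def)
      show "finite (vertices H)"
        using VG G finite_subset unfolding simple_graph_def by blast
      show "edges H \<subseteq> {{u, v} |u v. u \<in> vertices H \<and> v \<in> vertices H \<and> u \<noteq> v}"
      proof
        fix e assume e: "e \<in> edges H"
        then have "e \<in> edges G" using sub by (auto simp: H_def)
        then obtain u v where "e = {u, v}" "u \<noteq> v" using simple_graph_edgeE [OF G] by metis
        moreover have "e \<subseteq> vertices H" using e by (auto simp: H_def)
        ultimately show "e \<in> {{u, v} |u v. u \<in> vertices H \<and> v \<in> vertices H \<and> u \<noteq> v}" by auto
      qed
    qed
    ultimately show False using free unfolding free_of_def by blast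
  qed
next
  let ?F = "copies (Suc k) (complete_graph 2)"
  assume le: "matching_number G \<le> k"
  show "free_of ?F G"
    unfolding free_of_def
  proof
    assume "\<exists>H :: 'a ugraph. is_subgraph H G \<and> isomorphic H ?F"
    then obtain H :: "'a ugraph" where H: "is_subgraph H G" "isomorphic H ?F" by blast
    have sH: "simple_graph H" using H(1) unfolding is_subgraph_def by blast
    have iso: "isomorphic ?F H"
      using isomorphic_sym [OF H(2)] simple_graph_edge_subset [OF sH] by blast
    have sF: "simple_graph ?F" using isomorphic_simple_graph [OF H(2) sH] .
    have "matching ?F (edges ?F)"
      unfolding matching_def pairwise_def disjnt_def edges_copies_K2 by (auto simp: prod_encode_eq)
    moreover have "card (edges ?F) = Suc k"
      unfolding edges_copies_K2 by (subst card_image) (auto simp: inj_on_def doubleton_eq_iff prod_encode_eq)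
    ultimately have "Suc k \<le> matching_number ?F"
      using matching_number_ge [OF sF] by metis
    also have "\<dots> \<le> matching_number H"
      by (rule matching_number_le_isomorphic [OF sF sH iso])
    also have "\<dots> \<le> matching_number G"
    proof -
      obtain M where M: "matching H M" "card M = matching_number H"
        using maximum_matching [OF sH] .
      then have "matching G M" using H(1) unfolding matching_def is_subgraph_def by blast
      then show ?thesis using matching_number_ge [OF G] M(2) by metis
    qed
    finally show False using le by simp
  qed
qed

section \<open>The extremal graphs\<close>

definition star_graph :: "nat \<Rightarrow> nat ugraph" where
  "star_graph n = ({..<n}, {{0, j} | j. 1 \<le> j \<and> j < n})"

lemma simple_star_graph: "simple_graph (star_graph n)"
proof -
  have "{0, j} \<in> {{u, v} |u v. u \<in> {..<n} \<and> v \<in> {..<n} \<and> u \<noteq> v}" if "1 \<le> j" "j < n" for j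
    by (rule CollectI, rule exI [of _ 0], rule exI [of _ j]) (use that in simp)
  then show ?thesis unfolding simple_graph_def star_graph_def by auto
qed

lemma simple_model_graph:
  assumes "2 * q + 3 \<le> n"
  shows "simple_graph (model_graph n q)"
proof -
  have "{u, v} \<in> {{u, v} |u v. u \<in> {..<n} \<and> v \<in> {..<n} \<and> u \<noteq> v}" if "u < n" "v < n" "u \<noteq> v" for u v
    using that by blast
  then show ?thesis
    using assms unfolding simple_graph_def model_graph_def by auto
qed

lemma matching_number_star_graph:
  assumes "n \<ge> 2"
  shows "matching_number (star_graph n) = 1"
proof (rule antisym)
  obtain M where M: "matching (star_graph n) M" "card M = matching_number (star_graph n)"
    using maximum_matching [OF simple_star_graph] .
  have "card M \<le> card {0::nat}"
    by (rule matching_card_le_cover [OF M(1)]) (auto simp: star_graph_def)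
  then show "matching_number (star_graph n) \<le> 1" using M(2) by simp
  have "matching (star_graph n) {{0, 1}}"
    using assms unfolding matching_def star_graph_def by (auto intro!: exI [of _ 1])
  then show "1 \<le> matching_number (star_graph n)"
    using matching_number_ge [OF simple_star_graph, of n "{{0, 1}}"] by simp
qed

text \<open>The vertices 0 and 1 and every second vertex of the path form a vertex cover with \<open>q + 2\<close> elements.
A matching of the same size takes every second edge of the path; this leaves the last
vertex of the path and the first isolated vertex to be matched with 0 and 1.\<close>

lemma matching_number_model_graph:
  assumes n: "2 * q + 4 \<le> n"
  shows "matching_number (model_graph n q) = q + 2"
proof (rule antisym)
  have simple: "simple_graph (model_graph n q)"
    by (rule simple_model_graph) (use n in simp)
  obtain M where M: "matching (model_graph n q) M" "card M = matching_number (model_graph n q)"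
    using maximum_matching [OF simple] .
  define S where "S = {0, 1} \<union> (\<lambda>i. 2 * i + 3) ` {..<q}"
  have "card M \<le> card S"
  proof (rule matching_card_le_cover [OF M(1)])
    show "finite S" by (simp add: S_def)
    fix e assume "e \<in> edges (model_graph n q)"
    then consider "0 \<in> e" | "1 \<in> e" | j where "e = {j, Suc j}" "2 \<le> j" "j < 2 * q + 2"
      unfolding model_graph_def by auto
    then show "e \<inter> S \<noteq> {}"
    proof cases
      case 3
      show ?thesis
      proof (cases "even j")
        case True
        then obtain i where "j = 2 * i" by (elim evenE)
        then have "Suc j = 2 * (i - 1) + 3" "i - 1 < q" using 3 by auto
        then have "Suc j \<in> S" unfolding S_def by blast
        then show ?thesis using 3 by auto
      next
        case False
        then obtain i where "j = 2 * i + 1" by (elim oddE)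
        then have "j = 2 * (i - 1) + 3" "i - 1 < q" using 3 by auto
        then have "j \<in> S" unfolding S_def by blast
        then show ?thesis using 3 by auto
      qed
    qed (auto simp: S_def)
  qed
  also have "card S \<le> card {0, 1::nat} + card ((\<lambda>i::nat. 2 * i + 3) ` {..<q})"
    unfolding S_def by (rule card_Un_le)
  also have "\<dots> \<le> q + 2" using card_image_le [of "{..<q}" "\<lambda>i::nat. 2 * i + 3"] by simp
  finally show "matching_number (model_graph n q) \<le> q + 2" using M(2) by simp
  define E where "E i = (if i < q then {2 * i + 2, 2 * i + 3} else if i = q then {0, 2 * q + 2} else {1, 2 * q + 3})" for i
  have "E i \<in> edges (model_graph n q)" if "i < q + 2" for i
  proof -
    have "{2 * i + 2, 2 * i + 3} \<in> {{j, Suc j} | j. 2 \<le> j \<and> j < 2 * q + 2}" if "i < q"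
      using that by (intro CollectI exI [of _ "2 * i + 2"]) (simp add: eval_nat_numeral)
    then show ?thesis using n that unfolding E_def model_graph_def by auto
  qed
  moreover have "E i \<inter> E j = {}" if "i < j" "j < q + 2" for i j
  proof -
    have low: "x div 2 = l + 1" if "x \<in> E l" "l < q" for x l
      using that by (auto simp: E_def)
    have high: "x div 2 = 0 \<or> x div 2 = q + 1" if "x \<in> E l" "\<not> l < q" for x l
      using that by (auto simp: E_def split: if_splits)
    show ?thesis
    proof (cases "i < q")
      case True
      then show ?thesis using low [of _ i] low [of _ j] high [of _ j] \<open>i < j\<close> by fastforce
    next
      case False
      then have "i = q" "j = Suc q" using that by auto
      then show ?thesis by (auto simp: E_def)
    qed
  qed
  moreover have "E i \<noteq> {}" for i by (simp add: E_def)
  ultimately have L: "matching (model_graph n q) (E ` {..<q + 2}) \<and> card (E ` {..<q + 2}) = q + 2"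
    by (intro matching_of_family) auto
  then show "q + 2 \<le> matching_number (model_graph n q)"
    using matching_number_ge [OF simple, of "E ` {..<q + 2}"] by simp
qed

text \<open>The constructors \<open>Inl\<close> and \<open>Inr\<close> tag the two sides of the join, so \<open>g\<close> only has to enumerate \<open>H\<close> with
the path in front.\<close>

lemma isomorphic_join_K2:
  assumes g: "bij_betw g {2..<n} (vertices H)" and E: "edges H = {{g j, g (Suc j)} | j. 2 \<le> j \<and> j < 2 * q + 2}"
    and n: "2 * q + 3 \<le> n"
  shows "isomorphic (model_graph n q) (graph_join (complete_graph 2) H)"
proof -
  let ?J = "graph_join (complete_graph 2) H"
  define f where "f j = (if j < 2 then sum_encode (Inl j) else sum_encode (Inr (g j)))" for j
  note K2 = complete_graph_2
  have gim: "g ` {2..<n} = vertices H" and ginj: "inj_on g {2..<n}"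
    using g by (auto simp: bij_betw_def)
  have split: "{..<n} = {0, 1} \<union> {2..<n}" using n by auto
  have f: "f 0 = sum_encode (Inl 0)" "f (Suc 0) = sum_encode (Inl 1)" "\<And>j. 2 \<le> j \<Longrightarrow> f j = sum_encode (Inr (g j))"
    by (auto simp: f_def)
  have V: "vertices ?J = f ` {..<n}"
  proof -
    have "f ` {..<n} = {sum_encode (Inl 0), sum_encode (Inl 1)} \<union> (\<lambda>j. sum_encode (Inr (g j))) ` {2..<n}"
      unfolding split image_Un by (auto simp: f)
    also have "\<dots> = {sum_encode (Inl 0), sum_encode (Inl 1)} \<union> (\<lambda>v. sum_encode (Inr v)) ` vertices H"
      unfolding gim [symmetric] by auto
    finally show ?thesis
      unfolding graph_join_def disjoint_union_def relabel_def K2 by (auto simp: Let_def)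
  qed
  have "inj_on f {..<n}"
  proof (rule inj_onI)
    fix i j assume ij: "i \<in> {..<n}" "j \<in> {..<n}" "f i = f j"
    show "i = j"
      using ij inj_onD [OF ginj, of i j] by (auto simp: f_def sum_encode_eq split: if_splits)
  qed
  moreover have "(\<lambda>e. f ` e) ` edges (model_graph n q) = edges ?J"
  proof -
    have join: "{{sum_encode (Inl u), sum_encode (Inr v)} | u v. u \<in> {0::nat, 1} \<and> v \<in> W} =
      (\<lambda>v. {sum_encode (Inl 0), sum_encode (Inr v)}) ` W \<union> (\<lambda>v. {sum_encode (Inl 1), sum_encode (Inr v)}) ` W" for W
      by blast
    have J: "edges ?J = {{f 0, f 1}} \<union> (\<lambda>e. (\<lambda>v. sum_encode (Inr v)) ` e) ` edges H \<union>
       ((\<lambda>v. {f 0, sum_encode (Inr v)}) ` vertices H \<union> (\<lambda>v. {f 1, sum_encode (Inr v)}) ` vertices H)"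
      unfolding graph_join_def disjoint_union_def relabel_def K2 Let_def fst_conv snd_conv join by (simp add: f)
    have "edges H = (\<lambda>j. {g j, g (Suc j)}) ` {j. 2 \<le> j \<and> j < 2 * q + 2}"
      unfolding E by blast
    then have "(\<lambda>e. (\<lambda>v. sum_encode (Inr v)) ` e) ` edges H = (\<lambda>j. {f j, f (Suc j)}) ` {j. 2 \<le> j \<and> j < 2 * q + 2}"
      unfolding image_image by (simp add: image_image f cong: image_cong_simp)
    moreover have "(\<lambda>v. {c, sum_encode (Inr v)}) ` vertices H = (\<lambda>j. {c, f j}) ` {2..<n}" for c
      unfolding gim [symmetric] image_image by (intro image_cong) (auto simp: f)
    ultimately have J': "edges ?J = {{f 0, f 1}} \<union> (\<lambda>j. {f j, f (Suc j)}) ` {j. 2 \<le> j \<and> j < 2 * q + 2} \<union>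
       ((\<lambda>j. {f 0, f j}) ` {2..<n} \<union> (\<lambda>j. {f 1, f j}) ` {2..<n})"
      unfolding J by simp
    have "edges (model_graph n q) = {{0, 1}} \<union> (\<lambda>j. {0, j}) ` {2..<n} \<union> (\<lambda>j. {1, j}) ` {2..<n} \<union>
       (\<lambda>j. {j, Suc j}) ` {j. 2 \<le> j \<and> j < 2 * q + 2}"
      unfolding model_graph_def snd_conv by (intro arg_cong2 [where f = "(\<union>)"]) auto
    then have "(\<lambda>e. f ` e) ` edges (model_graph n q) =
       {{f 0, f 1}} \<union> (\<lambda>j. {f 0, f j}) ` {2..<n} \<union> (\<lambda>j. {f 1, f j}) ` {2..<n} \<union>
       (\<lambda>j. {f j, f (Suc j)}) ` {j. 2 \<le> j \<and> j < 2 * q + 2}"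
      by (simp only: image_Un image_image image_insert image_empty)
    then show ?thesis unfolding J' by (simp only: Un_ac)
  qed
  moreover have "vertices (model_graph n q) = {..<n}" by (simp add: model_graph_def)
  ultimately show ?thesis
    unfolding isomorphic_def bij_betw_def using V by auto
qed

lemma complete_graph_1: "complete_graph 1 = ({0}, {})"
  unfolding complete_graph_def by auto

lemma copies_K1: "copies m (complete_graph 1) = ((\<lambda>i. prod_encode (i, 0)) ` {..<m}, {})"
  unfolding copies_def relabel_def complete_graph_1 by auto

lemma isomorphic_model_M_graph:
  assumes k: "k \<ge> 2" and n: "2 * k - 1 \<le> n"
  shows "isomorphic (model_graph n (k - 2)) (M_graph n k)"
proof (cases "k = 2")
  case True
  have "isomorphic (model_graph n 0) (graph_join (complete_graph 2) (copies (n - 2) (complete_graph 1)))"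
  proof (rule isomorphic_join_K2 [of "\<lambda>j. prod_encode (j - 2, 0)"])
    have "inj_on (\<lambda>j. prod_encode (j - 2, 0)) {2..<n}"
      by (auto simp: inj_on_def prod_encode_eq)
    moreover have "(\<lambda>j. prod_encode (j - 2, 0)) ` {2..<n} = (\<lambda>i. prod_encode (i, 0)) ` {..<n - 2}"
    proof -
      have "(\<lambda>j. j - 2) ` {2..<n} = {..<n - 2}"
        using n True by (subst image_minus_const_atLeastLessThan_nat) (auto simp: lessThan_atLeast0)
      then show ?thesis by (simp only: image_image [symmetric, of "\<lambda>i. prod_encode (i, 0)" "\<lambda>j. j - 2"])
    qed
    ultimately show "bij_betw (\<lambda>j. prod_encode (j - 2, 0)) {2..<n} (vertices (copies (n - 2) (complete_graph 1)))"
      unfolding copies_K1 bij_betw_def by simp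
  qed (use n True in \<open>auto simp: copies_K1 [simplified]\<close>)
  then show ?thesis using True by (simp add: M_graph_def)
next
  case False
  define q where "q = k - 2"
  have q: "q \<ge> 1" "k = q + 2" using k False by (auto simp: q_def)
  define H where "H = disjoint_union (path_graph (2 * k - 3)) (copies (n + 1 - 2 * k) (complete_graph 1))"
  define g where "g j = (if j < 2 * q + 3 then sum_encode (Inl (j - 2))
      else sum_encode (Inr (prod_encode (j - (2 * q + 3), 0))))" for j
  have len: "2 * k - 3 = 2 * q + 1" "n + 1 - 2 * k = n - (2 * q + 3)" "2 * q + 3 \<le> n"
    using q n by auto
  have "isomorphic (model_graph n q) (graph_join (complete_graph 2) H)"
  proof (rule isomorphic_join_K2 [of g])
    have "inj_on g {2..<n}"
      by (auto simp: inj_on_def g_def sum_encode_eq prod_encode_eq split: if_splits)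
    moreover have "g ` {2..<n} = vertices H"
    proof -
      have s: "{2..<n} = {2..<2 * q + 3} \<union> {2 * q + 3..<n}" using len by auto
      have im1: "(\<lambda>j. j - 2) ` {2..<2 * q + 3} = {..<2 * q + 1}"
        by (subst image_minus_const_atLeastLessThan_nat) (auto simp: lessThan_atLeast0)
      have "g ` {2..<2 * q + 3} = (\<lambda>j. sum_encode (Inl (j - 2))) ` {2..<2 * q + 3}"
        by (intro image_cong) (auto simp: g_def)
      then have 1: "g ` {2..<2 * q + 3} = (\<lambda>i. sum_encode (Inl i)) ` {..<2 * q + 1}"
        unfolding im1 [symmetric] image_image .
      have im2: "(\<lambda>j. j - (2 * q + 3)) ` {2 * q + 3..<n} = {..<n - (2 * q + 3)}"
        using len by (subst image_minus_const_atLeastLessThan_nat) (auto simp: lessThan_atLeast0)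
      have "g ` {2 * q + 3..<n} = (\<lambda>j. sum_encode (Inr (prod_encode (j - (2 * q + 3), 0)))) ` {2 * q + 3..<n}"
        by (intro image_cong) (auto simp: g_def)
      then have 2: "g ` {2 * q + 3..<n} = (\<lambda>i. sum_encode (Inr (prod_encode (i, 0)))) ` {..<n - (2 * q + 3)}"
        unfolding im2 [symmetric] image_image .
      have "vertices H = (\<lambda>i. sum_encode (Inl i)) ` {..<2 * q + 1} \<union> (\<lambda>i. sum_encode (Inr (prod_encode (i, 0)))) ` {..<n - (2 * q + 3)}"
        unfolding H_def len disjoint_union_def relabel_def path_graph_def copies_K1
        by (simp add: Let_def image_image)
      then show ?thesis unfolding s image_Un 1 2 by simp
    qed
    ultimately show "bij_betw g {2..<n} (vertices H)" unfolding bij_betw_def by blast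
    have im: "{i. Suc i < 2 * q + 1} = (\<lambda>j. j - 2) ` {2..<2 * q + 2}"
      by (subst image_minus_const_atLeastLessThan_nat) auto
    have "edges H = (\<lambda>i. {sum_encode (Inl i), sum_encode (Inl (Suc i))}) ` {i. Suc i < 2 * q + 1}"
      unfolding H_def len disjoint_union_def relabel_def path_graph_def copies_K1
      by (simp add: Let_def setcompr_eq_image image_image)
    also have "\<dots> = (\<lambda>j. {g j, g (Suc j)}) ` {2..<2 * q + 2}"
    proof -
      have "Suc (j - 2) = j - Suc 0" if "2 \<le> j" for j using that by arith
      then show ?thesis
        unfolding im image_image by (intro image_cong) (simp_all add: g_def)
    qed
    also have "\<dots> = {{g j, g (Suc j)} | j. 2 \<le> j \<and> j < 2 * q + 2}"
      by auto
    finally show "edges H = {{g j, g (Suc j)} | j. 2 \<le> j \<and> j < 2 * q + 2}" .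
    show "2 * q + 3 \<le> n" using len by simp
  qed
  then show ?thesis using k False by (simp add: M_graph_def H_def q_def)
qed

lemma isomorphic_star_M_graph:
  assumes "n \<ge> 1"
  shows "isomorphic (star_graph n) (M_graph n 1)"
proof -
  define f where "f j = (if j = 0 then sum_encode (Inl 0) else sum_encode (Inr (j - 1)))" for j :: nat
  have "inj_on f {..<n}" by (auto simp: inj_on_def f_def sum_encode_eq split: if_splits)
  moreover have "f ` {..<n} = sum_encode ` ({..<1} <+> {..<n - 1})"
  proof -
    have "{..<n} = insert 0 (Suc ` {..<n - 1})"
      using assms lessThan_Suc_eq_insert_0 [of "n - 1"] by simp
    then have "f ` {..<n} = insert (f 0) ((\<lambda>i. f (Suc i)) ` {..<n - 1})"
      by (simp add: image_image)
    also have "\<dots> = sum_encode ` ({..<1} <+> {..<n - 1})"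
      by (auto simp: f_def)
    finally show ?thesis .
  qed
  moreover have "(\<lambda>e. f ` e) ` edges (star_graph n) = {{sum_encode (Inl i), sum_encode (Inr j)} |i j. i < 1 \<and> j < n - 1}"
  proof -
    have "edges (star_graph n) = (\<lambda>j. {0, j}) ` {1..<n}"
      unfolding star_graph_def snd_conv by auto
    also have "{1..<n} = Suc ` {..<n - 1}"
      using assms by (simp add: lessThan_atLeast0 image_Suc_atLeastLessThan)
    finally have "(\<lambda>e. f ` e) ` edges (star_graph n) = (\<lambda>j. {sum_encode (Inl 0), sum_encode (Inr j)}) ` {..<n - 1}"
      by (simp add: image_image f_def insert_commute)
    also have "\<dots> = {{sum_encode (Inl i), sum_encode (Inr j)} |i j. i < 1 \<and> j < n - 1}"
      by auto
    finally show ?thesis .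
  qed
  ultimately show ?thesis
    unfolding isomorphic_def bij_betw_def M_graph_def complete_bipartite_def
    by (auto simp: star_graph_def)
qed

section \<open>Joins with an edge\<close>

lemma edge_double_count:
  fixes h :: "'a \<Rightarrow> real"
  assumes "finite A" "finite B"
  shows "(\<Sum>a\<in>A. \<Sum>b\<in>neighbors G a \<inter> B. h b) = (\<Sum>b\<in>B. real (card (neighbors G b \<inter> A)) * h b)"
proof -
  have "(\<Sum>a\<in>A. \<Sum>b\<in>neighbors G a \<inter> B. h b) = (\<Sum>a\<in>A. \<Sum>b\<in>{b. b \<in> B \<and> b \<in> neighbors G a}. h b)"
    by (intro sum.cong) auto
  also have "\<dots> = (\<Sum>b\<in>B. \<Sum>a\<in>{a. a \<in> A \<and> b \<in> neighbors G a}. h b)"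
    by (rule sum.swap_restrict [OF assms])
  also have "\<dots> = (\<Sum>b\<in>B. \<Sum>a\<in>neighbors G b \<inter> A. h b)"
    using neighbors_sym by (intro sum.cong) fastforce+
  finally show ?thesis by simp
qed

definition remove_vertices :: "'a ugraph \<Rightarrow> 'a set \<Rightarrow> 'a ugraph" where
  "remove_vertices G X = (vertices G - X, {e \<in> edges G. e \<inter> X = {}})"

lemma simple_remove_vertices: "simple_graph G \<Longrightarrow> simple_graph (remove_vertices G X)"
  unfolding simple_graph_def remove_vertices_def by (auto dest!: subsetD)

lemma neighbors_remove_vertices: "w \<notin> X \<Longrightarrow> neighbors (remove_vertices G X) w = neighbors G w - X"
  unfolding neighbors_def remove_vertices_def by auto

text \<open>Graphs that are the join of the edge \<open>{u, v}\<close> with the graph \<open>H\<close> on the other vertices; \<open>d\<close> is the degree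
in \<open>H\<close>.\<close>

locale hub_pair =
  fixes G :: "'a :: linorder ugraph" and u v :: 'a
  assumes simple: "simple_graph G"
    and uv: "{u, v} \<in> edges G"
    and hubs: "\<And>w. w \<in> vertices G - {u, v} \<Longrightarrow> {u, w} \<in> edges G \<and> {v, w} \<in> edges G"
begin

definition "H = remove_vertices G {u, v}"
definition "d w = real (card (neighbors H w))"

lemma hub_facts: "u \<noteq> v" "u \<in> vertices G" "v \<in> vertices G" "finite (vertices G)"
  using uv simple by (auto simp: simple_graph_def doubleton_eq_iff)

lemma simple_H: "simple_graph H"
  unfolding H_def by (rule simple_remove_vertices [OF simple])

lemma vertices_H: "vertices H = vertices G - {u, v}" "finite (vertices H)"
  using hub_facts(4) unfolding H_def by (auto simp: remove_vertices_def)

lemma neighbors_rest: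
  assumes "w \<in> vertices H"
  shows "neighbors G w = insert u (insert v (neighbors H w))" "u \<notin> neighbors H w" "v \<notin> neighbors H w"
    "finite (neighbors H w)" "neighbors H w \<subseteq> vertices H"
proof -
  have w: "w \<in> vertices G - {u, v}" using assms vertices_H by simp
  have N: "neighbors H w = neighbors G w - {u, v}"
    unfolding H_def by (rule neighbors_remove_vertices) (use w in simp)
  have "u \<in> neighbors G w" "v \<in> neighbors G w"
    using hubs [OF w] by (simp_all add: neighbors_def insert_commute)
  then show "neighbors G w = insert u (insert v (neighbors H w))" "u \<notin> neighbors H w" "v \<notin> neighbors H w"
    using N by auto
  show "finite (neighbors H w)" "neighbors H w \<subseteq> vertices H"
    using neighbors_simple [OF simple_H] by auto
qed

lemma neighbors_hub: "neighbors G u = insert v (vertices H)" "neighbors G v = insert u (vertices H)"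
  using neighbors_simple(1,3) [OF simple, of u] neighbors_simple(1,3) [OF simple, of v] uv hubs
  by (auto simp: vertices_H neighbors_def insert_commute)

lemma sum_neighbors_rest:
  "w \<in> vertices H \<Longrightarrow> (\<Sum>x\<in>neighbors G w. y x) = y u + y v + (\<Sum>x\<in>neighbors H w. (y x :: real))"
  using neighbors_rest [of w] hub_facts(1) by simp

lemma sum_neighbors_hub:
  "(\<Sum>x\<in>neighbors G u. y x) = y v + (\<Sum>x\<in>vertices H. (y x :: real))"
  "(\<Sum>x\<in>neighbors G v. y x) = y u + (\<Sum>x\<in>vertices H. y x)"
  unfolding neighbors_hub using vertices_H by simp_all

lemma card_vertices_H: "real (card (vertices H)) = real (card (vertices G)) - 2"
proof -
  have "card (vertices G) = Suc (Suc (card (vertices H)))"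
  proof -
    have "vertices G = insert u (insert v (vertices H))" using hub_facts vertices_H by auto
    moreover have "u \<notin> insert v (vertices H)" "v \<notin> vertices H" using hub_facts(1) vertices_H(1) by auto
    ultimately show ?thesis using vertices_H(2) by (metis card_insert_disjoint finite_insert)
  qed
  then show ?thesis by simp
qed

lemma sum_over_H_neighbors:
  "(\<Sum>w\<in>vertices H. \<Sum>x\<in>neighbors H w. y x) = (\<Sum>x\<in>vertices H. d x * y x)"
proof -
  have "neighbors H w \<inter> vertices H = neighbors H w" for w
    using neighbors_simple(1) [OF simple_H] by auto
  then show ?thesis
    using edge_double_count [OF vertices_H(2) vertices_H(2), of y H] by (simp add: d_def)
qed

text \<open>For an eigenvector with the value 1 at \<open>u\<close> and \<open>v\<close>, the entries on \<open>H\<close> would be twice the series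
\<open>1 / lam + d w / lam\<^sup>2 + c w / lam\<^sup>3 + ...\<close> that counts the walks in \<open>H\<close> starting at \<open>w\<close>. Cutting the series off after the
third term leaves a subsolution exactly when the inequality required at \<open>u\<close> and \<open>v\<close> holds, which is the assumption.\<close>

lemma spectral_radius_lower:
  assumes l: "lam > 0"
    and le: "lam ^ 4 - lam ^ 3 \<le> 2 * ((real (card (vertices G)) - 2) * lam\<^sup>2 + (\<Sum>w\<in>vertices H. d w) * lam + (\<Sum>w\<in>vertices H. (d w)\<^sup>2))"
  shows "lam \<le> graph_spectral_radius G"
proof -
  define c where "c w = (\<Sum>x\<in>neighbors H w. d x)" for w
  define t where "t w = 2 * (1 / lam + d w / lam\<^sup>2 + c w / lam ^ 3)" for w
  define y where "y w = (if w \<in> {u, v} then 1 else t w)" for w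
  have dc: "d w \<ge> 0" "c w \<ge> 0" for w
    unfolding d_def c_def by (auto intro: sum_nonneg)
  have t: "t w \<ge> 0" "t w \<ge> 2 * (1 / lam + d w / lam\<^sup>2)" for w
    unfolding t_def using dc l by (auto intro!: add_nonneg_nonneg divide_nonneg_nonneg)
  have yH: "y w = t w" if "w \<in> vertices H" for w
    using that by (auto simp: y_def vertices_H)
  have sumH: "(\<Sum>w\<in>vertices H. y w) = 2 * ((real (card (vertices G)) - 2) / lam + (\<Sum>w\<in>vertices H. d w) / lam\<^sup>2 + (\<Sum>w\<in>vertices H. (d w)\<^sup>2) / lam ^ 3)"
  proof -
    have "(\<Sum>w\<in>vertices H. y w) = (\<Sum>w\<in>vertices H. t w)" using yH by simp
    also have "\<dots> = 2 * (real (card (vertices H)) / lam + (\<Sum>w\<in>vertices H. d w) / lam\<^sup>2 + (\<Sum>w\<in>vertices H. c w) / lam ^ 3)"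
      unfolding t_def sum_distrib_left [symmetric] by (simp add: sum.distrib sum_divide_distrib)
    also have "(\<Sum>w\<in>vertices H. c w) = (\<Sum>w\<in>vertices H. (d w)\<^sup>2)"
      unfolding c_def sum_over_H_neighbors by (simp add: power2_eq_square)
    finally show ?thesis using card_vertices_H by simp
  qed
  have "lam \<le> 1 + (\<Sum>w\<in>vertices H. y w)"
  proof -
    have "lam ^ 3 * (1 + 2 * (m / lam + D1 / lam\<^sup>2 + D2 / lam ^ 3)) = lam ^ 3 + 2 * (m * lam\<^sup>2 + D1 * lam + D2)" for m D1 D2
      using l by (simp add: field_simps eval_nat_numeral)
    moreover have "lam ^ 3 * lam = lam ^ 4" by (simp add: eval_nat_numeral)
    ultimately have "lam ^ 3 * lam \<le> lam ^ 3 * (1 + (\<Sum>w\<in>vertices H. y w))"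
      unfolding sumH using le by (simp only:)
    then show ?thesis using l by simp
  qed
  then have hub: "lam * y w \<le> (\<Sum>x\<in>neighbors G w. y x)" if "w \<in> {u, v}" for w
    using that sum_neighbors_hub [of y] by (auto simp: y_def)
  have rest: "lam * y w \<le> (\<Sum>x\<in>neighbors G w. y x)" if w: "w \<in> vertices H" for w
  proof -
    have "lam * y w = 2 + 2 * (d w / lam + c w / lam\<^sup>2)"
      using l yH [OF w] by (simp add: t_def field_simps eval_nat_numeral)
    also have "2 * (d w / lam + c w / lam\<^sup>2) = (\<Sum>x\<in>neighbors H w. 2 * (1 / lam + d x / lam\<^sup>2))"
      unfolding c_def sum_distrib_left [symmetric] by (simp add: sum.distrib sum_divide_distrib d_def)
    also have "\<dots> \<le> (\<Sum>x\<in>neighbors H w. y x)"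
      using t(2) yH neighbors_rest(5) [OF w] by (intro sum_mono) auto
    also have "2 + (\<Sum>x\<in>neighbors H w. y x) = (\<Sum>x\<in>neighbors G w. y x)"
      using sum_neighbors_rest [OF w, of y] by (simp add: y_def)
    finally show ?thesis by simp
  qed
  show ?thesis
  proof (rule spectral_radius_ge_of_subsolution [OF simple, of y u])
    show "y w \<ge> 0" if "w \<in> vertices G" for w
      using t by (simp add: y_def)
    show "lam * y w \<le> (\<Sum>x\<in>neighbors G w. y x)" if "w \<in> vertices G" for w
      using hub rest that vertices_H by blast
  qed (use hub_facts in \<open>auto simp: y_def\<close>)
qed

text \<open>The counterpart of the lower bound: summing the inequalities of a subsolution over \<open>H\<close> with the weights
1, \<open>d\<close> and \<open>c\<close> expands the sum of the entries into the same three terms and a remainder. As all degrees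
are at most 2, the entries on \<open>H\<close> are at most \<open>a / (\<mu> - 2)\<close>, where \<open>a\<close> is the sum of the entries at the hubs.
This bounds the remainder by the factor \<open>2 / (\<mu> - 2)\<close> in the last term.\<close>

lemma spectral_radius_upper:
  defines "\<mu> \<equiv> graph_spectral_radius G"
  assumes mu: "\<mu> > 2" and deg: "\<And>w. w \<in> vertices H \<Longrightarrow> d w \<le> 2"
  shows "\<mu> ^ 4 - \<mu> ^ 3 \<le> 2 * ((real (card (vertices G)) - 2) * \<mu>\<^sup>2 + (\<Sum>w\<in>vertices H. d w) * \<mu>
      + (\<Sum>w\<in>vertices H. (d w)\<^sup>2) * (1 + 2 / (\<mu> - 2)))"
proof -
  obtain y where y: "\<And>w. y w \<ge> 0" "\<exists>w\<in>vertices G. y w > 0"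
    and sub: "\<And>w. w \<in> vertices G \<Longrightarrow> \<mu> * y w \<le> (\<Sum>x\<in>neighbors G w. y x)"
    using spectral_radius_subsolution [OF simple] hub_facts unfolding \<mu>_def by blast
  define a where "a = y u + y v"
  define Y where "Y = (\<Sum>x\<in>vertices H. y x)"
  have a0: "a \<ge> 0" using y by (simp add: a_def)
  have subH: "\<mu> * y w \<le> a + (\<Sum>x\<in>neighbors H w. y x)" if "w \<in> vertices H" for w
    using sub [of w] sum_neighbors_rest [OF that, of y] that by (simp add: a_def vertices_H)
  have mx: "\<exists>B. (\<forall>w\<in>vertices H. y w \<le> B) \<and> (\<mu> - 2) * B \<le> a \<and> 0 \<le> B"
  proof (cases "vertices H = {}")
    case True then show ?thesis using a0 by (intro exI [of _ 0]) auto
  next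
    case False
    define B where "B = Max (y ` vertices H)"
    have le: "y w \<le> B" if "w \<in> vertices H" for w
      unfolding B_def using that vertices_H by auto
    have "B \<in> y ` vertices H"
      unfolding B_def by (rule Max_in) (use vertices_H False in auto)
    then obtain w where w: "w \<in> vertices H" "y w = B" by auto
    have "(\<Sum>x\<in>neighbors H w. y x) \<le> (\<Sum>x\<in>neighbors H w. B)"
      using le neighbors_rest(5) [OF w(1)] by (intro sum_mono) auto
    also have "\<dots> = d w * B" by (simp add: d_def)
    also have "\<dots> \<le> 2 * B" using deg [OF w(1)] y(1) [of w] w by (intro mult_right_mono) auto
    finally have "\<mu> * B \<le> a + 2 * B" using subH [OF w(1)] w by simp
    then have "(\<mu> - 2) * B \<le> a" by (simp add: algebra_simps)
    then show ?thesis using le y(1) [of w] w(2) by blast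
  qed
  then obtain B where B: "\<And>w. w \<in> vertices H \<Longrightarrow> y w \<le> B" "(\<mu> - 2) * B \<le> a" "B \<ge> 0" by blast
  define c where "c w = (\<Sum>x\<in>neighbors H w. d x)" for w
  define Dc where "Dc = (\<Sum>w\<in>vertices H. (d w)\<^sup>2)"
  define Dl where "Dl = (\<Sum>w\<in>vertices H. d w)"
  have d0: "d w \<ge> 0" for w by (simp add: d_def)
  have c0: "c w \<ge> 0" for w unfolding c_def by (intro sum_nonneg) (simp add: d0)
  have c_sum: "(\<Sum>w\<in>vertices H. c w) = Dc"
    unfolding c_def Dc_def sum_over_H_neighbors by (simp add: power2_eq_square)
  \<comment> \<open>Summation with weights \<open>g\<close>; the adjacency of \<open>H\<close> is moved from \<open>y\<close> to the weights by symmetry.\<close>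
  have step: "\<mu> * (\<Sum>w\<in>vertices H. g w * y w) \<le> (\<Sum>w\<in>vertices H. g w) * a + (\<Sum>w\<in>vertices H. (\<Sum>x\<in>neighbors H w. g x) * y w)"
    if g: "\<And>w. g w \<ge> (0::real)" for g
  proof -
    have "\<mu> * (\<Sum>w\<in>vertices H. g w * y w) = (\<Sum>w\<in>vertices H. g w * (\<mu> * y w))"
      by (simp add: sum_distrib_left ac_simps)
    also have "\<dots> \<le> (\<Sum>w\<in>vertices H. g w * (a + (\<Sum>x\<in>neighbors H w. y x)))"
      using subH g by (intro sum_mono mult_left_mono) auto
    also have "\<dots> = (\<Sum>w\<in>vertices H. g w) * a + (\<Sum>w\<in>vertices H. \<Sum>x\<in>neighbors H w. g w * y x)"
      by (simp add: algebra_simps sum.distrib sum_distrib_left sum_distrib_right)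
    also have "(\<Sum>w\<in>vertices H. \<Sum>x\<in>neighbors H w. g w * y x) = (\<Sum>w\<in>vertices H. \<Sum>x\<in>{x. x \<in> vertices H \<and> x \<in> neighbors H w}. g w * y x)"
      using neighbors_simple(1) [OF simple_H] by (intro sum.cong) auto
    also have "\<dots> = (\<Sum>x\<in>vertices H. \<Sum>w\<in>{w. w \<in> vertices H \<and> x \<in> neighbors H w}. g w * y x)"
      by (rule sum.swap_restrict) (use vertices_H in auto)
    also have "\<dots> = (\<Sum>x\<in>vertices H. \<Sum>w\<in>neighbors H x. g w * y x)"
    proof (intro sum.cong refl)
      fix x show "{w. w \<in> vertices H \<and> x \<in> neighbors H w} = neighbors H x"
        using neighbors_simple(1) [OF simple_H, of x] neighbors_sym [of _ H] by blast
    qed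
    finally show ?thesis by (simp add: sum_distrib_right)
  qed
  have mu0: "\<mu> > 0" using mu by simp
  have 1: "\<mu> * a \<le> a + 2 * Y"
  proof -
    have "\<mu> * y u \<le> y v + Y" "\<mu> * y v \<le> y u + Y"
      using sub [of u] sub [of v] hub_facts sum_neighbors_hub [of y] by (auto simp: Y_def)
    then show ?thesis by (simp add: a_def algebra_simps)
  qed
  have 2: "\<mu> * Y \<le> (real (card (vertices G)) - 2) * a + (\<Sum>w\<in>vertices H. d w * y w)"
    using step [of "\<lambda>_. 1"] card_vertices_H by (simp add: Y_def d_def)
  have 3: "\<mu> * (\<Sum>w\<in>vertices H. d w * y w) \<le> Dl * a + (\<Sum>w\<in>vertices H. c w * y w)"
    using step [of d] d0 by (simp add: Dl_def c_def)
  have 4: "\<mu> * (\<Sum>w\<in>vertices H. c w * y w) \<le> Dc * a + 2 * Dc * B"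
  proof -
    have "(\<Sum>x\<in>neighbors H w. c x) * y w \<le> (\<Sum>x\<in>neighbors H w. c x) * B" if "w \<in> vertices H" for w
      using B that c0 by (intro mult_left_mono sum_nonneg) auto
    then have "(\<Sum>w\<in>vertices H. (\<Sum>x\<in>neighbors H w. c x) * y w) \<le> (\<Sum>w\<in>vertices H. (\<Sum>x\<in>neighbors H w. c x) * B)"
      by (rule sum_mono)
    also have "\<dots> = (\<Sum>w\<in>vertices H. d w * c w) * B"
      unfolding sum_distrib_right [symmetric] sum_over_H_neighbors by simp
    also have "\<dots> \<le> (\<Sum>w\<in>vertices H. 2 * c w) * B"
      using deg c0 B by (intro mult_right_mono sum_mono) auto
    also have "\<dots> = 2 * Dc * B" using c_sum by (simp add: sum_distrib_left [symmetric])
    finally show ?thesis using step [of c] c0 c_sum by simp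
  qed
  have Dc0: "Dc \<ge> 0" unfolding Dc_def by (intro sum_nonneg) simp
  have Ba: "B \<le> a / (\<mu> - 2)" using B(2) mu by (simp add: field_simps)
  have "2 * Dc * B \<le> 2 * Dc * (a / (\<mu> - 2))"
    using Ba Dc0 by (intro mult_left_mono) auto
  then have 5: "\<mu> * (\<Sum>w\<in>vertices H. c w * y w) \<le> Dc * (1 + 2 / (\<mu> - 2)) * a"
    using 4 by (simp add: algebra_simps)
  define K where "K = Dc * (1 + 2 / (\<mu> - 2))"
  note 5 = 5 [folded K_def]
  let ?n = "real (card (vertices G)) - 2"
  have "a > 0"
  proof (rule ccontr)
    assume "\<not> a > 0"
    then have a: "a = 0" using a0 by simp
    then have "B = 0" using Ba B(3) mu by simp
    then have "y w = 0" if "w \<in> vertices H" for w using B(1) [OF that] y(1) [of w] by simp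
    moreover have "y u = 0" "y v = 0" using a y(1) [of u] y(1) [of v] unfolding a_def by linarith+
    ultimately show False using y(2) vertices_H(1) by force
  qed
  have "\<mu> ^ 2 * (\<mu> * (\<mu> * a)) \<le> \<mu> ^ 2 * (\<mu> * (a + 2 * Y))"
    using 1 mu0 by (intro mult_left_mono) auto
  moreover have "2 * (\<mu>\<^sup>2 * (\<mu> * Y)) \<le> 2 * (\<mu>\<^sup>2 * (?n * a + (\<Sum>w\<in>vertices H. d w * y w)))"
    using 2 mu0 by (intro mult_left_mono) auto
  moreover have "2 * (\<mu> * (\<mu> * (\<Sum>w\<in>vertices H. d w * y w))) \<le> 2 * (\<mu> * (Dl * a + (\<Sum>w\<in>vertices H. c w * y w)))"
    using 3 mu0 by (intro mult_left_mono) auto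
  ultimately have "\<mu> ^ 2 * (\<mu> * (\<mu> * a)) - \<mu> ^ 2 * (\<mu> * a) \<le> 2 * (?n * \<mu>\<^sup>2 * a + Dl * \<mu> * a + K * a)"
    using 5 by (simp add: algebra_simps power2_eq_square)
  then have "(\<mu> ^ 4 - \<mu> ^ 3) * a \<le> 2 * (?n * \<mu>\<^sup>2 + Dl * \<mu> + K) * a"
    by (simp add: algebra_simps eval_nat_numeral)
  then show ?thesis using \<open>a > 0\<close> unfolding Dl_def Dc_def K_def by simp
qed

end

section \<open>Linear forests\<close>

definition acyclic_graph :: "'a ugraph \<Rightarrow> bool" where
  "acyclic_graph G \<longleftrightarrow> (\<nexists>cs. distinct cs \<and> length cs \<ge> 3 \<and> walk_edges (cs @ [hd cs]) \<subseteq> edges G)"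

definition linear_forest :: "'a ugraph \<Rightarrow> bool" where
  "linear_forest G \<longleftrightarrow> simple_graph G \<and> acyclic_graph G \<and> (\<forall>v. card (neighbors G v) \<le> 2)"

lemma walk_edges_nth: "walk_edges xs = {{xs ! i, xs ! Suc i} | i. Suc i < length xs}"
proof (induction xs rule: walk_edges.induct)
  case (1 x y zs)
  have "{{(x # y # zs) ! i, (x # y # zs) ! Suc i} | i. Suc i < length (x # y # zs)} =
    insert {x, y} {{(y # zs) ! i, (y # zs) ! Suc i} | i. Suc i < length (y # zs)}" (is "?L = insert _ ?R")
  proof
    show "?L \<subseteq> insert {x, y} ?R"
    proof
      fix e assume "e \<in> ?L"
      then obtain i where "e = {(x # y # zs) ! i, (x # y # zs) ! Suc i}" "Suc i < length (x # y # zs)" by blast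
      then show "e \<in> insert {x, y} ?R" by (cases i) auto
    qed
    have "{(y # zs) ! i, (y # zs) ! Suc i} \<in> ?L" if "Suc i < length (y # zs)" for i
      using that by (intro CollectI exI [of _ "Suc i"]) simp
    moreover have "{x, y} \<in> ?L" by (intro CollectI exI [of _ 0]) simp
    ultimately show "insert {x, y} ?R \<subseteq> ?L" by blast
  qed
  then show ?case using 1 by simp
qed auto

lemma walk_edges_rev: "walk_edges (rev xs) = walk_edges xs"
proof -
  have sub: "walk_edges xs \<subseteq> walk_edges (rev xs)" for xs :: "'a list"
  proof
    fix e assume "e \<in> walk_edges xs"
    then obtain i where i: "e = {xs ! i, xs ! Suc i}" "Suc i < length xs"
      unfolding walk_edges_nth by blast
    define j where "j = length xs - Suc (Suc i)"
    have "rev xs ! j = xs ! Suc i" "rev xs ! Suc j = xs ! i" "Suc j < length (rev xs)"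
      using i(2) by (auto simp: j_def rev_nth Suc_diff_Suc)
    then show "e \<in> walk_edges (rev xs)"
      unfolding walk_edges_nth i(1) by (intro CollectI exI [of _ j]) (simp add: insert_commute)
  qed
  show ?thesis using sub [of xs] sub [of "rev xs"] by auto
qed

lemma walk_edges_snoc: "xs \<noteq> [] \<Longrightarrow> walk_edges (xs @ [y]) = insert {last xs, y} (walk_edges xs)"
  by (induction xs rule: walk_edges.induct) (auto simp: insert_commute)

text \<open>A further neighbour of the first vertex would either prolong the path or close a cycle.\<close>

lemma longest_path_end:
  assumes F: "linear_forest F"
    and xs: "distinct xs" "length xs \<ge> 2" "walk_edges xs \<subseteq> edges F"
    and longest: "\<And>ys. distinct ys \<Longrightarrow> walk_edges ys \<subseteq> edges F \<Longrightarrow> length ys \<le> length xs"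
  shows "neighbors F (xs ! 0) = {xs ! 1}"
proof
  have e01: "{xs ! 0, xs ! 1} \<in> edges F"
    using xs(2,3) unfolding walk_edges_nth by (metis (mono_tags, lifting) One_nat_def Suc_1 Suc_le_lessD mem_Collect_eq subsetD)
  then show "{xs ! 1} \<subseteq> neighbors F (xs ! 0)" by (simp add: neighbors_def)
  show "neighbors F (xs ! 0) \<subseteq> {xs ! 1}"
  proof
    fix y assume y: "y \<in> neighbors F (xs ! 0)"
    obtain x zs where xs': "xs = x # zs" "zs \<noteq> []" using xs(2) by (cases xs) force+
    have yx: "{y, x} \<in> edges F" using y xs' by (simp add: neighbors_def insert_commute)
    have "y \<in> set xs"
    proof (rule ccontr)
      assume "y \<notin> set xs"
      then have "distinct (y # xs)" "walk_edges (y # xs) \<subseteq> edges F"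
        using xs xs' yx by auto
      then show False using longest [of "y # xs"] by simp
    qed
    moreover have "y \<noteq> x" using yx F neighbors_simple(3) unfolding linear_forest_def neighbors_def by fastforce
    ultimately obtain i where i: "y = xs ! i" "i < length xs" "i > 0"
      using xs' by (metis in_set_conv_nth gr0I nth_Cons_0)
    have "i = 1"
    proof (rule ccontr)
      assume "i \<noteq> 1"
      define cs where "cs = take (Suc i) xs"
      have len: "length cs = Suc i" using i by (simp add: cs_def)
      have "length cs \<ge> 3" using \<open>i \<noteq> 1\<close> i len by simp
      moreover have "distinct cs" using xs(1) by (simp add: cs_def)
      moreover have "walk_edges (cs @ [hd cs]) \<subseteq> edges F"
      proof -
        have ne: "cs \<noteq> []" using len by auto
        have "last cs = y" using i by (simp add: cs_def take_Suc_conv_app_nth)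
        moreover have "hd cs = x" using xs' by (simp add: cs_def)
        moreover have "walk_edges cs \<subseteq> walk_edges xs"
          unfolding walk_edges_nth using len i by (auto simp: cs_def)
        ultimately show ?thesis using walk_edges_snoc [OF ne] yx xs(3) by auto
      qed
      ultimately show False using F unfolding linear_forest_def acyclic_graph_def by blast
    qed
    then show "y \<in> {xs ! 1}" using i by simp
  qed
qed

text \<open>A longest path. Its ends have no further neighbours, and an inner vertex already has two neighbours on the
path, which is the maximal degree; so no edge leaves the path.\<close>

lemma path_component:
  assumes F: "linear_forest F" and ne: "edges F \<noteq> {}"
  obtains xs where "distinct xs" "length xs \<ge> 2" "walk_edges xs \<subseteq> edges F"
    "\<And>e. e \<in> edges F \<Longrightarrow> e \<inter> set xs \<noteq> {} \<Longrightarrow> e \<in> walk_edges xs"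
    "neighbors F (xs ! 0) = {xs ! 1}" "neighbors F (last xs) = {xs ! (length xs - 2)}"
proof -
  have simple: "simple_graph F" using F unfolding linear_forest_def by simp
  have fin: "finite (vertices F)" using simple unfolding simple_graph_def by simp
  define P where "P ys \<longleftrightarrow> distinct ys \<and> length ys \<ge> 2 \<and> walk_edges ys \<subseteq> edges F" for ys
  have bound: "length ys \<le> card (vertices F)" if "P ys" for ys
  proof -
    have "set ys = \<Union> (walk_edges ys)" using that Union_walk_edges unfolding P_def by blast
    also have "\<dots> \<subseteq> vertices F" using that simple_graph_edge_subset [OF simple] unfolding P_def by blast
    finally show ?thesis using that fin distinct_card [of ys] card_mono unfolding P_def by metis
  qed
  obtain a b where ab: "{a, b} \<in> edges F" "a \<noteq> b"
    using ne simple_graph_edgeE [OF simple] by (metis ex_in_conv)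
  then have "P [a, b]" by (simp add: P_def)
  then obtain xs where xs: "P xs" "\<And>ys. P ys \<Longrightarrow> length ys \<le> length xs"
    using ex_has_greatest_nat [of P "[a, b]" length "Suc (card (vertices F))"] bound
    by (metis le_imp_less_Suc)
  have xs': "distinct xs" "length xs \<ge> 2" "walk_edges xs \<subseteq> edges F"
    using xs(1) unfolding P_def by auto
  have longest: "length ys \<le> length xs" if "distinct ys" "walk_edges ys \<subseteq> edges F" for ys
    using that xs xs' by (cases "length ys \<ge> 2") (auto simp: P_def)
  have first: "neighbors F (xs ! 0) = {xs ! 1}"
    by (rule longest_path_end [OF F xs' longest])
  have "neighbors F (rev xs ! 0) = {rev xs ! 1}"
    by (rule longest_path_end [OF F]) (use xs' longest in \<open>auto simp: walk_edges_rev\<close>)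
  moreover have "rev xs ! 0 = last xs" "rev xs ! 1 = xs ! (length xs - 2)"
  proof -
    have "xs \<noteq> []" using xs'(2) by auto
    then show "rev xs ! 0 = last xs" by (simp add: rev_nth last_conv_nth)
    show "rev xs ! 1 = xs ! (length xs - 2)" using xs'(2) by (simp add: rev_nth numeral_2_eq_2)
  qed
  ultimately have last: "neighbors F (last xs) = {xs ! (length xs - 2)}" by simp
  have closed: "e \<in> walk_edges xs" if e: "e \<in> edges F" "e \<inter> set xs \<noteq> {}" for e
  proof -
    obtain a b where "e = {a, b}" using simple_graph_edgeE [OF simple e(1)] by metis
    then obtain x y where xy: "e = {x, y}" "x \<in> set xs"
      using e(2) by (metis disjoint_iff insert_commute insertE singletonD)
    then obtain i where i: "x = xs ! i" "i < length xs" by (metis in_set_conv_nth)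
    have y: "y \<in> neighbors F x" using e(1) xy by (simp add: neighbors_def)
    have step: "{xs ! j, xs ! Suc j} \<in> walk_edges xs" if "Suc j < length xs" for j
      using that unfolding walk_edges_nth by blast
    consider "i = 0" | "i = length xs - 1" | "0 < i" "Suc i < length xs" using i by linarith
    then show ?thesis
    proof cases
      case 1
      then have "y = xs ! 1" using y first i by simp
      then show ?thesis using step [of 0] xs'(2) xy i 1 by simp
    next
      case 2
      then have "y = xs ! (length xs - 2)" using y last i xs'(2) last_conv_nth [of xs] by force
      moreover have "Suc (length xs - 2) = length xs - 1" using xs'(2) by simp
      ultimately show ?thesis using step [of "length xs - 2"] xs'(2) xy i 2 by (simp add: insert_commute)
    next
      case 3
      let ?N = "{xs ! (i - 1), xs ! Suc i}"
      have st: "{xs ! (i - 1), xs ! i} \<in> walk_edges xs" "{xs ! i, xs ! Suc i} \<in> walk_edges xs"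
        using step [of "i - 1"] step [of i] 3 by auto
      then have "?N \<subseteq> neighbors F x"
        using xs'(3) i by (auto simp: neighbors_def insert_commute)
      moreover have "card ?N = 2"
        using xs'(1) 3 by (auto simp: card_2_iff nth_eq_iff_index_eq doubleton_eq_iff)
      moreover have "card (neighbors F x) \<le> 2" using F unfolding linear_forest_def by simp
      ultimately have "neighbors F x = ?N"
        using neighbors_simple(2) [OF simple] by (metis card_seteq)
      then show ?thesis using y st xy i by (auto simp: insert_commute)
    qed
  qed
  show ?thesis by (rule that [OF xs' closed first last])
qed

lemma linear_forest_subgraph:
  assumes "linear_forest F" "E \<subseteq> edges F"
  shows "linear_forest (vertices F, E)"
proof -
  have "neighbors (vertices F, E) v \<subseteq> neighbors F v" for v
    using assms(2) unfolding neighbors_def by auto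
  then have "card (neighbors (vertices F, E) v) \<le> card (neighbors F v)" for v
    using assms(1) neighbors_simple(2) card_mono unfolding linear_forest_def by metis
  then have "card (neighbors (vertices F, E) v) \<le> 2" for v
    using assms(1) le_trans unfolding linear_forest_def by metis
  moreover have "simple_graph (vertices F, E)"
    using assms unfolding linear_forest_def simple_graph_def by auto
  moreover have "acyclic_graph (vertices F, E)"
    using assms unfolding linear_forest_def acyclic_graph_def snd_conv by (meson subset_trans)
  ultimately show ?thesis unfolding linear_forest_def by simp
qed

text \<open>Take an end \<open>x\<close> of a path and its neighbour \<open>y\<close>. The matching uses \<open>{x, y}\<close>, and the induction continues
without the at most two edges at \<open>y\<close>.\<close>

lemma linear_forest_matching:
  "linear_forest F \<Longrightarrow> \<exists>M. matching F M \<and> card (edges F) \<le> 2 * card M"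
proof (induction "card (edges F)" arbitrary: F rule: less_induct)
  case less
  have simple: "simple_graph F" using less.prems unfolding linear_forest_def by simp
  note fin = simple_graph_finite_edges [OF simple]
  show ?case
  proof (cases "edges F = {}")
    case True
    then show ?thesis by (intro exI [of _ "{}"]) (simp add: matching_def)
  next
    case False
    obtain xs where xs: "length xs \<ge> 2" "neighbors F (xs ! 0) = {xs ! 1}"
      using path_component [OF less.prems False] by metis
    define x y where "x = xs ! 0" and "y = xs ! 1"
    have xy: "{x, y} \<in> edges F" "neighbors F x = {y}" using xs by (auto simp: x_def y_def neighbors_def)
    define E where "E = {e \<in> edges F. y \<notin> e}"
    have sub: "edges F - E \<subseteq> (\<lambda>z. {y, z}) ` neighbors F y"
    proof
      fix e assume "e \<in> edges F - E"
      then have e: "e \<in> edges F" "y \<in> e" by (auto simp: E_def)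
      obtain a b where "e = {a, b}" using simple_graph_edgeE [OF simple e(1)] by metis
      then show "e \<in> (\<lambda>z. {y, z}) ` neighbors F y"
        using e by (auto simp: neighbors_def insert_commute)
    qed
    have "card (edges F - E) \<le> card ((\<lambda>z. {y, z}) ` neighbors F y)"
      by (rule card_mono [OF _ sub]) (simp add: neighbors_simple [OF simple])
    also have "\<dots> \<le> card (neighbors F y)" by (rule card_image_le) (simp add: neighbors_simple [OF simple])
    also have "\<dots> \<le> 2" using less.prems unfolding linear_forest_def by simp
    finally have two: "card (edges F) \<le> card E + 2"
      using card_Diff_subset [of E "edges F"] fin by (auto simp: E_def)
    have "E \<subset> edges F" using xy by (auto simp: E_def)
    then have less': "card E < card (edges F)" using fin by (rule psubset_card_mono [rotated])
    have "linear_forest (vertices F, E)"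
      by (rule linear_forest_subgraph [OF less.prems]) (auto simp: E_def)
    then obtain M where M: "matching (vertices F, E) M" "card E \<le> 2 * card M"
      using less.hyps [of "(vertices F, E)"] less' by auto
    have ME: "M \<subseteq> E" using M(1) by (simp add: matching_def)
    have dis: "e \<inter> {x, y} = {}" if "e \<in> M" for e
    proof -
      have e: "e \<in> edges F" "y \<notin> e" using ME that by (auto simp: E_def)
      obtain a b where ab: "e = {a, b}" using simple_graph_edgeE [OF simple e(1)] by metis
      have "x \<notin> e"
      proof
        assume "x \<in> e"
        then have "e = {x, a} \<or> e = {x, b}" using ab by auto
        then show False using e xy(2) by (auto simp: neighbors_def)
      qed
      then show ?thesis using e by auto
    qed
    have "matching F (insert {x, y} M)"
      using M(1) ME xy dis unfolding matching_def pairwise_insert disjnt_def E_def by auto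
    moreover have "{x, y} \<notin> M" using dis by blast
    then have "card (insert {x, y} M) = Suc (card M)"
      using finite_subset [OF ME] fin by (simp add: E_def)
    ultimately show ?thesis using two M(2) by (intro exI [of _ "insert {x, y} M"]) auto
  qed
qed

lemma sum_degrees:
  assumes "simple_graph F"
  shows "(\<Sum>v\<in>vertices F. card (neighbors F v)) = 2 * card (edges F)"
proof -
  have fin: "finite (vertices F)" using assms unfolding simple_graph_def by simp
  have "card (neighbors F v) = card {e \<in> edges F. v \<in> e}" for v
  proof -
    have "{e \<in> edges F. v \<in> e} = (\<lambda>w. {v, w}) ` neighbors F v"
    proof
      show "{e \<in> edges F. v \<in> e} \<subseteq> (\<lambda>w. {v, w}) ` neighbors F v"
      proof
        fix e assume e: "e \<in> {e \<in> edges F. v \<in> e}"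
        then obtain a b where "e = {a, b}" using simple_graph_edgeE [OF assms] by blast
        then show "e \<in> (\<lambda>w. {v, w}) ` neighbors F v"
          using e by (auto simp: neighbors_def insert_commute)
      qed
    qed (auto simp: neighbors_def)
    moreover have "inj_on (\<lambda>w. {v, w}) (neighbors F v)"
      by (auto simp: inj_on_def doubleton_eq_iff)
    ultimately show ?thesis by (simp add: card_image)
  qed
  then have "(\<Sum>v\<in>vertices F. card (neighbors F v)) = (\<Sum>v\<in>vertices F. \<Sum>e\<in>{e. e \<in> edges F \<and> v \<in> e}. 1)"
    by simp
  also have "\<dots> = (\<Sum>e\<in>edges F. \<Sum>v\<in>{v. v \<in> vertices F \<and> v \<in> e}. 1)"
    by (rule sum.swap_restrict [OF fin simple_graph_finite_edges [OF assms]])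
  also have "\<dots> = (\<Sum>e\<in>edges F. 2)"
  proof (intro sum.cong refl)
    fix e assume e: "e \<in> edges F"
    have "{v. v \<in> vertices F \<and> v \<in> e} = e" using simple_graph_edge_subset [OF assms e] by auto
    moreover have "card e = 2" using simple_graph_edgeE [OF assms e] by (metis card_2_iff)
    ultimately show "(\<Sum>v\<in>{v. v \<in> vertices F \<and> v \<in> e}. 1) = (2::nat)" by simp
  qed
  finally show ?thesis by simp
qed

text \<open>For \<open>d\<close> in \<open>{0, 1, 2}\<close>, the square of \<open>d\<close> is \<open>2 * d\<close>, reduced by 1 if \<open>d = 1\<close>.\<close>

lemma sum_squared_degrees:
  assumes simple: "simple_graph F" and deg: "\<And>v. card (neighbors F v) \<le> 2"
  shows "(\<Sum>v\<in>vertices F. (card (neighbors F v))\<^sup>2) + card {v \<in> vertices F. card (neighbors F v) = 1} = 4 * card (edges F)"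
proof -
  have fin: "finite (vertices F)" using simple unfolding simple_graph_def by simp
  have pt: "(card (neighbors F v))\<^sup>2 + (if card (neighbors F v) = 1 then 1 else 0) = 2 * card (neighbors F v)" for v
  proof -
    consider "card (neighbors F v) = 0" | "card (neighbors F v) = 1" | "card (neighbors F v) = 2"
      using deg [of v] by linarith
    then show ?thesis by cases simp_all
  qed
  have "card {v \<in> vertices F. card (neighbors F v) = 1} = (\<Sum>v\<in>vertices F. if card (neighbors F v) = 1 then 1 else 0)"
    using fin by (simp add: sum.If_cases Int_def)
  then have "(\<Sum>v\<in>vertices F. (card (neighbors F v))\<^sup>2) + card {v \<in> vertices F. card (neighbors F v) = 1}
     = (\<Sum>v\<in>vertices F. (card (neighbors F v))\<^sup>2 + (if card (neighbors F v) = 1 then 1 else 0))"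
    by (simp only: sum.distrib)
  also have "\<dots> = (\<Sum>v\<in>vertices F. 2 * card (neighbors F v))" by (simp only: pt)
  also have "\<dots> = 4 * card (edges F)" using sum_degrees [OF simple] by (simp add: sum_distrib_left [symmetric])
  finally show ?thesis .
qed

text \<open>Every component with an edge is a path and has two leaves.\<close>

lemma linear_forest_one_or_two_paths:
  assumes F: "linear_forest F" and ne: "edges F \<noteq> {}"
  shows "(\<exists>xs. distinct xs \<and> edges F = walk_edges xs \<and> length xs = Suc (card (edges F)) \<and> set xs \<subseteq> vertices F)
     \<or> card {v \<in> vertices F. card (neighbors F v) = 1} \<ge> 4"
proof -
  have simple: "simple_graph F" using F unfolding linear_forest_def by simp
  have fin: "finite (vertices F)" using simple unfolding simple_graph_def by simp
  obtain xs where xs: "distinct xs" "length xs \<ge> 2" "walk_edges xs \<subseteq> edges F"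
    "\<And>e. e \<in> edges F \<Longrightarrow> e \<inter> set xs \<noteq> {} \<Longrightarrow> e \<in> walk_edges xs"
    "neighbors F (xs ! 0) = {xs ! 1}" "neighbors F (last xs) = {xs ! (length xs - 2)}"
    using path_component [OF F ne] by metis
  have ends_xs: "xs ! 0 \<in> set xs" "last xs \<in> set xs" "xs ! 0 \<noteq> last xs"
  proof -
    have "xs \<noteq> []" "length xs > 1" using xs(2) by auto
    then show "xs ! 0 \<in> set xs" "last xs \<in> set xs" "xs ! 0 \<noteq> last xs"
      using xs(1) by (auto simp: last_conv_nth nth_eq_iff_index_eq)
  qed
  have sub: "set xs \<subseteq> vertices F"
    using Union_walk_edges [OF xs(2)] xs(3) simple_graph_edge_subset [OF simple] by blast
  show ?thesis
  proof (cases "edges F = walk_edges xs")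
    case True
    have "card (walk_edges xs) = length xs - 1"
    proof -
      have "walk_edges xs = (\<lambda>i. {xs ! i, xs ! Suc i}) ` {i. Suc i < length xs}"
        unfolding walk_edges_nth by auto
      moreover have "inj_on (\<lambda>i. {xs ! i, xs ! Suc i}) {i. Suc i < length xs}"
        using xs(1) by (auto simp: inj_on_def doubleton_eq_iff nth_eq_iff_index_eq)
      moreover have "{i. Suc i < length xs} = {..<length xs - 1}" by auto
      ultimately show ?thesis by (simp add: card_image)
    qed
    then show ?thesis using True xs(1,2) sub by (intro disjI1 exI [of _ xs]) auto
  next
    case False
    define F' where "F' = (vertices F, edges F - walk_edges xs)"
    have F': "linear_forest F'" unfolding F'_def by (rule linear_forest_subgraph [OF F]) auto
    obtain ys where ys: "distinct ys" "length ys \<ge> 2" "walk_edges ys \<subseteq> edges F'"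
       "neighbors F' (ys ! 0) = {ys ! 1}" "neighbors F' (last ys) = {ys ! (length ys - 2)}"
      using path_component [OF F'] False xs(3) unfolding F'_def by (metis Diff_eq_empty_iff snd_conv subset_antisym)
    have ends_ys: "ys ! 0 \<in> set ys" "last ys \<in> set ys" "ys ! 0 \<noteq> last ys"
    proof -
    have "ys \<noteq> []" "length ys > 1" using ys(2) by auto
    then show "ys ! 0 \<in> set ys" "last ys \<in> set ys" "ys ! 0 \<noteq> last ys"
      using ys(1) by (auto simp: last_conv_nth nth_eq_iff_index_eq)
  qed
    have ysF': "\<exists>e\<in>edges F'. y \<in> e" if "y \<in> set ys" for y
      using Union_walk_edges [OF ys(2)] ys(3) that by blast
    have disj: "set ys \<inter> set xs = {}"
    proof -
      have "y \<notin> set xs" if y: "y \<in> set ys" for y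
      proof
        assume yx: "y \<in> set xs"
        obtain e where e: "e \<in> edges F'" "y \<in> e" using ysF' [OF y] by blast
        then have "e \<in> walk_edges xs" using xs(4) [of e] yx by (auto simp: F'_def)
        then show False using e by (simp add: F'_def)
      qed
      then show ?thesis by blast
    qed
    have nb: "neighbors F y = neighbors F' y" if "y \<in> set ys" for y
    proof -
      have "{y, w} \<notin> walk_edges xs" for w
        using walk_edges_subset disj that by fastforce
      then show ?thesis unfolding neighbors_def F'_def by simp
    qed
    have subys: "set ys \<subseteq> vertices F"
    proof
      fix y assume "y \<in> set ys"
      then obtain e where "e \<in> edges F'" "y \<in> e" using ysF' by blast
      then show "y \<in> vertices F" using simple_graph_edge_subset [OF simple, of e] by (auto simp: F'_def)
    qed
    let ?S = "{xs ! 0, last xs, ys ! 0, last ys}"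
    have "card ?S = 4"
    proof -
      have "distinct [xs ! 0, last xs, ys ! 0, last ys]" using ends_xs ends_ys disj by auto
      then show ?thesis using distinct_card [of "[xs ! 0, last xs, ys ! 0, last ys]"] by simp
    qed
    moreover have "?S \<subseteq> {v \<in> vertices F. card (neighbors F v) = 1}"
      using ends_xs ends_ys sub subys nb xs(5,6) ys(4,5) by auto
    ultimately show ?thesis using card_mono [of "{v \<in> vertices F. card (neighbors F v) = 1}" ?S] fin by auto
  qed
qed

section \<open>Two dominating vertices\<close>

text \<open>The spectral radius is at least about \<open>sqrt (2 * n)\<close>, so an order that is large compared with \<open>s\<^sup>6\<close> makes it
large compared with \<open>s\<^sup>3\<close>.\<close>

lemma spectral_lower_bound_cubic:
  fixes s n \<mu> :: real
  assumes "s \<ge> 4" "n \<ge> 10 ^ 5 * s ^ 6" "\<mu> > 0" "\<mu>\<^sup>2 - \<mu> \<ge> 2 * (n - 2)"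
  shows "\<mu> \<ge> 400 * s ^ 3"
proof (rule ccontr)
  assume "\<not> \<mu> \<ge> 400 * s ^ 3"
  then have "\<mu>\<^sup>2 \<le> (400 * s ^ 3)\<^sup>2" using assms(3) by (intro power_mono) auto
  also have "\<dots> = 160000 * s ^ 6" by (simp add: power_mult_distrib power_mult [symmetric])
  finally have "2 * (n - 2) \<le> 160000 * s ^ 6" using assms(3,4) by linarith
  moreover have "s ^ 6 \<ge> 1" using assms(1) by (intro one_le_power) auto
  ultimately show False using assms(2) by (simp add: eval_nat_numeral(1)) 
qed

text \<open>The left-hand side is what the edges inside \<open>S\<close> and the vertices with three or more neighbours
contribute to the walks of length two.\<close>

lemma error_bound:
  fixes s \<mu> :: real
  assumes s: "s \<ge> 4" and mu: "\<mu> \<ge> 400 * s ^ 3"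
  shows "\<mu> * s + 2 * s ^ 4 \<le> \<mu>\<^sup>2 / (390 * s\<^sup>2)"
proof -
  have s3: "s ^ 3 > 0" using s by simp
  have mu0: "\<mu> \<ge> 0" using mu s3 by linarith
  have "400 * s ^ 3 * \<mu> \<le> \<mu> * \<mu>" using mu mu0 by (intro mult_right_mono) auto
  moreover have "s ^ 3 * (400 * s ^ 3) \<le> s ^ 3 * \<mu>" using mu s3 by (intro mult_left_mono) auto
  moreover have "s ^ 3 * (400 * s ^ 3) = 400 * s ^ 6" by (simp add: eval_nat_numeral)
  moreover have "s ^ 6 > 0" using s by simp
  ultimately have "390 * (s ^ 3 * \<mu>) + 780 * s ^ 6 \<le> \<mu>\<^sup>2"
    unfolding power2_eq_square by (simp only: mult.assoc)
  moreover have "(\<mu> * s + 2 * s ^ 4) * (390 * s\<^sup>2) = 390 * (s ^ 3 * \<mu>) + 780 * s ^ 6"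
    by (simp add: algebra_simps eval_nat_numeral)
  ultimately show ?thesis using s by (simp add: pos_le_divide_eq)
qed

text \<open>Here \<open>Z\<close> is the largest eigenvector entry on \<open>S - {u, v}\<close> and \<open>d\<close> the number of vertices that are not common
neighbours of \<open>u\<close> and \<open>v\<close>. Up to constant factors, \<open>Z\<close> is at most \<open>1 / \<mu> + d / \<mu>\<^sup>2\<close>; the second
conclusion bounds the total contribution of the edges that avoid \<open>u\<close> and \<open>v\<close>. What matters there is that
the constant term and the coefficient of \<open>d\<close> are far below 1.\<close>

lemma small_entries:
  fixes s \<mu> d Z :: real
  assumes s: "s \<ge> 4" and mu: "\<mu> \<ge> 400 * s ^ 3"
    and d: "0 \<le> d" "d \<le> 2 * \<mu>\<^sup>2 / (390 * s\<^sup>2)"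
    and Z: "Z \<ge> 0" "\<mu> * Z \<le> (2 + s * Z) * (1 + (2 + d) / \<mu>)"
  shows "s * Z \<le> 1 / 100" "s * Z * (s + 2 + d) + (2 + s * Z) / \<mu> * (s * (2 + d)) \<le> 5 / 1000 + d / 50"
proof -
  have s3: "s ^ 3 \<ge> 64" using power_mono [OF s, of 3] by simp
  have mu0: "\<mu> > 0" "\<mu> \<ge> 25600" using mu s3 by auto
  have B: "s\<^sup>2 / \<mu> \<le> 1 / 1600"
  proof -
    have "1600 * s\<^sup>2 \<le> 400 * s * s\<^sup>2" using s by (intro mult_right_mono) auto
    also have "\<dots> = 400 * s ^ 3" by (simp add: eval_nat_numeral)
    finally have "1600 * s\<^sup>2 \<le> \<mu>" using mu by linarith
    then show ?thesis using mu0 by (simp add: field_simps)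
  qed
  have A: "s / \<mu> \<le> 1 / 6400"
  proof -
    have "4 * (s / \<mu>) \<le> s * (s / \<mu>)" using s mu0 by (intro mult_right_mono) auto
    moreover have "s * (s / \<mu>) = s\<^sup>2 / \<mu>" by (simp add: power2_eq_square)
    ultimately show ?thesis using B by linarith
  qed
  have sd: "s * (d / \<mu>\<^sup>2) \<le> 1 / 780"
  proof -
    have "d / \<mu>\<^sup>2 \<le> 2 / (390 * s\<^sup>2)" using d(2) mu0 s by (simp add: field_simps)
    then have "s * (d / \<mu>\<^sup>2) \<le> s * (2 / (390 * s\<^sup>2))" using s by (intro mult_left_mono) auto
    also have "\<dots> = 1 / (195 * s)" using s by (simp add: power2_eq_square)
    also have "\<dots> \<le> 1 / 780" using s by (intro divide_left_mono) auto
    finally show ?thesis .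
  qed
  define P where "P = 2 + s * Z"
  have P2: "P \<ge> 2" using s Z by (simp add: P_def)
  have Z1: "Z \<le> P * (1 / \<mu> + 2 / \<mu>\<^sup>2 + d / \<mu>\<^sup>2)"
  proof -
    have "Z = (\<mu> * Z) / \<mu>" using mu0 by simp
    also have "\<dots> \<le> P * (1 + (2 + d) / \<mu>) / \<mu>"
      using Z(2) mu0 unfolding P_def by (intro divide_right_mono) auto
    also have "\<dots> = P * (1 / \<mu> + 2 / \<mu>\<^sup>2 + d / \<mu>\<^sup>2)" using mu0 by (simp add: field_simps power2_eq_square)
    finally show ?thesis .
  qed
  have inv: "1 / \<mu> \<le> 1 / 25600" using mu0 by (intro divide_left_mono) auto
  have small: "2 / \<mu>\<^sup>2 \<le> 1 / 100 * (1 / \<mu>)"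
  proof -
    have "2 / \<mu>\<^sup>2 = 2 * (1 / \<mu>) * (1 / \<mu>)" by (simp add: power2_eq_square)
    also have "\<dots> \<le> (1 / 100) * (1 / \<mu>)" using inv mu0 by (intro mult_right_mono) auto
    finally show ?thesis .
  qed
  have "s * Z \<le> s * (P * (1 / \<mu> + 2 / \<mu>\<^sup>2 + d / \<mu>\<^sup>2))" using Z1 s by (intro mult_left_mono) auto
  also have "\<dots> = P * (s / \<mu> + s * (2 / \<mu>\<^sup>2) + s * (d / \<mu>\<^sup>2))" by (simp add: algebra_simps)
  also have "\<dots> \<le> P * (2 / 1000)"
  proof (intro mult_left_mono)
    have "s * (2 / \<mu>\<^sup>2) \<le> s * (1 / 100 * (1 / \<mu>))" using small s by (intro mult_left_mono) auto
    then show "s / \<mu> + s * (2 / \<mu>\<^sup>2) + s * (d / \<mu>\<^sup>2) \<le> 2 / 1000" using A sd by simp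
  qed (use P2 in simp)
  finally have sZP: "s * Z \<le> P * (2 / 1000)" .
  then have P3: "P \<le> 201 / 100" unfolding P_def by (simp add: algebra_simps)
  then show sZ: "s * Z \<le> 1 / 100" unfolding P_def by linarith
  have "Z \<le> 201 / 100 * (1 / \<mu> + 2 / \<mu>\<^sup>2 + d / \<mu>\<^sup>2)"
    using Z1 P3 d mu0 by (meson add_nonneg_nonneg divide_nonneg_nonneg less_imp_le mult_right_mono order_trans zero_le_numeral zero_le_one zero_le_power2)
  moreover have "0 \<le> d / \<mu>\<^sup>2" "0 < 1 / \<mu>" using d mu0 by auto
  moreover have "Z \<le> 3 * p + 3 * r" if "Z \<le> 201 / 100 * (p + q + r)" "0 \<le> r" "0 < p" "q \<le> 1 / 100 * p" for p q r
    using that by argo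
  ultimately have Z2: "Z \<le> 3 * (1 / \<mu>) + 3 * (d / \<mu>\<^sup>2)" using small by blast
  have t1: "s * Z * d \<le> 1 / 100 * d" using sZ d by (intro mult_right_mono) auto
  have t2: "s * Z * (s + 2) \<le> 29 / 10000 + 1 / 1000 * d"
  proof -
    have "s * (s + 2) \<le> s * (3 / 2 * s)" using s by (intro mult_left_mono) auto
    then have "s * (s + 2) * Z \<le> 3 / 2 * s\<^sup>2 * Z" using Z by (intro mult_right_mono) (auto simp: power2_eq_square)
    also have "\<dots> \<le> 3 / 2 * s\<^sup>2 * (3 * (1 / \<mu>) + 3 * (d / \<mu>\<^sup>2))" using Z2 by (intro mult_left_mono) auto
    also have "\<dots> = 9 / 2 * (s\<^sup>2 / \<mu>) + 9 / 2 * (s\<^sup>2 / \<mu>) * (1 / \<mu>) * d" by (simp add: field_simps power2_eq_square)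
    also have "\<dots> \<le> 9 / 2 * (1 / 1600) + 9 / 2 * (1 / 1600) * (1 / 25600) * d"
      using B inv mu0 d s by (intro add_mono mult_mono mult_nonneg_nonneg) auto
    also have "\<dots> \<le> 29 / 10000 + 1 / 1000 * d" using d by simp
    finally show ?thesis by (simp add: algebra_simps)
  qed
  have t3: "(2 + s * Z) / \<mu> * (s * (2 + d)) \<le> 201 / 100 * (1 / 6400) * (2 + d)"
  proof -
    have "(2 + s * Z) / \<mu> * (s * (2 + d)) = P * (s / \<mu>) * (2 + d)" by (simp add: P_def)
    also have "\<dots> \<le> 201 / 100 * (1 / 6400) * (2 + d)"
      using P3 P2 A d mu0 s by (intro mult_right_mono mult_mono) auto
    finally show ?thesis .
  qed
  have "s * Z * (s + 2 + d) = s * Z * (s + 2) + s * Z * d" by (simp add: algebra_simps)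
  then have "s * Z * (s + 2 + d) + (2 + s * Z) / \<mu> * (s * (2 + d))
      \<le> 29 / 10000 + 1 / 1000 * d + 1 / 100 * d + 201 / 100 * (1 / 6400) * (2 + d)"
    using t1 t2 t3 by (simp only: add_mono)
  also have "\<dots> \<le> 5 / 1000 + d / 50" using d(1) by argo
  finally show "s * Z * (s + 2 + d) + (2 + s * Z) / \<mu> * (s * (2 + d)) \<le> 5 / 1000 + d / 50" .
qed

lemma planar_common_neighbors:
  assumes G: "simple_graph G" "planar G" and abc: "distinct [a, b, c]"
  shows "card (neighbors G a \<inter> neighbors G b \<inter> neighbors G c) \<le> 2"
proof (rule ccontr)
  let ?X = "neighbors G a \<inter> neighbors G b \<inter> neighbors G c"
  assume "\<not> card ?X \<le> 2"
  then obtain T where T: "T \<subseteq> ?X" "card T = 3" by (metis not_less_eq_eq numeral_2_eq_2 numeral_3_eq_3 obtain_subset_with_card_n)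
  then obtain x y z where xyz: "T = {x, y, z}" "x \<noteq> y" "x \<noteq> z" "y \<noteq> z" by (auto simp: card_3_iff)
  have "w \<noteq> a \<and> w \<noteq> b \<and> w \<noteq> c" if "w \<in> T" for w
    using that T(1) neighbors_simple(3) [OF G(1)] by blast
  then have "distinct [a, b, c, x, y, z]" using abc xyz by auto
  moreover have "{i, j} \<in> edges G" if "i \<in> {a, b, c}" "j \<in> {x, y, z}" for i j
    using that T(1) xyz(1) by (auto simp: neighbors_def)
  ultimately show False using planar_no_K33 [OF G, of a b c x y z] by metis
qed

text \<open>Each such vertex is a common neighbour of three elements of \<open>S\<close>, and three vertices have at most two common
neighbours.\<close>

lemma card_many_neighbors:
  assumes G: "simple_graph G" "planar G" and S: "finite S" "S \<subseteq> vertices G"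
  shows "card {i \<in> vertices G. card (neighbors G i \<inter> S) \<ge> 3} \<le> 2 * card S ^ 3"
proof -
  define F where "F = {T. T \<subseteq> S \<and> card T = 3}"
  define X where "X T = {i \<in> vertices G. T \<subseteq> neighbors G i}" for T
  have finF: "finite F" unfolding F_def using S by auto
  have X: "card (X T) \<le> 2" if T: "T \<in> F" for T
  proof -
    obtain a b c where abc: "T = {a, b, c}" "distinct [a, b, c]" using T unfolding F_def by (auto simp: card_3_iff)
    have "X T \<subseteq> neighbors G a \<inter> neighbors G b \<inter> neighbors G c"
      using abc neighbors_sym unfolding X_def by fastforce
    then have "card (X T) \<le> card (neighbors G a \<inter> neighbors G b \<inter> neighbors G c)"
      by (intro card_mono) (auto simp: neighbors_simple [OF G(1)])
    then show ?thesis using planar_common_neighbors [OF G abc(2)] by linarith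
  qed
  have "{i \<in> vertices G. card (neighbors G i \<inter> S) \<ge> 3} \<subseteq> (\<Union>T\<in>F. X T)"
  proof
    fix i assume "i \<in> {i \<in> vertices G. card (neighbors G i \<inter> S) \<ge> 3}"
    then have i: "i \<in> vertices G" "3 \<le> card (neighbors G i \<inter> S)" by auto
    obtain T where "T \<subseteq> neighbors G i \<inter> S" "card T = 3" using obtain_subset_with_card_n [OF i(2)] by metis
    then show "i \<in> (\<Union>T\<in>F. X T)" using i unfolding F_def X_def by auto
  qed
  moreover have "finite (\<Union>T\<in>F. X T)"
    using finF G(1) unfolding X_def simple_graph_def by auto
  ultimately have "card {i \<in> vertices G. card (neighbors G i \<inter> S) \<ge> 3} \<le> card (\<Union>T\<in>F. X T)"
    by (rule card_mono [rotated])
  also have "\<dots> \<le> (\<Sum>T\<in>F. card (X T))" by (rule card_UN_le [OF finF])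
  also have "\<dots> \<le> (\<Sum>T\<in>F. 2)" using X by (rule sum_mono)
  also have "\<dots> = 2 * (card S choose 3)" using n_subsets [OF S(1), of 3] by (simp add: F_def)
  also have "\<dots> \<le> 2 * card S ^ 3"
  proof (cases "card S \<ge> 3")
    case True then show ?thesis using binomial_le_pow by simp
  qed (simp add: binomial_eq_0)
  finally show ?thesis .
qed

lemma sum_le_card_mult:
  fixes f :: "'a \<Rightarrow> real"
  assumes "\<And>x. x \<in> A \<Longrightarrow> f x \<le> B" "real (card A) \<le> c" "0 \<le> B"
  shows "sum f A \<le> c * B"
proof -
  have "sum f A \<le> real (card A) * B" using sum_bounded_above [of A f B] assms(1) by simp
  also have "\<dots> \<le> c * B" using assms by (intro mult_right_mono) auto
  finally show ?thesis .
qed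

text \<open>A planar graph with a vertex cover \<open>S\<close> that is small compared with its order, and whose spectral radius is at least that of the join of \<open>K2\<close> with
isolated vertices.\<close>

locale near_extremal =
  fixes G :: "nat ugraph" and S :: "nat set" and s :: real
  assumes G: "simple_graph G" "planar G"
    and S: "S \<subseteq> vertices G" "\<And>e. e \<in> edges G \<Longrightarrow> e \<inter> S \<noteq> {}" "real (card S) \<le> s"
    and s: "s \<ge> 4"
    and large: "real (card (vertices G)) \<ge> 10 ^ 5 * s ^ 6"
    and rho: "graph_spectral_radius G > 0"
      "(graph_spectral_radius G)\<^sup>2 - graph_spectral_radius G \<ge> 2 * (real (card (vertices G)) - 2)"
begin

abbreviation "V \<equiv> vertices G"
abbreviation "N \<equiv> neighbors G"
definition "\<mu> = graph_spectral_radius G"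
definition "n = real (card V)"
text \<open>The relative error in the count of walks of length two from a vertex of \<open>S\<close>. The constant 390 is below the
constant 400 of the bound on \<open>\<mu>\<close> to make room for the lower-order term in \<open>error_bound\<close>.\<close>

definition "\<eta> = 1 / (390 * s\<^sup>2)"
definition "I = V - S"

lemma mu: "\<mu> \<ge> 400 * s ^ 3" "\<mu> \<ge> 25600" "\<mu> > 0" "\<mu>\<^sup>2 - \<mu> \<ge> 2 * (n - 2)" "\<mu>\<^sup>2 \<ge> 2 * n" "n > 0"
proof -
  show 1: "\<mu> \<ge> 400 * s ^ 3"
    unfolding \<mu>_def by (rule spectral_lower_bound_cubic [OF s large rho])
  have s3: "s ^ 3 \<ge> 64" using power_mono [OF s, of 3] by simp
  show 2: "\<mu> \<ge> 25600" using 1 s3 by linarith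
  show "\<mu> > 0" using 2 by linarith
  show 3: "\<mu>\<^sup>2 - \<mu> \<ge> 2 * (n - 2)" using rho(2) by (simp add: \<mu>_def n_def)
  have "2 * n = 2 * (n - 2) + 4" by simp
  also have "\<dots> \<le> \<mu>\<^sup>2 - \<mu> + 4" using 3 by (rule add_right_mono)
  also have "\<dots> \<le> \<mu>\<^sup>2" using 2 by simp
  finally show "\<mu>\<^sup>2 \<ge> 2 * n" .
  have "10 ^ 5 * s ^ 6 > 0" using s by simp
  then show "n > 0" using large unfolding n_def by linarith
qed

lemma eta: "\<eta> > 0" "\<eta> \<le> 1 / 6240" "\<mu> * s + 2 * s ^ 4 \<le> \<eta> * \<mu>\<^sup>2"
proof -
  have s2: "s\<^sup>2 \<ge> 16" using power_mono [OF s, of 2] by simp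
  show "\<eta> > 0" using s by (simp add: \<eta>_def)
  show "\<eta> \<le> 1 / 6240" using s2 unfolding \<eta>_def by (intro divide_left_mono) auto
  show "\<mu> * s + 2 * s ^ 4 \<le> \<eta> * \<mu>\<^sup>2" using error_bound [OF s mu(1)] by (simp add: \<eta>_def)
qed

lemma fin: "finite V" "finite S" "finite I" "finite (N x)"
  using G(1) S(1) finite_subset neighbors_simple(2) [OF G(1)] unfolding I_def simple_graph_def by auto

lemma V_split: "V = S \<union> I" "S \<inter> I = {}"
  using S(1) by (auto simp: I_def)

lemma N_V: "N x \<subseteq> V" "x \<notin> N x" using neighbors_simple [OF G(1)] by auto

lemma N_I: "i \<in> I \<Longrightarrow> N i \<subseteq> S"
  using S(2) unfolding I_def neighbors_def by fastforce

text \<open>The largest entry is attained on \<open>S\<close>: all neighbours of a vertex outside \<open>S\<close> lie in \<open>S\<close>, so its entry is at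
most \<open>s / \<mu>\<close>.\<close>

lemma extremal_vector:
  obtains y u where "\<And>w. y w \<ge> (0::real)" "\<And>w. w \<in> V \<Longrightarrow> y w \<le> 1" "u \<in> S" "y u = 1"
    "\<And>w. w \<in> V \<Longrightarrow> \<mu> * y w \<le> (\<Sum>x\<in>N w. y x)"
proof -
  have "V \<noteq> {}" using mu(6) by (auto simp: n_def)
  then obtain z where z: "\<And>w. z w \<ge> 0" "\<exists>w\<in>V. z w > 0"
    and sub: "\<And>w. w \<in> V \<Longrightarrow> \<mu> * z w \<le> (\<Sum>x\<in>N w. z x)"
    using spectral_radius_subsolution [OF G(1)] unfolding \<mu>_def by blast
  define m where "m = Max (z ` V)"
  have "m \<in> z ` V" unfolding m_def by (rule Max_in) (use fin \<open>V \<noteq> {}\<close> in auto)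
  then obtain u where u: "u \<in> V" "z u = m" by auto
  have le: "z w \<le> m" if "w \<in> V" for w unfolding m_def using that fin by auto
  have m: "m > 0" using z(2) le by fastforce
  define y where "y w = z w / m" for w
  have y: "y w \<ge> 0" "w \<in> V \<Longrightarrow> y w \<le> 1" for w
    using z(1) le m by (auto simp: y_def)
  have suby: "\<mu> * y w \<le> (\<Sum>x\<in>N w. y x)" if "w \<in> V" for w
    using sub [OF that] m by (simp add: y_def sum_divide_distrib [symmetric] divide_right_mono)
  have yu: "y u = 1" using u m by (simp add: y_def)
  have "u \<in> S"
  proof (rule ccontr)
    assume "u \<notin> S"
    then have uI: "u \<in> I" using u by (simp add: I_def)
    have "card (N u) \<le> card S" using N_I [OF uI] fin by (intro card_mono) auto
    then have c: "real (card (N u)) \<le> s" using S(3) by linarith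
    have "(\<Sum>x\<in>N u. y x) \<le> s * 1"
      by (rule sum_le_card_mult) (use y N_V c in auto)
    then have "\<mu> \<le> s" using suby [OF u(1)] yu by simp
    moreover have "s * 1 < s * (400 * s\<^sup>2)"
      using s power_mono [OF s, of 2] by (intro mult_strict_left_mono) auto
    moreover have "s * (400 * s\<^sup>2) = 400 * s ^ 3" by (simp add: eval_nat_numeral)
    ultimately show False using mu(1) by linarith
  qed
  then show ?thesis using that [of y u] y yu suby by blast
qed

text \<open>Let \<open>u\<close> carry the largest entry and \<open>v\<close> the largest entry among the other elements of \<open>S\<close>. A vertex outside
\<open>S\<close> with at most two neighbours contributes at most \<open>1 + y v\<close> to the walks of length two from \<open>u\<close>. Since
\<open>\<mu>\<^sup>2 \<ge> 2 * n\<close>, almost all vertices must contribute and \<open>y v\<close> must be almost 1; but then the same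
holds for \<open>v\<close>.\<close>

lemma common_hubs:
  assumes y: "\<And>w. y w \<ge> (0::real)" "\<And>w. w \<in> V \<Longrightarrow> y w \<le> 1" "u \<in> S" "y u = 1"
    and sub: "\<And>w. w \<in> V \<Longrightarrow> \<mu> * y w \<le> (\<Sum>x\<in>N w. y x)"
  obtains v where "v \<in> S" "v \<noteq> u" "y v \<ge> 1 - 2 * \<eta>" "real (card (V - (N u \<inter> N v))) \<le> 4 * \<eta> * n"
proof -
  define I3 where "I3 = {i \<in> I. card (N i) \<ge> 3}"
  define I2 where "I2 = I - I3"
  have finI: "finite I2" "finite I3" using fin by (auto simp: I2_def I3_def)
  have card_I3: "real (card I3) \<le> 2 * s ^ 3"
  proof -
    have "I3 \<subseteq> {i \<in> V. card (N i \<inter> S) \<ge> 3}"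
      using N_I unfolding I3_def I_def by (auto simp: Int_absorb2)
    then have "card I3 \<le> card {i \<in> V. card (N i \<inter> S) \<ge> 3}"
      using fin by (intro card_mono) auto
    also have "\<dots> \<le> 2 * card S ^ 3" by (rule card_many_neighbors [OF G fin(2) S(1)])
    finally have "real (card I3) \<le> 2 * real (card S) ^ 3"
      by (metis of_nat_le_iff of_nat_mult of_nat_numeral of_nat_power)
    also have "\<dots> \<le> 2 * s ^ 3" using S(3) by (intro mult_left_mono power_mono) auto
    finally show ?thesis .
  qed
  have yS: "(\<Sum>x\<in>A. y x) \<le> s" if "A \<subseteq> S" for A
  proof -
    have "card A \<le> card S" using that fin by (intro card_mono) auto
    then have c: "real (card A) \<le> s" using S(3) by linarith
    have "(\<Sum>x\<in>A. y x) \<le> s * 1"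
      by (rule sum_le_card_mult) (use y(2) that S(1) c in auto)
    then show ?thesis by simp
  qed
  define b where "b t = real (card (N t \<inter> I2))" for t
  \<comment> \<open>Walks of length two from \<open>t\<close>; those through \<open>S\<close> or \<open>I3\<close> are part of the error term.\<close>
  have A2: "\<mu>\<^sup>2 * y t \<le> \<eta> * \<mu>\<^sup>2 + (\<Sum>i\<in>N t \<inter> I2. \<Sum>x\<in>N i. y x)" if t: "t \<in> S" for t
  proof -
    have tV: "t \<in> V" using t S(1) by auto
    have spl: "N t = (N t \<inter> S) \<union> (N t \<inter> I)" using N_V(1) [of t] V_split by auto
    have "(\<Sum>x\<in>N t. y x) = (\<Sum>x\<in>N t \<inter> S. y x) + (\<Sum>i\<in>N t \<inter> I. y i)"
      by (subst spl, rule sum.union_disjoint) (use fin V_split in auto)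
    then have 1: "\<mu> * y t \<le> s + (\<Sum>i\<in>N t \<inter> I. y i)"
      using sub [OF tV] yS [of "N t \<inter> S"] by simp
    have "\<mu> * (\<Sum>i\<in>N t \<inter> I. y i) \<le> (\<Sum>i\<in>N t \<inter> I. \<Sum>x\<in>N i. y x)"
      unfolding sum_distrib_left by (intro sum_mono sub) (auto simp: I_def)
    also have "\<dots> = (\<Sum>i\<in>N t \<inter> I2. \<Sum>x\<in>N i. y x) + (\<Sum>i\<in>N t \<inter> I3. \<Sum>x\<in>N i. y x)"
    proof -
      have "N t \<inter> I = (N t \<inter> I2) \<union> (N t \<inter> I3)" by (auto simp: I2_def I3_def)
      then show ?thesis using fin by (simp only:) (rule sum.union_disjoint; auto simp: I2_def I3_def)
    qed
    also have "(\<Sum>i\<in>N t \<inter> I3. \<Sum>x\<in>N i. y x) \<le> 2 * s ^ 3 * s"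
    proof (rule sum_le_card_mult)
      have "card (N t \<inter> I3) \<le> card I3" using finI by (intro card_mono) auto
      then show "real (card (N t \<inter> I3)) \<le> 2 * s ^ 3" using card_I3 by linarith
      show "(\<Sum>x\<in>N i. y x) \<le> s" if "i \<in> N t \<inter> I3" for i
        by (rule yS) (use that N_I in \<open>auto simp: I3_def\<close>)
    qed (use s in simp)
    finally have 2: "\<mu> * (\<Sum>i\<in>N t \<inter> I. y i) \<le> (\<Sum>i\<in>N t \<inter> I2. \<Sum>x\<in>N i. y x) + 2 * s ^ 4"
      by (simp add: eval_nat_numeral)
    have "\<mu> * (\<mu> * y t) \<le> \<mu> * (s + (\<Sum>i\<in>N t \<inter> I. y i))"
      using 1 mu(3) by (intro mult_left_mono) auto
    then have "\<mu>\<^sup>2 * y t \<le> \<mu> * s + \<mu> * (\<Sum>i\<in>N t \<inter> I. y i)"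
      by (simp add: power2_eq_square algebra_simps)
    then show ?thesis using 2 eta(3) by linarith
  qed
  have cardN: "card (N i) \<le> 2" if "i \<in> I2" for i
    using that by (auto simp: I2_def I3_def)
  have b_n: "b t \<le> n" for t
  proof -
    have "card (N t \<inter> I2) \<le> card V" using fin by (intro card_mono) (auto simp: I2_def I_def)
    then show ?thesis by (simp add: b_def n_def)
  qed
  \<comment> \<open>A vertex of \<open>I2\<close> next to \<open>u\<close> has at most one other neighbour.\<close>
  have A3: "(1 - \<eta>) * \<mu>\<^sup>2 \<le> b u * (1 + Y)" if Y: "Y \<ge> 0" "\<And>x. x \<in> S - {u} \<Longrightarrow> y x \<le> Y" for Y
  proof -
    have "(\<Sum>x\<in>N i. y x) \<le> 1 + Y" if i: "i \<in> N u \<inter> I2" for i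
    proof -
      have ui: "u \<in> N i" using i neighbors_sym [of u G i] by auto
      then have "(\<Sum>x\<in>N i. y x) = 1 + (\<Sum>x\<in>N i - {u}. y x)"
        using fin y(4) by (simp add: sum.remove)
      also have "(\<Sum>x\<in>N i - {u}. y x) \<le> 1 * Y"
      proof (rule sum_le_card_mult)
        show "real (card (N i - {u})) \<le> 1" using cardN [of i] i ui fin by (simp add: card_Diff_singleton)
        have "N i \<subseteq> S" using N_I i by (auto simp: I2_def)
        then show "y x \<le> Y" if "x \<in> N i - {u}" for x using that Y(2) by auto
      qed (rule Y)
      finally show ?thesis by simp
    qed
    then have "(\<Sum>i\<in>N u \<inter> I2. \<Sum>x\<in>N i. y x) \<le> b u * (1 + Y)"
      by (rule sum_le_card_mult) (use Y in \<open>auto simp: b_def\<close>)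
    then show ?thesis using A2 [OF y(3)] y(4) by (simp add: algebra_simps)
  qed
  have n2: "(1 - \<eta>) * \<mu>\<^sup>2 \<ge> (1 - \<eta>) * (2 * n)"
    using mu(5) eta by (intro mult_left_mono) auto
  have "S - {u} \<noteq> {}"
  proof
    assume "S - {u} = {}"
    then have "(1 - \<eta>) * \<mu>\<^sup>2 \<le> b u" using A3 [of 0] by auto
    then have "(1 - \<eta>) * (2 * n) \<le> 1 * n" using n2 b_n [of u] by linarith
    then have "(1 - \<eta>) * 2 \<le> 1" using mu(6) by simp
    then show False using eta by simp
  qed
  define Y where "Y = Max (y ` (S - {u}))"
  have "Y \<in> y ` (S - {u})" unfolding Y_def by (rule Max_in) (use fin \<open>S - {u} \<noteq> {}\<close> in auto)
  then obtain v where v: "v \<in> S" "v \<noteq> u" "y v = Y" by auto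
  have Ymax: "y x \<le> Y" if "x \<in> S - {u}" for x unfolding Y_def using that fin by auto
  have Y01: "0 \<le> Y" "Y \<le> 1" using v y(1,2) S(1) by auto
  have bu: "(1 - \<eta>) * \<mu>\<^sup>2 \<le> b u * (1 + Y)" using A3 Y01 Ymax by blast
  have yv: "y v \<ge> 1 - 2 * \<eta>"
  proof -
    have "b u * (1 + Y) \<le> n * (1 + Y)" using b_n Y01 by (intro mult_right_mono) auto
    then have "n * (2 * (1 - \<eta>)) \<le> n * (1 + Y)" using bu n2 by (simp add: algebra_simps)
    then have "2 * (1 - \<eta>) \<le> 1 + Y" using mu(6) by (simp add: mult_le_cancel_left_pos)
    then show ?thesis using v(3) by simp
  qed
  have bu': "b u \<ge> (1 - \<eta>) * n"
  proof -
    have "b u * (1 + Y) \<le> b u * 2" using Y01 by (intro mult_left_mono) (auto simp: b_def)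
    then show ?thesis using bu n2 by (simp add: algebra_simps)
  qed
  have bv': "b v \<ge> (1 - 3 * \<eta>) * n"
  proof -
    have "(\<Sum>x\<in>N i. y x) \<le> 2" if i: "i \<in> N v \<inter> I2" for i
    proof -
      have "(\<Sum>x\<in>N i. y x) \<le> 2 * 1"
        by (rule sum_le_card_mult) (use i cardN [of i] y(2) N_V in auto)
      then show ?thesis by simp
    qed
    then have "(\<Sum>i\<in>N v \<inter> I2. \<Sum>x\<in>N i. y x) \<le> b v * 2"
      by (rule sum_le_card_mult) (auto simp: b_def)
    then have "\<mu>\<^sup>2 * y v \<le> \<eta> * \<mu>\<^sup>2 + b v * 2" using A2 [OF v(1)] by linarith
    moreover have "\<mu>\<^sup>2 * (1 - 2 * \<eta>) \<le> \<mu>\<^sup>2 * y v" using yv by (intro mult_left_mono) auto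
    ultimately have "(1 - 3 * \<eta>) * \<mu>\<^sup>2 \<le> b v * 2" by (simp add: algebra_simps)
    moreover have "(1 - 3 * \<eta>) * (2 * n) \<le> (1 - 3 * \<eta>) * \<mu>\<^sup>2"
      using mu(5) eta by (intro mult_left_mono) auto
    ultimately show ?thesis by (simp add: algebra_simps)
  qed
  have comp: "real (card (V - N t)) \<le> n - b t" for t
  proof -
    have "card (V - N t) \<le> card (V - (N t \<inter> I2))" using fin by (intro card_mono) auto
    also have "\<dots> = card V - card (N t \<inter> I2)"
      using fin by (intro card_Diff_subset) (auto simp: I2_def I_def)
    finally show ?thesis using b_n [of t] by (simp add: b_def n_def)
  qed
  have "V - (N u \<inter> N v) = (V - N u) \<union> (V - N v)" by auto
  then have "real (card (V - (N u \<inter> N v))) \<le> real (card (V - N u)) + real (card (V - N v))"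
    using card_Un_le [of "V - N u" "V - N v"] by simp
  also have "\<dots> \<le> 4 * \<eta> * n"
    using comp [of u] comp [of v] bu' bv' by (simp add: algebra_simps)
  finally show ?thesis using that [of v] v yv by blast
qed

text \<open>Compare \<open>\<mu> * \<mu>\<close> times \<open>a = y u + y v\<close> with the walks of length two from \<open>u\<close> and \<open>v\<close>. A common neighbour
of \<open>u\<close> and \<open>v\<close> (a vertex in \<open>C\<close>) contributes \<open>2 * a\<close>, any other vertex (in \<open>D\<close>) at most 1, which is about \<open>a / 2\<close>,
and all edges avoiding \<open>u\<close> and \<open>v\<close> together contribute at most \<open>1 / 100 + d / 25\<close>, where \<open>d\<close> is the size of
\<open>D\<close>. As \<open>\<mu>\<^sup>2 - \<mu> \<ge> 2 * (n - 2)\<close>, this leaves no room for a vertex in \<open>D\<close>, nor for \<open>u\<close> and \<open>v\<close> not being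
adjacent.\<close>

theorem hub_pair_exists: "\<exists>u v. hub_pair G u v"
proof -
  obtain y u where y: "\<And>w. y w \<ge> (0::real)" "\<And>w. w \<in> V \<Longrightarrow> y w \<le> 1" "u \<in> S" "y u = 1"
    and sub: "\<And>w. w \<in> V \<Longrightarrow> \<mu> * y w \<le> (\<Sum>x\<in>N w. y x)"
    using extremal_vector by blast
  obtain v where v: "v \<in> S" "v \<noteq> u" "y v \<ge> 1 - 2 * \<eta>" "real (card (V - (N u \<inter> N v))) \<le> 4 * \<eta> * n"
    using common_hubs [OF y sub] by blast
  define W where "W = V - {u, v}"
  define C where "C = N u \<inter> N v"
  define D where "D = W - C"
  define S' where "S' = S - {u, v}"
  define d where "d = real (card D)"
  define a where "a = 1 + y v"
  have CW: "C \<subseteq> W" using N_V [of u] N_V [of v] by (auto simp: C_def W_def)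
  have W_split: "W = C \<union> D" "C \<inter> D = {}" using CW by (auto simp: D_def)
  have W_split': "W = S' \<union> I" "S' \<inter> I = {}" using V_split y(3) v(1) by (auto simp: W_def S'_def)
  have uvV: "u \<in> V" "v \<in> V" using y(3) v(1) S(1) by auto
  have finW: "finite W" "finite C" "finite D" "finite S'"
    using fin by (auto simp: W_def C_def D_def S'_def)
  have cardW: "real (card C) + d = n - 2"
  proof -
    have "V = insert u (insert v W)" "u \<notin> insert v W" "v \<notin> W" using uvV v(2) by (auto simp: W_def)
    then have "card V = Suc (Suc (card W))" using finW by (metis card_insert_disjoint finite_insert)
    moreover have "card W = card C + card D" using W_split finW by (metis card_Un_disjoint)
    ultimately show ?thesis by (simp add: n_def d_def)
  qed
  have d: "0 \<le> d" "d \<le> 2 * \<mu>\<^sup>2 / (390 * s\<^sup>2)"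
  proof -
    show "0 \<le> d" by (simp add: d_def)
    have "card D \<le> card (V - (N u \<inter> N v))" using fin by (intro card_mono) (auto simp: D_def W_def C_def)
    then have "d \<le> 4 * \<eta> * n" using v(4) by (simp add: d_def)
    also have "\<dots> = 2 * \<eta> * (2 * n)" by simp
    also have "\<dots> \<le> 2 * \<eta> * \<mu>\<^sup>2" using mu(5) eta(1) by (intro mult_left_mono) auto
    finally show "d \<le> 2 * \<mu>\<^sup>2 / (390 * s\<^sup>2)" by (simp add: \<eta>_def)
  qed
  have a: "199 / 100 \<le> a" "a \<le> 2" using v(3) y(2) [OF uvV(2)] eta(2) by (auto simp: a_def)
  have cardS': "real (card S') \<le> s"
    using card_mono [of S S'] fin S(3) by (auto simp: S'_def)
  have NC: "card (N w \<inter> C) \<le> 2" if "w \<in> W" for w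
  proof -
    have "distinct [w, u, v]" using that v(2) by (auto simp: W_def)
    then show ?thesis using planar_common_neighbors [OF G, of w u v] by (simp add: C_def Int_assoc)
  qed
  have NI: "N i \<inter> W \<subseteq> S'" if "i \<in> I" for i using N_I [OF that] by (auto simp: W_def S'_def)
  have NtI: "real (card (N t \<inter> I)) \<le> 2 + d" if t: "t \<in> S'" for t
  proof -
    have "N t \<inter> I \<subseteq> (N t \<inter> C) \<union> D" using W_split W_split' by auto
    then have "card (N t \<inter> I) \<le> card ((N t \<inter> C) \<union> D)" using finW by (intro card_mono) auto
    also have "\<dots> \<le> card (N t \<inter> C) + card D" by (rule card_Un_le)
    finally show ?thesis using NC [of t] t W_split' by (auto simp: d_def)
  qed
  \<comment> \<open>The set \<open>S'\<close> may be empty, in which case \<open>Z\<close> is 0.\<close>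
  obtain Z where Z: "Z \<ge> 0" "\<And>t. t \<in> S' \<Longrightarrow> y t \<le> Z" "Z = 0 \<or> (\<exists>t\<in>S'. y t = Z)"
  proof (cases "S' = {}")
    case True
    then show ?thesis using that [of 0] by auto
  next
    case False
    have "Max (y ` S') \<in> y ` S'" by (rule Max_in) (use finW False in auto)
    then obtain t where "t \<in> S'" "y t = Max (y ` S')" by auto
    then show ?thesis using that [of "Max (y ` S')"] y(1) [of t] finW by auto
  qed
  have outside: "(\<Sum>x\<in>N w. y x) \<le> a + (\<Sum>x\<in>N w \<inter> W. y x)" if "w \<in> V" for w
  proof -
    have "(\<Sum>x\<in>N w. y x) \<le> (\<Sum>x\<in>{u, v} \<union> (N w \<inter> W). y x)"
      using N_V(1) [of w] y(1) finW by (intro sum_mono2) (auto simp: W_def)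
    also have "\<dots> = (\<Sum>x\<in>{u, v}. y x) + (\<Sum>x\<in>N w \<inter> W. y x)"
      using finW by (intro sum.union_disjoint) (auto simp: W_def)
    finally show ?thesis using v(2) y(4) by (simp add: a_def)
  qed
  have sumS': "(\<Sum>x\<in>A. y x) \<le> s * Z" if "A \<subseteq> S'" for A
  proof (rule sum_le_card_mult)
    show "real (card A) \<le> s" using card_mono [OF finW(4) that] cardS' by linarith
  qed (use Z that in auto)
  have yI: "y i \<le> (2 + s * Z) / \<mu>" if i: "i \<in> I" for i
  proof -
    have iV: "i \<in> V" using i by (simp add: I_def)
    have "\<mu> * y i \<le> 2 + s * Z"
      using sub [OF iV] outside [OF iV] sumS' [OF NI [OF i]] a by linarith
    then show ?thesis using mu(3) by (simp add: pos_le_divide_eq mult.commute)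
  qed
  have q0: "(2 + s * Z) / \<mu> \<ge> 0" using Z(1) s mu(3) by simp
  have Zmu: "\<mu> * Z \<le> (2 + s * Z) * (1 + (2 + d) / \<mu>)"
    using Z(3)
  proof
    assume "Z = 0" then show ?thesis using d mu(3) by simp
  next
    assume "\<exists>t\<in>S'. y t = Z"
    then obtain t where t: "t \<in> S'" "y t = Z" by blast
    have tV: "t \<in> V" using t W_split' by (auto simp: W_def)
    have "(\<Sum>x\<in>N t \<inter> W. y x) = (\<Sum>x\<in>N t \<inter> S'. y x) + (\<Sum>x\<in>N t \<inter> I. y x)"
      unfolding W_split' Int_Un_distrib using finW fin W_split' by (intro sum.union_disjoint) auto
    moreover have "(\<Sum>x\<in>N t \<inter> S'. y x) \<le> s * Z" by (rule sumS') auto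
    moreover have "(\<Sum>x\<in>N t \<inter> I. y x) \<le> (2 + d) * ((2 + s * Z) / \<mu>)"
      by (rule sum_le_card_mult) (use yI NtI [OF t(1)] q0 in auto)
    moreover have "\<mu> * Z \<le> (\<Sum>x\<in>N t. y x)" using sub [OF tV] t(2) by simp
    then have "\<mu> * Z \<le> 2 + (\<Sum>x\<in>N t \<inter> W. y x)" using outside [OF tV] a by linarith
    ultimately have "\<mu> * Z \<le> 2 + s * Z + (2 + d) * ((2 + s * Z) / \<mu>)" by (simp only:)
    also have "\<dots> = (2 + s * Z) * (1 + (2 + d) / \<mu>)" by (simp add: field_simps)
    finally show ?thesis .
  qed
  note small = small_entries [OF s mu(1) d Z(1) Zmu]
  define h where "h w = (\<Sum>x\<in>N w \<inter> W. y x)" for w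
  have h0: "h w \<ge> 0" for w unfolding h_def using y(1) by (intro sum_nonneg) auto
  have sum_W: "sum f W = sum f S' + sum f I" for f :: "nat \<Rightarrow> real"
    unfolding W_split'(1) using finW fin W_split'(2) by (intro sum.union_disjoint) auto
  \<comment> \<open>The edges of \<open>W\<close> are incident with \<open>S'\<close>, where the entries are at most \<open>Z\<close> and the degrees are bounded.\<close>
  have T: "(\<Sum>w\<in>W. h w) \<le> 5 / 1000 + d / 50"
  proof -
    have "(\<Sum>w\<in>W. h w) = (\<Sum>x\<in>W. real (card (N x \<inter> W)) * y x)"
      unfolding h_def by (rule edge_double_count [OF finW(1) finW(1)])
    also have "\<dots> = (\<Sum>x\<in>S'. real (card (N x \<inter> W)) * y x) + (\<Sum>x\<in>I. real (card (N x \<inter> W)) * y x)"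
      by (rule sum_W)
    also have "(\<Sum>x\<in>S'. real (card (N x \<inter> W)) * y x) \<le> s * ((s + 2 + d) * Z)"
    proof (rule sum_le_card_mult)
      fix t assume t: "t \<in> S'"
      have "N t \<inter> W = (N t \<inter> S') \<union> (N t \<inter> I)" unfolding W_split' by auto
      then have "card (N t \<inter> W) \<le> card (N t \<inter> S') + card (N t \<inter> I)" by (metis card_Un_le)
      moreover have "card (N t \<inter> S') \<le> card S'" using finW by (intro card_mono) auto
      ultimately have "real (card (N t \<inter> W)) \<le> s + 2 + d"
        using NtI [OF t] cardS' by linarith
      then show "real (card (N t \<inter> W)) * y t \<le> (s + 2 + d) * Z"
        using Z(2) [OF t] y(1) s d by (intro mult_mono) auto
    qed (use cardS' s d Z in auto)
    also have "(\<Sum>x\<in>I. real (card (N x \<inter> W)) * y x) \<le> (2 + s * Z) / \<mu> * (s * (2 + d))"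
    proof -
      have "(\<Sum>x\<in>I. real (card (N x \<inter> W)) * y x) \<le> (\<Sum>x\<in>I. real (card (N x \<inter> W)) * ((2 + s * Z) / \<mu>))"
        using yI by (intro sum_mono mult_left_mono) auto
      also have "\<dots> = (2 + s * Z) / \<mu> * (\<Sum>x\<in>I. real (card (N x \<inter> W)))"
        by (simp only: sum_distrib_right [symmetric] mult.commute)
      also have "(\<Sum>x\<in>I. real (card (N x \<inter> W))) = (\<Sum>x\<in>I. real (card (N x \<inter> S')))"
      proof (intro sum.cong refl)
        fix x assume "x \<in> I"
        then have "N x \<inter> W = N x \<inter> S'" using NI [of x] W_split' by auto
        then show "real (card (N x \<inter> W)) = real (card (N x \<inter> S'))" by simp
      qed
      also have "\<dots> = (\<Sum>t\<in>S'. real (card (N t \<inter> I)))"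
        using edge_double_count [OF finW(4) fin(3), of "\<lambda>_. 1" G] by simp
      also have "(2 + s * Z) / \<mu> * \<dots> \<le> (2 + s * Z) / \<mu> * (s * (2 + d))"
        by (rule mult_left_mono [OF sum_le_card_mult q0]) (use NtI cardS' d in auto)
      finally show ?thesis .
    qed
    finally show ?thesis using small(2) by (simp add: mult_ac)
  qed
  \<comment> \<open>The contribution of the edge \<open>{u, v}\<close>, if it is present.\<close>
  define \<epsilon> where "\<epsilon> = (if {u, v} \<in> edges G then 1 else 0 :: real)"
  have hubsum: "\<mu> * a \<le> \<epsilon> * a + 2 * (\<Sum>w\<in>C. y w) + (\<Sum>w\<in>D. y w)"
  proof -
    have one: "(\<Sum>x\<in>N p. y x) \<le> \<epsilon> * y p' + (\<Sum>w\<in>C. y w) + (\<Sum>w\<in>N p \<inter> D. y w)"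
      if p: "p = u \<and> p' = v \<or> p = v \<and> p' = u" for p p'
    proof -
      have e: "p' \<in> N p \<longleftrightarrow> {u, v} \<in> edges G" using p by (auto simp: neighbors_def insert_commute)
      have Np: "N p = (N p \<inter> {p'}) \<union> (C \<union> (N p \<inter> D))"
        using N_V [of p] p CW by (auto simp: D_def W_def C_def)
      have "(\<Sum>x\<in>N p. y x) = (\<Sum>x\<in>N p \<inter> {p'}. y x) + (\<Sum>x\<in>C \<union> (N p \<inter> D). y x)"
        by (subst Np, rule sum.union_disjoint) (use finW fin CW p in \<open>auto simp: D_def W_def\<close>)
      also have "(\<Sum>x\<in>C \<union> (N p \<inter> D). y x) = (\<Sum>w\<in>C. y w) + (\<Sum>w\<in>N p \<inter> D. y w)"
        by (rule sum.union_disjoint) (use finW W_split in auto)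
      also have "(\<Sum>x\<in>N p \<inter> {p'}. y x) = \<epsilon> * y p'"
        using e by (auto simp: \<epsilon>_def)
      finally show ?thesis by simp
    qed
    have "(\<Sum>w\<in>N u \<inter> D. y w) + (\<Sum>w\<in>N v \<inter> D. y w) = (\<Sum>w\<in>(N u \<inter> D) \<union> (N v \<inter> D). y w)"
      using finW by (intro sum.union_disjoint [symmetric]) (auto simp: D_def C_def)
    also have "\<dots> \<le> (\<Sum>w\<in>D. y w)" using finW y(1) by (intro sum_mono2) auto
    finally have "(\<Sum>w\<in>N u \<inter> D. y w) + (\<Sum>w\<in>N v \<inter> D. y w) \<le> (\<Sum>w\<in>D. y w)" .
    moreover have "\<mu> * a = \<mu> * y u + \<mu> * y v" "\<epsilon> * a = \<epsilon> * y u + \<epsilon> * y v"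
      using y(4) by (simp_all add: a_def algebra_simps)
    ultimately show ?thesis
      using sub [OF uvV(1)] sub [OF uvV(2)] one [of u v] one [of v u] by simp
  qed
  have sumC: "\<mu> * (\<Sum>w\<in>C. y w) \<le> real (card C) * a + (\<Sum>w\<in>C. h w)"
  proof -
    have "\<mu> * (\<Sum>w\<in>C. y w) = (\<Sum>w\<in>C. \<mu> * y w)" by (rule sum_distrib_left)
    also have "\<dots> \<le> (\<Sum>w\<in>C. a + h w)"
    proof (rule sum_mono)
      fix w assume "w \<in> C"
      then have "w \<in> V" using N_V by (auto simp: C_def)
      then show "\<mu> * y w \<le> a + h w" using sub outside unfolding h_def by force
    qed
    finally show ?thesis by (simp add: sum.distrib)
  qed
  have sumD: "\<mu> * (\<Sum>w\<in>D. y w) \<le> d + (\<Sum>w\<in>D. h w)"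
  proof -
    have "\<mu> * (\<Sum>w\<in>D. y w) = (\<Sum>w\<in>D. \<mu> * y w)" by (rule sum_distrib_left)
    also have "\<dots> \<le> (\<Sum>w\<in>D. 1 + h w)"
    proof (rule sum_mono)
      fix w assume w: "w \<in> D"
      then have wV: "w \<in> V" by (auto simp: D_def W_def)
      have "\<exists>p\<in>{u, v}. N w \<subseteq> {p} \<union> (N w \<inter> W)"
      proof -
        have "u \<notin> N w \<or> v \<notin> N w"
          using w neighbors_sym [of _ G w] by (auto simp: D_def C_def)
        then show ?thesis using N_V(1) [of w] by (auto simp: W_def)
      qed
      then obtain p where p: "p \<in> {u, v}" "N w \<subseteq> {p} \<union> (N w \<inter> W)" by blast
      have "(\<Sum>x\<in>N w. y x) \<le> (\<Sum>x\<in>{p} \<union> (N w \<inter> W). y x)"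
        using p(2) y(1) finW by (intro sum_mono2) auto
      also have "\<dots> = y p + h w"
        unfolding h_def using finW p(1) by (subst sum.union_disjoint) (auto simp: W_def)
      also have "y p \<le> 1" using y(2) p(1) uvV by auto
      finally show "\<mu> * y w \<le> 1 + h w" using sub [OF wV] by simp
    qed
    finally show ?thesis by (simp add: sum.distrib d_def)
  qed
  have hCD: "2 * (\<Sum>w\<in>C. h w) + (\<Sum>w\<in>D. h w) \<le> 2 * (\<Sum>w\<in>W. h w)"
  proof -
    have "(\<Sum>w\<in>W. h w) = (\<Sum>w\<in>C. h w) + (\<Sum>w\<in>D. h w)"
      unfolding W_split(1) using finW W_split(2) by (intro sum.union_disjoint) auto
    moreover have "(\<Sum>w\<in>D. h w) \<ge> 0" using h0 by (intro sum_nonneg) auto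
    ultimately show ?thesis by simp
  qed
  have "\<mu> * (\<mu> * a) \<le> \<mu> * (\<epsilon> * a + 2 * (\<Sum>w\<in>C. y w) + (\<Sum>w\<in>D. y w))"
    using hubsum mu(3) by (intro mult_left_mono) auto
  also have "\<dots> = \<epsilon> * (\<mu> * a) + 2 * (\<mu> * (\<Sum>w\<in>C. y w)) + \<mu> * (\<Sum>w\<in>D. y w)"
    by (simp add: algebra_simps)
  also have "\<dots> \<le> \<epsilon> * (\<mu> * a) + 2 * (real (card C) * a) + d + 2 * (5 / 1000 + d / 50)"
  proof -
    have "A + 2 * P + Q \<le> A + 2 * c + d + 2 * t" if "P \<le> c + x" "Q \<le> d + w" "2 * x + w \<le> 2 * z" "z \<le> t"
      for A P Q c x w z t :: real
      using that by argo
    from this [OF sumC sumD hCD T] show ?thesis .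
  qed
  finally have key: "\<mu> * (\<mu> * a) \<le> \<epsilon> * (\<mu> * a) + 2 * (real (card C) * a) + d + 2 * (5 / 1000 + d / 50)" .
  have "(2 * (n - 2)) * a \<le> (\<mu>\<^sup>2 - \<mu>) * a" using mu(4) a by (intro mult_right_mono) auto
  then have "\<mu> * a + 2 * ((real (card C) + d) * a) \<le> \<mu> * (\<mu> * a)"
    unfolding cardW by (simp add: algebra_simps power2_eq_square)
  then have fin_ineq: "(1 - \<epsilon>) * (\<mu> * a) + 2 * (d * a) \<le> d + 2 * (5 / 1000 + d / 50)"
    using key by (simp add: algebra_simps)
  have da: "d * (199 / 100) \<le> d * a" using a d by (intro mult_left_mono) auto
  have mua: "1 * 1 \<le> \<mu> * a" using mu(2) a by (intro mult_mono) auto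
  have uv: "{u, v} \<in> edges G"
  proof (rule ccontr)
    assume "{u, v} \<notin> edges G"
    then have "\<epsilon> = 0" by (simp add: \<epsilon>_def)
    then show False using fin_ineq da mua d(1) by simp
  qed
  then have "\<epsilon> = 1" by (simp add: \<epsilon>_def)
  then have "d < 1" using fin_ineq da d(1) by simp
  then have "D = {}" using finW by (simp add: d_def)
  then have "W = C" using W_split by simp
  have "hub_pair G u v"
  proof
    show "simple_graph G" by (rule G)
    show "{u, v} \<in> edges G" by (rule uv)
    fix w assume "w \<in> V - {u, v}"
    then have "w \<in> W" by (simp add: W_def)
    then have "w \<in> C" unfolding \<open>W = C\<close> .
    then show "{u, w} \<in> edges G \<and> {v, w} \<in> edges G" by (simp add: C_def neighbors_def)
  qed
  then show ?thesis by blast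
qed

end

section \<open>Comparison of joins\<close>

lemma list_bij_betw:
  assumes "distinct zs" "set zs = V" "length zs = n"
  shows "bij_betw (\<lambda>i. zs ! i) {..<n} V"
  using bij_betw_nth [OF assms(1), of "{..<n}" V] assms(2,3) by auto

lemma isomorphic_star_graph:
  assumes G: "simple_graph G" and x: "x \<in> vertices G" "edges G = {{x, w} | w. w \<in> vertices G - {x}}"
    and n: "card (vertices G) = n"
  shows "isomorphic (star_graph n) G"
proof -
  have "finite (vertices G - {x})" using G unfolding simple_graph_def by simp
  then obtain ws where ws: "set ws = vertices G - {x}" "distinct ws" using finite_distinct_list by metis
  define zs where "zs = x # ws"
  have zs: "distinct zs" "set zs = vertices G" using ws x(1) by (auto simp: zs_def)
  then have len: "length zs = n" using distinct_card [of zs] n by simp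
  have bij: "bij_betw (\<lambda>i. zs ! i) {..<n} (vertices G)" by (rule list_bij_betw [OF zs len])
  have z0: "zs ! 0 = x" by (simp add: zs_def)
  have img: "(\<lambda>i. zs ! i) ` {1..<n} = vertices G - {x}"
  proof -
    have "{1..<n} = {..<n} - {0}" by auto
    moreover have "0 < n" using len by (simp add: zs_def)
    ultimately show ?thesis
      using bij z0 unfolding bij_betw_def by (simp add: inj_on_image_set_diff [of _ "{..<n}"])
  qed
  have "edges (star_graph n) = (\<lambda>j. {0, j}) ` {1..<n}" unfolding star_graph_def by auto
  then have "(\<lambda>e. (\<lambda>i. zs ! i) ` e) ` edges (star_graph n) = (\<lambda>j. {x, zs ! j}) ` {1..<n}"
    by (simp add: image_image z0)
  also have "\<dots> = (\<lambda>w. {x, w}) ` (vertices G - {x})" unfolding img [symmetric] image_image ..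
  also have "\<dots> = edges G" using x(2) by auto
  finally show ?thesis using bij unfolding isomorphic_def by (auto simp: star_graph_def)
qed

lemma isomorphic_model_graph:
  assumes hub: "hub_pair G u v" and xs: "distinct xs" "length xs = 2 * q + 1" "set xs \<subseteq> vertices G - {u, v}"
    and E: "edges (remove_vertices G {u, v}) = walk_edges xs" and n: "card (vertices G) = n"
  shows "isomorphic (model_graph n q) G"
proof -
  interpret hub_pair G u v by (rule hub)
  have "finite (vertices G - {u, v} - set xs)" using hub_facts by simp
  then obtain ws where ws: "set ws = vertices G - {u, v} - set xs" "distinct ws" using finite_distinct_list by metis
  define zs where "zs = u # v # xs @ ws"
  have zs: "distinct zs" "set zs = vertices G" using ws xs hub_facts by (auto simp: zs_def)
  then have len: "length zs = n" using distinct_card [of zs] n by simp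
  have bij: "bij_betw (\<lambda>i. zs ! i) {..<n} (vertices G)" by (rule list_bij_betw [OF zs len])
  have z: "zs ! 0 = u" "zs ! 1 = v" by (simp_all add: zs_def)
  have n2: "2 \<le> n" using len by (simp add: zs_def)
  have img: "(\<lambda>i. zs ! i) ` {2..<n} = vertices G - {u, v}"
  proof -
    have "{2..<n} = {..<n} - {0, 1}" by auto
    moreover have "(\<lambda>i. zs ! i) ` ({..<n} - {0, 1}) = (\<lambda>i. zs ! i) ` {..<n} - (\<lambda>i. zs ! i) ` {0, 1}"
      by (rule inj_on_image_set_diff [of _ "{..<n}"]) (use bij n2 in \<open>auto simp: bij_betw_def\<close>)
    ultimately show ?thesis using bij z unfolding bij_betw_def by (simp only: image_insert image_empty)
  qed
  have path: "(\<lambda>j. {zs ! j, zs ! Suc j}) ` {2..<2 * q + 2} = walk_edges xs"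
  proof -
    have "{2..<2 * q + 2} = (\<lambda>i. i + 2) ` {i. Suc i < length xs}"
      using xs(2) image_add_atLeastLessThan' [of 2 0 "2 * q"] by (simp add: lessThan_def lessThan_atLeast0 [symmetric] numeral_2_eq_2)
    then have "(\<lambda>j. {zs ! j, zs ! Suc j}) ` {2..<2 * q + 2} = (\<lambda>i. {zs ! (i + 2), zs ! Suc (i + 2)}) ` {i. Suc i < length xs}"
      by (simp add: image_image)
    also have "\<dots> = (\<lambda>i. {xs ! i, xs ! Suc i}) ` {i. Suc i < length xs}"
      by (intro image_cong) (auto simp: zs_def nth_append)
    also have "\<dots> = walk_edges xs" unfolding walk_edges_nth by auto
    finally show ?thesis .
  qed
  have "edges (model_graph n q) = {{0, 1}} \<union> (\<lambda>j. {0, j}) ` {2..<n} \<union> (\<lambda>j. {1, j}) ` {2..<n} \<union>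
       (\<lambda>j. {j, Suc j}) ` {2..<2 * q + 2}"
    unfolding model_graph_def snd_conv by (intro arg_cong2 [where f = "(\<union>)"]) auto
  then have "(\<lambda>e. (\<lambda>i. zs ! i) ` e) ` edges (model_graph n q) =
      {{u, v}} \<union> (\<lambda>j. {u, zs ! j}) ` {2..<n} \<union> (\<lambda>j. {v, zs ! j}) ` {2..<n} \<union> walk_edges xs"
    by (simp only: image_Un image_image image_insert image_empty z path)
  also have "(\<lambda>j. {u, zs ! j}) ` {2..<n} = (\<lambda>w. {u, w}) ` (vertices G - {u, v})"
    unfolding img [symmetric] image_image ..
  also have "(\<lambda>j. {v, zs ! j}) ` {2..<n} = (\<lambda>w. {v, w}) ` (vertices G - {u, v})"
    unfolding img [symmetric] image_image ..
  also have "{{u, v}} \<union> (\<lambda>w. {u, w}) ` (vertices G - {u, v}) \<union> (\<lambda>w. {v, w}) ` (vertices G - {u, v}) \<union> walk_edges xs = edges G"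
    (is "?L = _")
  proof
    show "?L \<subseteq> edges G"
      using uv hubs E unfolding remove_vertices_def by auto
    show "edges G \<subseteq> ?L"
    proof
      fix e assume e: "e \<in> edges G"
      show "e \<in> ?L"
      proof (cases "e \<inter> {u, v} = {}")
        case True
        then have "e \<in> walk_edges xs" using e unfolding E [symmetric] remove_vertices_def by simp
        then show ?thesis by blast
      next
        case False
        obtain a b where ab: "e = {a, b}" "a \<in> vertices G" "b \<in> vertices G" "a \<noteq> b"
          using simple_graph_edgeE [OF simple e] .
        then show ?thesis using False by (auto simp: insert_commute)
      qed
    qed
  qed
  finally show ?thesis using bij unfolding isomorphic_def by (auto simp: model_graph_def)
qed

lemma hub_pair_model_graph:
  assumes n: "2 * q + 3 \<le> n"
  shows "hub_pair (model_graph n q) 0 (Suc 0)"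
proof
  show "simple_graph (model_graph n q)" by (rule simple_model_graph [OF n])
qed (auto simp: model_graph_def)

text \<open>Leaves decrease the sum of the squared degrees, so a lower bound for this sum rests on an upper bound for their
number.\<close>

lemma model_graph_rest:
  assumes n: "2 * q + 3 \<le> n"
  defines "F \<equiv> remove_vertices (model_graph n q) {0, Suc 0}"
  shows "card (edges F) = 2 * q" "\<And>j. card (neighbors F j) \<le> 2"
    "{j \<in> vertices F. card (neighbors F j) = 1} \<subseteq> {2, 2 * q + 2}"
proof -
  have E: "edges F = (\<lambda>j. {j, Suc j}) ` {2..<2 * q + 2}"
    unfolding F_def remove_vertices_def model_graph_def by auto
  have "inj_on (\<lambda>j. {j, Suc j}) {2..<2 * q + 2}" by (auto simp: inj_on_def doubleton_eq_iff)
  then show "card (edges F) = 2 * q" unfolding E by (simp add: card_image)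
  have nb: "neighbors F j = {i. (i = Suc j \<and> 2 \<le> j \<and> j < 2 * q + 2) \<or> (j = Suc i \<and> 2 \<le> i \<and> i < 2 * q + 2)}" for j
    unfolding neighbors_def E by (auto simp: doubleton_eq_iff image_iff)
  show "card (neighbors F j) \<le> 2" for j
  proof -
    have "neighbors F j \<subseteq> {Suc j, j - 1}" unfolding nb by auto
    then have "card (neighbors F j) \<le> card {Suc j, j - 1}" by (intro card_mono) auto
    also have "\<dots> \<le> 2" by (rule card_insert_le_m1) auto
    finally show ?thesis .
  qed
  show "{j \<in> vertices F. card (neighbors F j) = 1} \<subseteq> {2, 2 * q + 2}"
  proof
    fix j assume j: "j \<in> {j \<in> vertices F. card (neighbors F j) = 1}"
    have "card (neighbors F j) = 2" if "2 < j" "j < 2 * q + 2"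
    proof -
      have "neighbors F j = {j - 1, Suc j}" unfolding nb using that by auto
      then show ?thesis using that by simp
    qed
    moreover have "neighbors F j = {}" if "j < 2 \<or> 2 * q + 2 < j" unfolding nb using that by auto
    ultimately show "j \<in> {2, 2 * q + 2}" using j by force
  qed
qed

lemma model_graph_lower_bound:
  assumes n: "2 * q + 3 \<le> n" and l: "l > 0"
    and le: "l ^ 4 - l ^ 3 \<le> 2 * ((real n - 2) * l\<^sup>2 + 4 * real q * l + (8 * real q - 2))"
  shows "l \<le> graph_spectral_radius (model_graph n q)"
proof -
  interpret hub_pair "model_graph n q" 0 "Suc 0" by (rule hub_pair_model_graph [OF n])
  note rest = model_graph_rest [OF n, folded H_def]
  have "(\<Sum>w\<in>vertices H. d w) = real (\<Sum>w\<in>vertices H. card (neighbors H w))" by (simp add: d_def)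
  then have D1: "(\<Sum>w\<in>vertices H. d w) = 4 * real q"
    unfolding sum_degrees [OF simple_H] rest(1) by simp
  have "card {j \<in> vertices H. card (neighbors H j) = 1} \<le> card {2, 2 * q + 2}"
    using rest(3) by (intro card_mono) auto
  also have "\<dots> \<le> 2" by (rule card_insert_le_m1) auto
  finally have "8 * q \<le> (\<Sum>w\<in>vertices H. (card (neighbors H w))\<^sup>2) + 2"
    using sum_squared_degrees [OF simple_H rest(2)] rest(1) by linarith
  then have "real (8 * q) \<le> real ((\<Sum>w\<in>vertices H. (card (neighbors H w))\<^sup>2) + 2)" by (rule of_nat_mono)
  then have D2: "8 * real q - 2 \<le> (\<Sum>w\<in>vertices H. (d w)\<^sup>2)" by (simp add: d_def)
  have "card (vertices (model_graph n q)) = n" by (simp add: model_graph_def)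
  then show ?thesis
    using spectral_radius_lower [OF l] le D1 D2 by simp
qed

lemma model_graph_lower_bound_quadratic:
  assumes n: "2 * q + 3 \<le> n" and l: "l > 0" and le: "l\<^sup>2 - l \<le> 2 * (real n - 2)"
  shows "l \<le> graph_spectral_radius (model_graph n q)"
proof -
  interpret hub_pair "model_graph n q" 0 "Suc 0" by (rule hub_pair_model_graph [OF n])
  have "l\<^sup>2 * (l\<^sup>2 - l) \<le> l\<^sup>2 * (2 * (real n - 2))" using le by (intro mult_left_mono) auto
  moreover have "l\<^sup>2 * (l\<^sup>2 - l) = l ^ 4 - l ^ 3" by (simp add: algebra_simps eval_nat_numeral)
  moreover have "(\<Sum>w\<in>vertices H. d w) * l \<ge> 0" "(\<Sum>w\<in>vertices H. (d w)\<^sup>2) \<ge> 0"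
    using l by (auto intro!: sum_nonneg mult_nonneg_nonneg simp: d_def)
  moreover have "card (vertices (model_graph n q)) = n" by (simp add: model_graph_def)
  ultimately show ?thesis
    using spectral_radius_lower [OF l] by (simp add: algebra_simps)
qed

text \<open>The inequality remains true at a slightly larger number, by continuity.\<close>

lemma model_graph_strict:
  assumes n: "2 * q + 3 \<le> n" and l: "l > 0"
    and less: "l ^ 4 - l ^ 3 < 2 * ((real n - 2) * l\<^sup>2 + 4 * real q * l + (8 * real q - 2))"
  shows "l < graph_spectral_radius (model_graph n q)"
proof -
  define f where "f x = 2 * ((real n - 2) * x\<^sup>2 + 4 * real q * x + (8 * real q - 2)) - (x ^ 4 - x ^ 3)" for x :: real
  have "isCont f l" unfolding f_def by (intro continuous_intros)
  then have "f \<midarrow>l\<rightarrow> f l" by (simp add: isCont_def)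
  moreover have "f l > 0" using less by (simp add: f_def)
  ultimately have "eventually (\<lambda>x. f x > 0) (at l)" by (rule order_tendstoD)
  then obtain e where e: "e > 0" "\<And>x. x \<noteq> l \<Longrightarrow> dist x l < e \<Longrightarrow> f x > 0"
    unfolding eventually_at by auto
  define x where "x = l + e / 2"
  have "f x > 0" by (rule e(2)) (use e(1) in \<open>auto simp: x_def dist_real_def\<close>)
  then have "x \<le> graph_spectral_radius (model_graph n q)"
    using l e(1) by (intro model_graph_lower_bound [OF n]) (auto simp: f_def x_def)
  then show ?thesis using e(1) by (simp add: x_def)
qed

text \<open>Three neighbours in \<open>H\<close> of a vertex would form \<open>K33\<close> with it and the two hubs, and a cycle in \<open>H\<close> with the hubs
is the forbidden double wheel.\<close>

lemma hub_pair_linear_forest: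
  assumes hub: "hub_pair G u v" and planar: "planar G"
  shows "linear_forest (remove_vertices G {u, v})"
proof -
  interpret hub_pair G u v by (rule hub)
  have "card (neighbors H w) \<le> 2" for w
  proof (cases "w \<in> vertices H")
    case True
    have "neighbors H w \<subseteq> neighbors G w \<inter> neighbors G u \<inter> neighbors G v"
      using neighbors_rest [OF True] neighbors_hub by auto
    then have "card (neighbors H w) \<le> card (neighbors G w \<inter> neighbors G u \<inter> neighbors G v)"
      using neighbors_simple(2) [OF simple] by (intro card_mono) auto
    also have "\<dots> \<le> 2"
      by (rule planar_common_neighbors [OF simple planar]) (use True hub_facts vertices_H in auto)
    finally show ?thesis .
  next
    case False
    then have "neighbors H w = {}" using simple_graph_edge_subset [OF simple_H] by (auto simp: neighbors_def)
    then show ?thesis by simp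
  qed
  moreover have "acyclic_graph H"
    unfolding acyclic_graph_def
  proof
    assume "\<exists>cs. distinct cs \<and> length cs \<ge> 3 \<and> walk_edges (cs @ [hd cs]) \<subseteq> edges H"
    then obtain cs where cs: "distinct cs" "length cs \<ge> 3" "walk_edges (cs @ [hd cs]) \<subseteq> edges H" by blast
    have "set (cs @ [hd cs]) = \<Union> (walk_edges (cs @ [hd cs]))"
      by (rule Union_walk_edges [symmetric]) (use cs(2) in simp)
    also have "\<dots> \<subseteq> vertices H" using cs(3) simple_graph_edge_subset [OF simple_H] by blast
    finally have sub: "set cs \<subseteq> vertices G - {u, v}" using vertices_H by simp
    have "edges H \<subseteq> edges G" by (auto simp: H_def remove_vertices_def)
    then have walk: "walk_edges (cs @ [hd cs]) \<subseteq> edges G" using cs(3) by blast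
    show False
      by (rule planar_no_double_wheel [OF simple planar cs(1,2) walk uv]) (use sub hubs in auto)
  qed
  ultimately show ?thesis using simple_H unfolding linear_forest_def H_def by simp
qed

text \<open>The order is large enough to match \<open>u\<close> and \<open>v\<close> with vertices that \<open>M\<close> leaves free.\<close>

lemma hub_pair_matching:
  assumes hub: "hub_pair G u v" and M: "matching (remove_vertices G {u, v}) M"
    and large: "2 * matching_number G + 4 \<le> card (vertices G)"
  shows "card M + 2 \<le> matching_number G"
proof -
  interpret hub_pair G u v by (rule hub)
  have ME: "M \<subseteq> edges G" "\<And>e. e \<in> M \<Longrightarrow> e \<inter> {u, v} = {}"
    using M unfolding matching_def remove_vertices_def by auto
  have MG: "matching G M" using M ME(1) unfolding matching_def by simp
  have finM: "finite M" using ME(1) simple_graph_finite_edges [OF simple] finite_subset by blast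
  have "card (\<Union>M) \<le> (\<Sum>e\<in>M. card e)" by (rule card_Union_le_sum_card)
  also have "\<dots> \<le> (\<Sum>e\<in>M. 2)"
  proof (rule sum_mono)
    fix e assume "e \<in> M"
    then obtain a b where "e = {a, b}" using ME(1) simple_graph_edgeE [OF simple, of e] by blast
    then show "card e \<le> 2" by (simp add: card_insert_le_m1)
  qed
  finally have cM: "card (\<Union>M) \<le> 2 * matching_number G"
    using matching_number_ge [OF simple MG] by simp
  have "card (vertices G) - 2 = card (vertices H)"
    using card_vertices_H by linarith
  then have "2 \<le> card (vertices H - \<Union>M)"
    using diff_card_le_card_Diff [of "\<Union>M" "vertices H"] cM large finM
      ME(1) simple_graph_edge_subset [OF simple] hub_facts(4) finite_subset [of "\<Union>M" "vertices G"] by fastforce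
  then obtain T where "T \<subseteq> vertices H - \<Union>M" "card T = 2" using obtain_subset_with_card_n by metis
  then obtain w w' where w: "w \<in> vertices H" "w' \<in> vertices H" "w \<noteq> w'" "w \<notin> \<Union>M" "w' \<notin> \<Union>M"
    by (auto simp: card_2_iff)
  have dis: "{u, w} \<inter> {v, w'} = {}" "\<And>e. e \<in> M \<Longrightarrow> {u, w} \<inter> e = {} \<and> {v, w'} \<inter> e = {}"
    using w hub_facts(1) ME(2) vertices_H(1) by auto
  have "matching G (insert {u, w} (insert {v, w'} M))"
    using MG hubs w(1,2) vertices_H(1) dis unfolding matching_def pairwise_insert disjnt_def by auto
  moreover have "card (insert {u, w} (insert {v, w'} M)) = card M + 2"
  proof -
    have "{v, w'} \<notin> M" "{u, w} \<notin> insert {v, w'} M" using dis by auto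
    then show ?thesis using finM by simp
  qed
  ultimately show ?thesis using matching_number_ge [OF simple] by metis
qed

text \<open>Either an edge is missing, which costs \<open>2 * \<mu>\<close> in the linear term, or there are two further leaves, which costs 2 in
the constant term; each outweighs the error \<open>2 * D / (\<mu> - 2)\<close>.\<close>

lemma hub_pair_strict_bound:
  fixes \<mu> e D q n :: real
  assumes mu: "\<mu> > 16 * q + 2" and q: "q \<ge> 1"
    and le: "\<mu> ^ 4 - \<mu> ^ 3 \<le> 2 * ((n - 2) * \<mu>\<^sup>2 + 2 * e * \<mu> + D * (1 + 2 / (\<mu> - 2)))"
    and cases: "2 * e \<le> 4 * q - 2 \<and> D \<le> 8 * q \<or> e \<le> 2 * q \<and> D \<le> 8 * q - 4"
  shows "\<mu> ^ 4 - \<mu> ^ 3 < 2 * ((n - 2) * \<mu>\<^sup>2 + 4 * q * \<mu> + (8 * q - 2))"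
proof -
  have mu2: "\<mu> - 2 > 0" "\<mu> > 18" using mu q by auto
  have "2 * e * \<mu> + D * (1 + 2 / (\<mu> - 2)) < 4 * q * \<mu> + (8 * q - 2)"
    using cases
  proof
    assume A: "2 * e \<le> 4 * q - 2 \<and> D \<le> 8 * q"
    have "2 * e * \<mu> \<le> (4 * q - 2) * \<mu>" using A mu2 by (intro mult_right_mono) auto
    moreover have "D * (1 + 2 / (\<mu> - 2)) \<le> 8 * q * (1 + 2 / (\<mu> - 2))"
      using A mu2 by (intro mult_right_mono) auto
    moreover have "8 * q * (2 / (\<mu> - 2)) < 1" using mu mu2 by (simp add: divide_less_eq)
    moreover have "8 * q * (1 + 2 / (\<mu> - 2)) = 8 * q + 8 * q * (2 / (\<mu> - 2))" "(4 * q - 2) * \<mu> = 4 * q * \<mu> - 2 * \<mu>"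
      by (simp_all only: distrib_left mult_1_right left_diff_distrib)
    ultimately show ?thesis using mu2(2) by linarith
  next
    assume A: "e \<le> 2 * q \<and> D \<le> 8 * q - 4"
    have "2 * e * \<mu> \<le> 4 * q * \<mu>" using A mu2 by (intro mult_right_mono) auto
    moreover have "D * (1 + 2 / (\<mu> - 2)) \<le> (8 * q - 4) * (1 + 2 / (\<mu> - 2))"
      using A mu2 by (intro mult_right_mono) auto
    moreover have "(8 * q - 4) * (2 / (\<mu> - 2)) < 1" using mu mu2 q by (simp add: divide_less_eq)
    moreover have "(8 * q - 4) * (1 + 2 / (\<mu> - 2)) = 8 * q - 4 + (8 * q - 4) * (2 / (\<mu> - 2))"
      by (rule ring_class.ring_distribs(1) [of "8 * q - 4" 1, unfolded mult_1_right])
    ultimately show ?thesis by linarith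
  qed
  moreover have "L < 2 * (c + a + b)" if "x + z < a + b" "L \<le> 2 * (c + x + z)" for L a b c x z :: real
    using that by argo
  ultimately show ?thesis using le by blast
qed

theorem model_graph_extremal:
  fixes G :: "nat ugraph"
  assumes G: "simple_graph G" "planar G" "card (vertices G) = n" "matching_number G \<le> q + 2"
    and large: "real n \<ge> 10 ^ 5 * (2 * real q + 4) ^ 6"
    and rho: "graph_spectral_radius (model_graph n q) \<le> graph_spectral_radius G"
  shows "isomorphic (model_graph n q) G"
proof -
  define s where "s = 2 * real q + 4"
  have s: "s \<ge> 4" by (simp add: s_def)
  have "s ^ 1 \<le> s ^ 6" using s by (intro power_increasing) auto
  then have "s \<le> s ^ 6" by simp
  then have "10 ^ 5 * s \<le> 10 ^ 5 * s ^ 6" by simp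
  also have "\<dots> \<le> real n" using large unfolding s_def .
  finally have "100000 * s \<le> real n" by simp
  then have "200000 * real q + 400000 \<le> real n" unfolding s_def by simp
  then have "2 * q + 8 \<le> n" by linarith
  then have n: "2 * q + 3 \<le> n" "2 * (q + 2) + 4 \<le> n" "n \<ge> 4" by simp_all
  \<comment> \<open>The spectral radius of the join of \<open>K2\<close> with isolated vertices.\<close>
  define l where "l = (1 + sqrt (1 + 8 * (real n - 2))) / 2"
  have sq: "(sqrt (1 + 8 * (real n - 2)))\<^sup>2 = 1 + 8 * (real n - 2)" using n by simp
  have l: "l \<ge> 1 / 2" "l > 0" using n unfolding l_def by (auto simp: add_pos_nonneg)
  have l_eq: "l\<^sup>2 - l = 2 * (real n - 2)"
    using sq unfolding l_def by (simp add: power2_eq_square field_simps)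
  define \<mu> where "\<mu> = graph_spectral_radius G"
  have "l \<le> graph_spectral_radius (model_graph n q)"
    by (rule model_graph_lower_bound_quadratic [OF n(1) l(2)]) (use l_eq in simp)
  then have lmu: "l \<le> \<mu>" using rho by (simp add: \<mu>_def)
  have mu_quad: "\<mu>\<^sup>2 - \<mu> \<ge> 2 * (real n - 2)"
  proof -
    have "(\<mu> - l) * (\<mu> + l - 1) \<ge> 0" using lmu l by (intro mult_nonneg_nonneg) auto
    then have "\<mu>\<^sup>2 - \<mu> \<ge> l\<^sup>2 - l" by (simp add: algebra_simps power2_eq_square)
    then show ?thesis using l_eq by simp
  qed
  obtain S where S: "S \<subseteq> vertices G" "card S \<le> 2 * matching_number G" "\<And>e. e \<in> edges G \<Longrightarrow> e \<inter> S \<noteq> {}"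
    using matching_vertex_cover [OF G(1)] by metis
  have "card S \<le> 2 * q + 4" using S(2) G(4) by simp
  then have cS: "real (card S) \<le> s" unfolding s_def by linarith
  interpret near: near_extremal G S s
    by unfold_locales
      (use G S cS s large lmu l mu_quad in \<open>auto simp: s_def \<mu>_def\<close>)
  obtain u v where hub: "hub_pair G u v" using near.hub_pair_exists by blast
  interpret hub_pair G u v by (rule hub)
  have "s ^ 1 \<le> s ^ 3" using s by (intro power_increasing) auto
  then have mu_s: "\<mu> \<ge> 400 * s" using near.mu(1) unfolding near.\<mu>_def \<mu>_def by simp
  have lf: "linear_forest H" unfolding H_def by (rule hub_pair_linear_forest [OF hub G(2)])
  have degH: "card (neighbors H w) \<le> 2" for w using lf unfolding linear_forest_def by simp
  obtain M where M: "matching H M" "card (edges H) \<le> 2 * card M" using linear_forest_matching [OF lf] by blast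
  have "card M + 2 \<le> matching_number G"
    by (rule hub_pair_matching [OF hub]) (use M(1) G n in \<open>auto simp: H_def\<close>)
  then have e: "card (edges H) \<le> 2 * q" using M(2) G(4) by simp
  have fin_path: "isomorphic (model_graph n q) G"
    if "distinct xs" "length xs = 2 * q + 1" "set xs \<subseteq> vertices H" "edges H = walk_edges xs" for xs
    by (rule isomorphic_model_graph [OF hub that(1,2)]) (use that G vertices_H in \<open>auto simp: H_def\<close>)
  show ?thesis
  proof (cases "q = 0")
    case True
    then have "edges H = {}" using e simple_graph_finite_edges [OF simple_H] by simp
    have "real (card (vertices H)) > 0" using card_vertices_H n G(3) by simp
    then obtain w where "w \<in> vertices H" by (metis all_not_in_conv card.empty less_irrefl of_nat_0)
    then show ?thesis using fin_path [of "[w]"] True \<open>edges H = {}\<close> by simp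
  next
    case False
    let ?n1 = "card {w \<in> vertices H. card (neighbors H w) = 1}"
    have sumd: "(\<Sum>w\<in>vertices H. d w) = 2 * real (card (edges H))"
    proof -
      have "(\<Sum>w\<in>vertices H. d w) = real (\<Sum>w\<in>vertices H. card (neighbors H w))" by (simp add: d_def)
      then show ?thesis unfolding sum_degrees [OF simple_H] by simp
    qed
    have sumd2: "(\<Sum>w\<in>vertices H. (d w)\<^sup>2) + real ?n1 = 4 * real (card (edges H))"
    proof -
      have "(\<Sum>w\<in>vertices H. (d w)\<^sup>2) + real ?n1 = real ((\<Sum>w\<in>vertices H. (card (neighbors H w))\<^sup>2) + ?n1)"
        by (simp add: d_def)
      then show ?thesis unfolding sum_squared_degrees [OF simple_H degH] by simp
    qed
    have mu_pos: "\<mu> > 0" "\<mu> > 2" "\<mu> > 16 * real q + 2" 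
    proof -
      have "800 * real q + 1600 \<le> \<mu>" using mu_s unfolding s_def by simp
      then show "\<mu> > 0" "\<mu> > 2" "\<mu> > 16 * real q + 2" by linarith+
    qed
    have up: "\<mu> ^ 4 - \<mu> ^ 3 \<le> 2 * ((real n - 2) * \<mu>\<^sup>2 + 2 * real (card (edges H)) * \<mu>
      + (\<Sum>w\<in>vertices H. (d w)\<^sup>2) * (1 + 2 / (\<mu> - 2)))"
      using spectral_radius_upper mu_pos(2) degH unfolding \<mu>_def sumd G(3) by (simp add: d_def)
    have not_strict: "\<not> \<mu> ^ 4 - \<mu> ^ 3 < 2 * ((real n - 2) * \<mu>\<^sup>2 + 4 * real q * \<mu> + (8 * real q - 2))"
      using model_graph_strict [OF n(1) mu_pos(1)] rho unfolding \<mu>_def by linarith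
    have no: "\<not> (2 * real (card (edges H)) \<le> 4 * real q - 2 \<and> (\<Sum>w\<in>vertices H. (d w)\<^sup>2) \<le> 8 * real q
       \<or> real (card (edges H)) \<le> 2 * real q \<and> (\<Sum>w\<in>vertices H. (d w)\<^sup>2) \<le> 8 * real q - 4)"
      using hub_pair_strict_bound [OF mu_pos(3) _ up] not_strict False by auto
    have "card (edges H) = 2 * q"
    proof (rule ccontr)
      assume "card (edges H) \<noteq> 2 * q"
      then have "2 * card (edges H) + 2 \<le> 4 * q" using e by simp
      then have "2 * real (card (edges H)) \<le> 4 * real q - 2" by linarith
      moreover have "(\<Sum>w\<in>vertices H. (d w)\<^sup>2) \<le> 8 * real q" using sumd2 e by linarith
      ultimately show False using no by blast
    qed
    then have e2: "real (card (edges H)) = 2 * real q" by simp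
    have "\<not> ?n1 \<ge> 4"
    proof
      assume "?n1 \<ge> 4"
      then have "(\<Sum>w\<in>vertices H. (d w)\<^sup>2) \<le> 8 * real q - 4" using sumd2 e2 by linarith
      then show False using no e2 by simp
    qed
    moreover have "edges H \<noteq> {}" using \<open>card (edges H) = 2 * q\<close> False by auto
    ultimately obtain xs where "distinct xs" "edges H = walk_edges xs" "length xs = Suc (card (edges H))" "set xs \<subseteq> vertices H"
      using linear_forest_one_or_two_paths [OF lf] by blast
    then show ?thesis using fin_path [of xs] \<open>card (edges H) = 2 * q\<close> by simp
  qed
qed

section \<open>Matching number one\<close>

lemma star_graph_lower_bound:
  assumes "n \<ge> 2"
  shows "sqrt (real n - 1) \<le> graph_spectral_radius (star_graph n)"
proof (rule spectral_radius_ge_of_subsolution [OF simple_star_graph, of n "\<lambda>j. if j = 0 then sqrt (real n - 1) else 1" 1])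
  have E: "neighbors (star_graph n) j = (if j = 0 then {1..<n} else if j < n then {0} else {})" for j
    unfolding neighbors_def star_graph_def by (auto simp: doubleton_eq_iff)
  fix j assume "j \<in> vertices (star_graph n)"
  then show "sqrt (real n - 1) * (if j = 0 then sqrt (real n - 1) else 1)
      \<le> (\<Sum>w\<in>neighbors (star_graph n) j. if w = 0 then sqrt (real n - 1) else 1)"
    using assms unfolding E by (auto simp: star_graph_def of_nat_diff)
qed (use assms in \<open>auto simp: star_graph_def\<close>)

lemma simple_graph_edge_at:
  assumes "simple_graph G" "e \<in> edges G" "x \<in> e"
  obtains y where "e = {x, y}"
proof -
  obtain a b where "e = {a, b}" using simple_graph_edgeE [OF assms(1,2)] .
  then show ?thesis using that [of a] that [of b] assms(3) by (auto simp: insert_commute)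
qed

text \<open>If neither end of an edge \<open>{a, b}\<close> lies on all edges, there are edges \<open>{b, c}\<close> and \<open>{a, c}\<close>, and an edge that
meets all three is contained in the triangle.\<close>

lemma intersecting_edges:
  assumes G: "simple_graph G" and e: "edges G \<noteq> {}"
    and meet: "\<And>e e'. e \<in> edges G \<Longrightarrow> e' \<in> edges G \<Longrightarrow> e \<inter> e' \<noteq> {}"
  obtains (star) x where "x \<in> vertices G" "\<And>e. e \<in> edges G \<Longrightarrow> x \<in> e"
    | (triangle) a b c where "\<And>e. e \<in> edges G \<Longrightarrow> e \<subseteq> {a, b, c}"
proof -
  obtain a b where ab: "{a, b} \<in> edges G" "a \<in> vertices G" "b \<in> vertices G" "a \<noteq> b"
    using e simple_graph_edgeE [OF G] by (metis ex_in_conv)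
  show ?thesis
  proof (cases "(\<forall>e\<in>edges G. a \<in> e) \<or> (\<forall>e\<in>edges G. b \<in> e)")
    case True
    then show ?thesis using star ab by blast
  next
    case False
    then obtain e1 e2 where e1: "e1 \<in> edges G" "a \<notin> e1" and e2: "e2 \<in> edges G" "b \<notin> e2" by blast
    have "b \<in> e1" "a \<in> e2" using meet [OF e1(1) ab(1)] meet [OF e2(1) ab(1)] e1(2) e2(2) by auto
    then obtain c c' where c: "e1 = {b, c}" and c': "e2 = {a, c'}"
      using simple_graph_edge_at [OF G e1(1)] simple_graph_edge_at [OF G e2(1)] by metis
    have "c' = c" using meet [OF e1(1) e2(1)] c c' e1(2) e2(2) by auto
    have "f \<subseteq> {a, b, c}" if f: "f \<in> edges G" for f
    proof -
      obtain x y where xy: "f = {x, y}" using simple_graph_edgeE [OF G f] by metis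
      have "f \<inter> {a, b} \<noteq> {}" "f \<inter> {b, c} \<noteq> {}" "f \<inter> {a, c} \<noteq> {}"
        using meet [OF f ab(1)] meet [OF f e1(1)] meet [OF f e2(1)] c c' \<open>c' = c\<close> by auto
      then show ?thesis using xy e1(2) e2(2) c c' \<open>c' = c\<close> ab(4) by auto
    qed
    then show ?thesis by (rule triangle)
  qed
qed

text \<open>Inside a triangle all degrees are at most 2, so the spectral radius is at most 2. If all edges contain
\<open>x\<close>, the square of the spectral radius is at most the degree of \<open>x\<close>, which must therefore be \<open>n - 1\<close>.\<close>

theorem star_graph_extremal:
  fixes G :: "nat ugraph"
  assumes G: "simple_graph G" "card (vertices G) = n" "matching_number G \<le> 1"
    and n: "n \<ge> 6"
    and rho: "graph_spectral_radius (star_graph n) \<le> graph_spectral_radius G"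
  shows "isomorphic (star_graph n) G"
proof -
  define \<mu> where "\<mu> = graph_spectral_radius G"
  have sqn: "sqrt (real n - 1) \<le> \<mu>" using star_graph_lower_bound [of n] n rho by (simp add: \<mu>_def)
  have "sqrt 4 < sqrt (real n - 1)" using n by (subst real_sqrt_less_iff) simp
  then have mu: "\<mu> > 2" using sqn by simp
  have "(sqrt (real n - 1))\<^sup>2 \<le> \<mu>\<^sup>2" using sqn n by (intro power_mono) auto
  then have mun: "real n - 1 \<le> \<mu>\<^sup>2" using n by simp
  have V: "vertices G \<noteq> {}" "finite (vertices G)" using G n by (auto simp: simple_graph_def)
  obtain y where y: "\<And>v. y v \<ge> 0" "\<exists>v\<in>vertices G. y v > 0"
    and sub: "\<And>v. v \<in> vertices G \<Longrightarrow> \<mu> * y v \<le> (\<Sum>w\<in>neighbors G v. y w)"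
    using spectral_radius_subsolution [OF G(1) V(1)] unfolding \<mu>_def by blast
  have meet: "e \<inter> e' \<noteq> {}" if e: "e \<in> edges G" "e' \<in> edges G" for e e'
  proof
    assume dis: "e \<inter> e' = {}"
    have "e \<noteq> {}" using simple_graph_edgeE [OF G(1) e(1)] by blast
    then have "card {e, e'} = 2" using dis by (auto simp: card_2_iff)
    moreover have "matching G {e, e'}"
      using e dis unfolding matching_def pairwise_insert disjnt_def by auto
    ultimately show False using matching_number_ge [OF G(1), of "{e, e'}"] G(3) by simp
  qed
  have "edges G \<noteq> {}"
  proof
    assume "edges G = {}"
    then have "neighbors G v = {}" for v by (simp add: neighbors_def)
    moreover obtain v where "v \<in> vertices G" "y v > 0" using y(2) by blast
    ultimately show False using sub [of v] mu by (simp add: mult_le_0_iff)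
  qed
  show ?thesis
  proof (rule intersecting_edges [OF G(1) \<open>edges G \<noteq> {}\<close> meet])
    fix x assume star: "x \<in> vertices G" "\<And>e. e \<in> edges G \<Longrightarrow> x \<in> e"
    have nx: "neighbors G w \<subseteq> {x}" if "w \<noteq> x" for w
      using star(2) that by (auto simp: neighbors_def)
    define L where "L = neighbors G x"
    have L: "L \<subseteq> vertices G - {x}" "finite L" using neighbors_simple [OF G(1), of x] by (auto simp: L_def)
    have yw: "\<mu> * y w \<le> y x" if "w \<in> vertices G - {x}" for w
    proof -
      have "(\<Sum>z\<in>neighbors G w. y z) \<le> (\<Sum>z\<in>{x}. y z)"
        using nx [of w] that y(1) by (intro sum_mono2) auto
      then show ?thesis using sub [of w] that by simp
    qed
    have "y x > 0"
    proof (rule ccontr)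
      assume "\<not> y x > 0"
      then have "y x = 0" using y(1) [of x] by simp
      then have "y w \<le> 0" if "w \<in> vertices G" for w
        using yw [of w] that mu by (cases "w = x") (auto simp: mult_le_0_iff)
      then show False using y(2) by force
    qed
    have "\<mu> * (\<mu> * y x) \<le> \<mu> * (\<Sum>w\<in>L. y w)"
      using sub [OF star(1)] mu unfolding L_def by (intro mult_left_mono) auto
    also have "\<dots> = (\<Sum>w\<in>L. \<mu> * y w)" by (rule sum_distrib_left)
    also have "\<dots> \<le> (\<Sum>w\<in>L. y x)" using yw L by (intro sum_mono) auto
    finally have "\<mu>\<^sup>2 * y x \<le> real (card L) * y x" by (simp add: power2_eq_square)
    then have "\<mu>\<^sup>2 \<le> real (card L)" using \<open>y x > 0\<close> by simp
    then have "real n - 1 \<le> real (card L)" using mun by linarith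
    then have "card (vertices G - {x}) \<le> card L" using G(2) star(1) V by (simp add: of_nat_diff)
    then have Leq: "L = vertices G - {x}" using L V by (metis card_seteq finite_Diff)
    have "edges G = {{x, w} | w. w \<in> vertices G - {x}}"
    proof
      show "edges G \<subseteq> {{x, w} | w. w \<in> vertices G - {x}}"
      proof
        fix e assume e: "e \<in> edges G"
        obtain p r where "e = {p, r}" "p \<in> vertices G" "r \<in> vertices G" "p \<noteq> r"
          using simple_graph_edgeE [OF G(1) e] .
        then show "e \<in> {{x, w} | w. w \<in> vertices G - {x}}" using star(2) [OF e] by blast
      qed
      show "{{x, w} | w. w \<in> vertices G - {x}} \<subseteq> edges G"
        unfolding Leq [symmetric] L_def neighbors_def by auto
    qed
    then show ?thesis by (rule isomorphic_star_graph [OF G(1) star(1) _ G(2)])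
  next
    fix a b c assume triangle: "\<And>e. e \<in> edges G \<Longrightarrow> e \<subseteq> {a, b, c}"
    define m where "m = Max (y ` vertices G)"
    have "m \<in> y ` vertices G" unfolding m_def by (rule Max_in) (use V in auto)
    then obtain z where z: "z \<in> vertices G" "y z = m" by auto
    have le: "y w \<le> m" if "w \<in> vertices G" for w unfolding m_def using that V by auto
    have m: "m > 0" using y(2) le by fastforce
    have "card (neighbors G z) \<le> 2"
    proof (cases "neighbors G z = {}")
      case False
      then have sub3: "neighbors G z \<subseteq> {a, b, c} - {z}" "z \<in> {a, b, c}"
        using triangle neighbors_simple(3) [OF G(1), of z] unfolding neighbors_def by auto
      have "card {a, b, c} \<le> 3" by (rule card_insert_le_m1) (auto intro: card_insert_le_m1)
      then have "card ({a, b, c} - {z}) \<le> 2" using sub3(2) by (simp only: card_Diff_singleton)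
      then show ?thesis using card_mono [OF _ sub3(1)] by auto
    qed simp
    then have "(\<Sum>w\<in>neighbors G z. y w) \<le> 2 * m"
      by (intro sum_le_card_mult) (use le m neighbors_simple(1) [OF G(1)] in auto)
    then have "\<mu> * m \<le> 2 * m" using sub [OF z(1)] z(2) by simp
    then show ?thesis using m mu by simp
  qed
qed

section \<open>Spectral extremal graphs\<close>

text \<open>The assumption on \<open>M\<close> also yields that \<open>M\<close> is a maximizer, because isomorphic graphs have the same spectral radius.\<close>

lemma unique_spectral_maximizer:
  assumes simple: "\<And>G. G \<in> \<G> \<Longrightarrow> simple_graph G" and M: "M \<in> \<G>"
    and core: "\<And>G. G \<in> \<G> \<Longrightarrow> graph_spectral_radius M \<le> graph_spectral_radius G \<Longrightarrow> isomorphic M G"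
  shows "iso_class ` spectral_maximizers \<G> = {iso_class M}"
proof -
  have le: "graph_spectral_radius G \<le> graph_spectral_radius M" if G: "G \<in> \<G>" for G
  proof (cases "graph_spectral_radius M \<le> graph_spectral_radius G")
    case True
    have "isomorphic G M"
      by (rule isomorphic_sym [OF core [OF G True]]) (rule simple_graph_edge_subset [OF simple [OF M]])
    then show ?thesis by (rule isomorphic_spectral_radius [OF simple [OF G] simple [OF M]])
  qed simp
  then have max: "M \<in> spectral_maximizers \<G>" using M by (simp add: spectral_maximizers_def)
  have "iso_class G = iso_class M" if "G \<in> spectral_maximizers \<G>" for G
  proof -
    have G: "G \<in> \<G>" "graph_spectral_radius M \<le> graph_spectral_radius G"
      using that M by (auto simp: spectral_maximizers_def)
    show ?thesis
      by (rule iso_class_eqI [symmetric]) (use simple M G core in auto)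
  qed
  then show ?thesis using max by blast
qed

lemma exponential_beats_power:
  assumes "k \<ge> 28"
  shows "10 ^ 5 * (2 * real k) ^ 6 \<le> 10 * 4 ^ (k - 2)"
  using assms
proof (induction k rule: dec_induct)
  case (step k)
  have k: "real k \<ge> 28" using step by simp
  have "2 * real (Suc k) \<le> 6 / 5 * (2 * real k)" using k by simp
  then have "(2 * real (Suc k)) ^ 6 \<le> (6 / 5 * (2 * real k)) ^ 6" by (intro power_mono) auto
  also have "\<dots> = (6 / 5) ^ 6 * (2 * real k) ^ 6" by (rule power_mult_distrib)
  also have "\<dots> \<le> 4 * (2 * real k) ^ 6" by (intro mult_right_mono) (auto simp: eval_nat_numeral)
  finally have "10 ^ 5 * (2 * real (Suc k)) ^ 6 \<le> 4 * (10 ^ 5 * (2 * real k) ^ 6)" by simp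
  also have "\<dots> \<le> 4 * (10 * 4 ^ (k - 2))" using step.IH by simp
  also have "\<dots> = 10 * 4 ^ (Suc k - 2)"
  proof -
    have "Suc k - 2 = Suc (k - 2)" using step by simp
    then show ?thesis by (simp only: power_Suc)
  qed
  finally show ?case .
qed simp

text \<open>The first term of the maximum settles \<open>k < 28\<close>, and from \<open>k = 28\<close> on the exponential term exceeds the power.\<close>

lemma order_large:
  fixes k n :: nat and N :: real
  assumes k: "k \<ge> 2"
    and N: "N = max (2.67 * 9 ^ 17) (10.2 * 2 powr (2 * real k - 4) + 2)" and n: "real n \<ge> N"
  shows "real n \<ge> 10 ^ 5 * (2 * real k) ^ 6"
proof (cases "k \<ge> 28")
  case True
  have "2 * real k - 4 = real (2 * (k - 2))" using k by (simp add: of_nat_diff)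
  then have "2 powr (2 * real k - 4) = (2::real) ^ (2 * (k - 2))" by (simp only: powr_realpow zero_less_numeral)
  also have "\<dots> = 4 ^ (k - 2)" by (simp add: power_mult)
  finally have p: "2 powr (2 * real k - 4) = (4::real) ^ (k - 2)" .
  have "(0::real) \<le> 4 ^ (k - 2)" by simp
  then have "10 * 4 ^ (k - 2) \<le> 10.2 * 2 powr (2 * real k - 4) + 2" unfolding p by linarith
  also have "\<dots> \<le> real n" using N n by simp
  finally show ?thesis using exponential_beats_power [OF True] by linarith
next
  case False
  then have "(2 * real k) ^ 6 \<le> 56 ^ 6" by (intro power_mono) auto
  then have "10 ^ 5 * (2 * real k) ^ 6 \<le> 2.67 * 9 ^ 17" by simp
  also have "\<dots> \<le> real n" using N n by simp
  finally show ?thesis .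
qed

text \<open>Both families of graphs have matching number at most \<open>k\<close> and contain \<open>X\<close>, so it suffices that \<open>X\<close> is extremal
among all planar graphs with matching number at most \<open>k\<close>.\<close>

lemma SPEX_from_representative:
  assumes X: "X \<in> planar_graphs n" "matching_number X = k" "isomorphic X M"
    and core: "\<And>G. G \<in> planar_graphs n \<Longrightarrow> matching_number G \<le> k \<Longrightarrow>
       graph_spectral_radius X \<le> graph_spectral_radius G \<Longrightarrow> isomorphic X G"
  shows "SPEX_planar n (copies (k + 1) (complete_graph 2)) = {iso_class M} \<and>
         iso_class ` spectral_maximizers {G \<in> planar_graphs n. matching_number G = k} = {iso_class M}"
proof -
  have simple: "simple_graph G" if "G \<in> planar_graphs n" for G using that by (simp add: planar_graphs_def)
  have sM: "simple_graph M" using isomorphic_simple_graph [OF X(3) simple [OF X(1)]] .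
  have same: "iso_class X = iso_class M" by (rule iso_class_eqI [OF simple [OF X(1)] sM X(3)])
  have "{G \<in> planar_graphs n. free_of (copies (k + 1) (complete_graph 2)) G} = {G \<in> planar_graphs n. matching_number G \<le> k}"
  proof -
    have "free_of (copies (k + 1) (complete_graph 2)) G \<longleftrightarrow> matching_number G \<le> k" if "G \<in> planar_graphs n" for G
      unfolding Suc_eq_plus1 [symmetric] by (rule free_of_copies_K2_iff [OF simple [OF that]])
    then show ?thesis by blast
  qed
  moreover have "iso_class ` spectral_maximizers {G \<in> planar_graphs n. matching_number G \<le> k} = {iso_class X}"
    by (rule unique_spectral_maximizer) (use X core simple in auto)
  moreover have "iso_class ` spectral_maximizers {G \<in> planar_graphs n. matching_number G = k} = {iso_class X}"
    by (rule unique_spectral_maximizer) (use X core simple in auto)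
  ultimately show ?thesis unfolding SPEX_planar_def same by simp
qed

theorem theorem1p4:
  fixes k n :: nat and N :: real
  assumes "k \<ge> 1"
    and "N = max (2.67 * 9 ^ 17) (10.2 * 2 powr (2 * real k - 4) + 2)"
    and "real n \<ge> N + 3 / 2 * sqrt (2 * N - 6)"
  shows "SPEX_planar n (copies (k + 1) (complete_graph 2)) = {iso_class (M_graph n k)} \<and>
         iso_class ` spectral_maximizers {G \<in> planar_graphs n. matching_number G = k}
             = {iso_class (M_graph n k)}"
proof -
  have "2.67 * 9 ^ 17 \<le> N" using assms(2) by simp
  then have N6: "N \<ge> 6" by simp
  then have "sqrt (2 * N - 6) \<ge> 0" by simp
  then have nN: "real n \<ge> N" using assms(3) by linarith
  then have n6: "n \<ge> 6" using N6 by linarith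
  show ?thesis
  proof (cases "k = 1")
    case True
    have "planar (star_graph n)"
      by (rule planar_model_subgraph [of _ n 0]) (use n6 in \<open>auto simp: star_graph_def model_graph_def\<close>)
    then have "star_graph n \<in> planar_graphs n"
      using simple_star_graph by (simp add: planar_graphs_def) (simp add: star_graph_def)
    then show ?thesis
    proof (rule SPEX_from_representative)
      show "matching_number (star_graph n) = k" using matching_number_star_graph n6 True by simp
      show "isomorphic (star_graph n) (M_graph n k)" using isomorphic_star_M_graph n6 True by simp
      show "isomorphic (star_graph n) G" if "G \<in> planar_graphs n" "matching_number G \<le> k"
        "graph_spectral_radius (star_graph n) \<le> graph_spectral_radius G" for G
        by (rule star_graph_extremal) (use that n6 True in \<open>auto simp: planar_graphs_def\<close>)
    qed
  next
    case False
    define q where "q = k - 2"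
    have k: "k = q + 2" "k \<ge> 2" using False assms(1) by (auto simp: q_def)
    have large: "real n \<ge> 10 ^ 5 * (2 * real q + 4) ^ 6"
    proof -
      have "2 * real k = 2 * real q + 4" using k(1) by simp
      then show ?thesis using order_large [OF k(2) assms(2) nN] by (simp only:)
    qed
    have "2 * real k \<le> (2 * real k) ^ 6" using k(2) by (intro self_le_power) auto
    then have "2 * real k \<le> real n" using order_large [OF k(2) assms(2) nN] by simp
    then have n: "2 * q + 4 \<le> n" using k(1) by linarith
    have "planar (model_graph n q)"
      by (rule planar_model_subgraph [of _ n q]) (use n in \<open>auto simp: model_graph_def\<close>)
    then have "model_graph n q \<in> planar_graphs n"
      using simple_model_graph [of q n] n by (simp add: planar_graphs_def) (simp add: model_graph_def)
    then show ?thesis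
    proof (rule SPEX_from_representative)
      show "matching_number (model_graph n q) = k" using matching_number_model_graph [OF n] k by simp
      show "isomorphic (model_graph n q) (M_graph n k)"
        using isomorphic_model_M_graph [OF k(2), of n] n k unfolding q_def by simp
      show "isomorphic (model_graph n q) G" if "G \<in> planar_graphs n" "matching_number G \<le> k"
        "graph_spectral_radius (model_graph n q) \<le> graph_spectral_radius G" for G
        by (rule model_graph_extremal [OF _ _ _ _ large]) (use that k in \<open>auto simp: planar_graphs_def\<close>)
    qed
  qed
qed

end
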